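(* Let $T$ be a transient, simple, proper plane triangulation with bounded local geometry and root $\rho$. Let $\mathcal S_\rho$ be a rectangle tiling of $T$ in the cylinder $\mathbb R/\eta\mathbb Z\times[0,1]$ and let $\mathcal C$ be a circle packing of $T$ in the unit disc $\mathbb D$ with associated embedding $z$. Then: (1) a sequence of vertices $\langle v_n\rangle_{n\geq0}$ of $T$ satisfies that $z(v_n)$ converges to a point of $\partial\mathbb D$ if and only if $y(v_n)\to1$ and $\theta(v_n)$ converges to a point of $\mathbb R/\eta\mathbb Z$; (2) the map $\xi\mapsto\lim_{i\to\infty}\theta(v_i)$, where $z(v_i)\to\xi$ (well defined by (1)), is a homeomorphism from $\partial\mathbb D$ onto $\mathbb R/\eta\mathbb Z$.
   Context: A network is a connected locally finite graph $G=(V,E)$ with conductances $c:E\to(0,\infty)$; the random walk moves from $u$ to $v$ with probability $c(u,v)/c(u)$; $P_v$ is its law from $v$. Bounded local geometry: there is $M$ with all degrees $\le M$ and all conductances in $[M^{-1},M]$. Simple: no loops or multiple edges. A proper plane triangulation is a network with a proper embedding in $\mathbb R^2$ (continuous injective map of the metric graph such that every compact set meets finitely many edges and vertices) all of whose faces have three sides. Rectangle tiling: $y(v)=P_v(\text{never visit }\rho)$, $\eta=\sum_{u\sim\rho}c(\rho,u)y(u)$; a collection $\{S(e)\}$ with: for each oriented edge $e$ with $y(e^+)\ge y(e^-)$, $S(e)=I(e)\times[y(e^-),y(e^+)]$ where $I(e)\subseteq\mathbb R/\eta\mathbb Z$ is an interval of length $c(e)(y(e^+)-y(e^-))$ (and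 $S(e)=S(-e)$ otherwise); interiors disjoint, union $\mathbb R/\eta\mathbb Z\times[0,1)$; for each $v$, $I(v):=\bigcup_{e^-=v}I(e)$ is an interval equal to $\bigcup_{e^+=v}I(e)$; for a.e. $\theta$ and all $t<1$, $\{\theta\}\times[0,t]$ meets finitely many rectangles; interiors of vertical sides of $S(e_1),S(e_2)$ meet only if $e_1,e_2$ lie on a common face. $\theta(v)$ is an arbitrary point of $I(v)$. Circle packing of $T$ in $\mathbb D$: a collection of discs with disjoint interiors indexed by the vertices, two discs tangent iff the vertices are adjacent, whose carrier (union of the discs and the interstices bounded by discs of faces) is $\mathbb D$; the associated embedding $z$ sends $v$ to the centre of its disc and each edge to the straight segment between centres. (By He–Schramm, such a packing exists for transient bounded degree simple triangulations.) *)

theory Defs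
  imports "HOL-Analysis.Analysis"
begin

text \<open>Vertices are the elements of the type 'v; adj is the (symmetric) adjacency
relation, c the conductance function (only its values on edges matter).\<close>

definition nbrs :: "('v \<Rightarrow> 'v \<Rightarrow> bool) \<Rightarrow> 'v \<Rightarrow> 'v set" where
  "nbrs adj v = {u. adj v u}"

definition is_network :: "('v \<Rightarrow> 'v \<Rightarrow> bool) \<Rightarrow> ('v \<Rightarrow> 'v \<Rightarrow> real) \<Rightarrow> bool" where
  "is_network adj c \<longleftrightarrow>
     (\<forall>u v. adj u v \<longrightarrow> adj v u)
   \<and> (\<forall>v. finite (nbrs adj v))
   \<and> (\<forall>u v. adj\<^sup>*\<^sup>* u v)
   \<and> (\<forall>u v. adj u v \<longrightarrow> c u v > 0 \<and> c u v = c v u)"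

text \<open>Simple: no loops (multiple edges are impossible for an adjacency relation).\<close>
definition simple_graph :: "('v \<Rightarrow> 'v \<Rightarrow> bool) \<Rightarrow> bool" where
  "simple_graph adj \<longleftrightarrow> (\<forall>v. \<not> adj v v)"

definition bounded_local_geometry :: "('v \<Rightarrow> 'v \<Rightarrow> bool) \<Rightarrow> ('v \<Rightarrow> 'v \<Rightarrow> real) \<Rightarrow> bool" where
  "bounded_local_geometry adj c \<longleftrightarrow>
     (\<exists>M::real. M > 0 \<and> (\<forall>v. real (card (nbrs adj v)) \<le> M)
        \<and> (\<forall>u v. adj u v \<longrightarrow> inverse M \<le> c u v \<and> c u v \<le> M))"

definition cond :: "('v \<Rightarrow> 'v \<Rightarrow> bool) \<Rightarrow> ('v \<Rightarrow> 'v \<Rightarrow> real) \<Rightarrow> 'v \<Rightarrow> real" where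
  "cond adj c v = (\<Sum>u\<in>nbrs adj v. c v u)"

definition trans_prob :: "('v \<Rightarrow> 'v \<Rightarrow> bool) \<Rightarrow> ('v \<Rightarrow> 'v \<Rightarrow> real) \<Rightarrow> 'v \<Rightarrow> 'v \<Rightarrow> real" where
  "trans_prob adj c v u = (if adj v u then c v u / cond adj c v else 0)"

text \<open>hit_prob adj c \<rho> n v = P_v(the walk visits \<rho> at some time in {0..n}).\<close>
fun hit_prob :: "('v \<Rightarrow> 'v \<Rightarrow> bool) \<Rightarrow> ('v \<Rightarrow> 'v \<Rightarrow> real) \<Rightarrow> 'v \<Rightarrow> nat \<Rightarrow> 'v \<Rightarrow> real" where
  "hit_prob adj c \<rho> 0 v = (if v = \<rho> then 1 else 0)"
| "hit_prob adj c \<rho> (Suc n) v =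
     (if v = \<rho> then 1 else (\<Sum>u\<in>nbrs adj v. trans_prob adj c v u * hit_prob adj c \<rho> n u))"

definition escape :: "('v \<Rightarrow> 'v \<Rightarrow> bool) \<Rightarrow> ('v \<Rightarrow> 'v \<Rightarrow> real) \<Rightarrow> 'v \<Rightarrow> 'v \<Rightarrow> real" where
  "escape adj c \<rho> v = 1 - lim (\<lambda>n. hit_prob adj c \<rho> n v)"

text \<open>Transient: started at \<rho>, the walk returns to \<rho> with probability < 1.\<close>
definition transient :: "('v \<Rightarrow> 'v \<Rightarrow> bool) \<Rightarrow> ('v \<Rightarrow> 'v \<Rightarrow> real) \<Rightarrow> 'v \<Rightarrow> bool" where
  "transient adj c \<rho> \<longleftrightarrow>
     (\<Sum>u\<in>nbrs adj \<rho>. trans_prob adj c \<rho> u * (1 - escape adj c \<rho> u)) < 1"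

definition eta :: "('v \<Rightarrow> 'v \<Rightarrow> bool) \<Rightarrow> ('v \<Rightarrow> 'v \<Rightarrow> real) \<Rightarrow> 'v \<Rightarrow> real" where
  "eta adj c \<rho> = (\<Sum>u\<in>nbrs adj \<rho>. c \<rho> u * escape adj c \<rho> u)"

definition emb_image :: "('v \<Rightarrow> 'v \<Rightarrow> bool) \<Rightarrow> ('v \<Rightarrow> complex) \<Rightarrow> ('v \<Rightarrow> 'v \<Rightarrow> real \<Rightarrow> complex) \<Rightarrow> complex set" where
  "emb_image adj pos ep = range pos \<union> \<Union>{path_image (ep u v) | u v. adj u v}"

definition proper_embedding :: "('v \<Rightarrow> 'v \<Rightarrow> bool) \<Rightarrow> ('v \<Rightarrow> complex) \<Rightarrow> ('v \<Rightarrow> 'v \<Rightarrow> real \<Rightarrow> complex) \<Rightarrow> bool" where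
  "proper_embedding adj pos ep \<longleftrightarrow>
     inj pos
   \<and> (\<forall>u v. adj u v \<longrightarrow> arc (ep u v) \<and> pathstart (ep u v) = pos u \<and> pathfinish (ep u v) = pos v
                        \<and> ep v u = reversepath (ep u v))
   \<and> (\<forall>u v w. adj u v \<and> w \<notin> {u, v} \<longrightarrow> pos w \<notin> path_image (ep u v))
   \<and> (\<forall>u v u' v'. adj u v \<and> adj u' v' \<and> {u, v} \<noteq> {u', v'} \<longrightarrow>
        path_image (ep u v) \<inter> path_image (ep u' v') \<subseteq> pos ` ({u, v} \<inter> {u', v'}))
   \<and> (\<forall>K. compact K \<longrightarrow> finite {v. pos v \<in> K}
                        \<and> finite {(u, v). adj u v \<and> path_image (ep u v) \<inter> K \<noteq> {}})"

definition faces :: "('v \<Rightarrow> 'v \<Rightarrow> bool) \<Rightarrow> ('v \<Rightarrow> complex) \<Rightarrow> ('v \<Rightarrow> 'v \<Rightarrow> real \<Rightarrow> complex) \<Rightarrow> complex set set" where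
  "faces adj pos ep = components (- emb_image adj pos ep)"

definition triangle_face :: "('v \<Rightarrow> 'v \<Rightarrow> bool) \<Rightarrow> ('v \<Rightarrow> 'v \<Rightarrow> real \<Rightarrow> complex) \<Rightarrow> 'v \<Rightarrow> 'v \<Rightarrow> 'v \<Rightarrow> complex set \<Rightarrow> bool" where
  "triangle_face adj ep a b c F \<longleftrightarrow> distinct [a, b, c] \<and> adj a b \<and> adj b c \<and> adj c a
     \<and> frontier F = path_image (ep a b) \<union> path_image (ep b c) \<union> path_image (ep c a)"

definition proper_plane_triangulation :: "('v \<Rightarrow> 'v \<Rightarrow> bool) \<Rightarrow> ('v \<Rightarrow> complex) \<Rightarrow> ('v \<Rightarrow> 'v \<Rightarrow> real \<Rightarrow> complex) \<Rightarrow> bool" where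
  "proper_plane_triangulation adj pos ep \<longleftrightarrow> proper_embedding adj pos ep
     \<and> (\<forall>F\<in>faces adj pos ep. \<exists>a b c. triangle_face adj ep a b c F)"

definition common_face :: "('v \<Rightarrow> 'v \<Rightarrow> bool) \<Rightarrow> ('v \<Rightarrow> complex) \<Rightarrow> ('v \<Rightarrow> 'v \<Rightarrow> real \<Rightarrow> complex) \<Rightarrow> 'v \<Rightarrow> 'v \<Rightarrow> 'v \<Rightarrow> 'v \<Rightarrow> bool" where
  "common_face adj pos ep u v u' v' \<longleftrightarrow> (\<exists>F\<in>faces adj pos ep.
      path_image (ep u v) \<subseteq> frontier F \<and> path_image (ep u' v') \<subseteq> frontier F)"

text \<open>Subsets of R/\<eta>Z are represented by their \<eta>-periodic preimages in R;
per \<eta> J is the preimage of the image of J \<subseteq> R.\<close>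
definition per :: "real \<Rightarrow> real set \<Rightarrow> real set" where
  "per \<eta> J = {\<theta>. \<exists>k::int. \<theta> + real_of_int k * \<eta> \<in> J}"

definition circle_interval :: "real \<Rightarrow> real set \<Rightarrow> bool" where
  "circle_interval \<eta> X \<longleftrightarrow> (\<exists>J. is_interval J \<and> X = per \<eta> J)"

text \<open>a u v is the left endpoint (a lift of it) of I(u,v); I(u,v) has length c(u,v)(y(v)-y(u)).\<close>
definition tile_I :: "('v \<Rightarrow> 'v \<Rightarrow> bool) \<Rightarrow> ('v \<Rightarrow> 'v \<Rightarrow> real) \<Rightarrow> 'v \<Rightarrow> ('v \<Rightarrow> 'v \<Rightarrow> real) \<Rightarrow> 'v \<Rightarrow> 'v \<Rightarrow> real set" where
  "tile_I adj c \<rho> a u v = per (eta adj c \<rho>)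
     {a u v .. a u v + c u v * (escape adj c \<rho> v - escape adj c \<rho> u)}"

definition tile_S :: "('v \<Rightarrow> 'v \<Rightarrow> bool) \<Rightarrow> ('v \<Rightarrow> 'v \<Rightarrow> real) \<Rightarrow> 'v \<Rightarrow> ('v \<Rightarrow> 'v \<Rightarrow> real) \<Rightarrow> 'v \<Rightarrow> 'v \<Rightarrow> (real \<times> real) set" where
  "tile_S adj c \<rho> a u v =
     (if escape adj c \<rho> u \<le> escape adj c \<rho> v
      then tile_I adj c \<rho> a u v \<times> {escape adj c \<rho> u .. escape adj c \<rho> v}
      else tile_I adj c \<rho> a v u \<times> {escape adj c \<rho> v .. escape adj c \<rho> u})"

definition tile_vsides :: "('v \<Rightarrow> 'v \<Rightarrow> bool) \<Rightarrow> ('v \<Rightarrow> 'v \<Rightarrow> real) \<Rightarrow> 'v \<Rightarrow> ('v \<Rightarrow> 'v \<Rightarrow> real) \<Rightarrow> 'v \<Rightarrow> 'v \<Rightarrow> (real \<times> real) set" where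
  "tile_vsides adj c \<rho> a u v =
     (if escape adj c \<rho> u \<le> escape adj c \<rho> v
      then per (eta adj c \<rho>) {a u v, a u v + c u v * (escape adj c \<rho> v - escape adj c \<rho> u)}
             \<times> {escape adj c \<rho> u <..< escape adj c \<rho> v}
      else per (eta adj c \<rho>) {a v u, a v u + c v u * (escape adj c \<rho> u - escape adj c \<rho> v)}
             \<times> {escape adj c \<rho> v <..< escape adj c \<rho> u})"

text \<open>I(v): union of I(e) over the oriented edges e with e^- = v (those for which I(e) is defined).\<close>
definition tile_Iv :: "('v \<Rightarrow> 'v \<Rightarrow> bool) \<Rightarrow> ('v \<Rightarrow> 'v \<Rightarrow> real) \<Rightarrow> 'v \<Rightarrow> ('v \<Rightarrow> 'v \<Rightarrow> real) \<Rightarrow> 'v \<Rightarrow> real set" where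
  "tile_Iv adj c \<rho> a v = \<Union>{tile_I adj c \<rho> a v w | w. adj v w \<and> escape adj c \<rho> v \<le> escape adj c \<rho> w}"

definition tile_Iv_in :: "('v \<Rightarrow> 'v \<Rightarrow> bool) \<Rightarrow> ('v \<Rightarrow> 'v \<Rightarrow> real) \<Rightarrow> 'v \<Rightarrow> ('v \<Rightarrow> 'v \<Rightarrow> real) \<Rightarrow> 'v \<Rightarrow> real set" where
  "tile_Iv_in adj c \<rho> a v = \<Union>{tile_I adj c \<rho> a u v | u. adj u v \<and> escape adj c \<rho> u \<le> escape adj c \<rho> v}"

definition rectangle_tiling :: "('v \<Rightarrow> 'v \<Rightarrow> bool) \<Rightarrow> ('v \<Rightarrow> 'v \<Rightarrow> real) \<Rightarrow> 'v \<Rightarrow> ('v \<Rightarrow> complex) \<Rightarrow> ('v \<Rightarrow> 'v \<Rightarrow> real \<Rightarrow> complex) \<Rightarrow> ('v \<Rightarrow> 'v \<Rightarrow> real) \<Rightarrow> bool" where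
  "rectangle_tiling adj c \<rho> pos ep a \<longleftrightarrow>
     (\<forall>u v u' v'. adj u v \<and> adj u' v' \<and> {u, v} \<noteq> {u', v'} \<longrightarrow>
        interior (tile_S adj c \<rho> a u v) \<inter> interior (tile_S adj c \<rho> a u' v') = {})
   \<and> \<Union>{tile_S adj c \<rho> a u v | u v. adj u v} = UNIV \<times> {0..<1}
   \<and> (\<forall>v. circle_interval (eta adj c \<rho>) (tile_Iv adj c \<rho> a v))
   \<and> (\<forall>v. v \<noteq> \<rho> \<longrightarrow> tile_Iv adj c \<rho> a v = tile_Iv_in adj c \<rho> a v)
   \<and> (AE \<theta> in lborel. \<forall>t<1. finite {(u, v). adj u v \<and> tile_S adj c \<rho> a u v \<inter> ({\<theta>} \<times> {0..t}) \<noteq> {}})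
   \<and> (\<forall>u v u' v'. adj u v \<and> adj u' v' \<and>
        tile_vsides adj c \<rho> a u v \<inter> tile_vsides adj c \<rho> a u' v' \<noteq> {} \<longrightarrow>
        common_face adj pos ep u v u' v')"

text \<open>R/\<eta>Z is identified with the unit circle via t \<mapsto> exp(2\<pi>it/\<eta>).\<close>
definition to_circle :: "real \<Rightarrow> real \<Rightarrow> complex" where
  "to_circle \<eta> t = cis (2 * pi * t / \<eta>)"

definition interstice :: "('v \<Rightarrow> complex) \<Rightarrow> ('v \<Rightarrow> real) \<Rightarrow> 'v \<Rightarrow> 'v \<Rightarrow> 'v \<Rightarrow> complex set" where
  "interstice ctr r a b c = \<Union>{K \<in> components (- (cball (ctr a) (r a) \<union> cball (ctr b) (r b) \<union> cball (ctr c) (r c))). bounded K}"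

definition circle_packing_disc :: "('v \<Rightarrow> 'v \<Rightarrow> bool) \<Rightarrow> ('v \<Rightarrow> complex) \<Rightarrow> ('v \<Rightarrow> 'v \<Rightarrow> real \<Rightarrow> complex) \<Rightarrow> ('v \<Rightarrow> complex) \<Rightarrow> ('v \<Rightarrow> real) \<Rightarrow> bool" where
  "circle_packing_disc adj pos ep ctr r \<longleftrightarrow>
     (\<forall>v. r v > 0)
   \<and> (\<forall>u v. u \<noteq> v \<longrightarrow> ball (ctr u) (r u) \<inter> ball (ctr v) (r v) = {})
   \<and> (\<forall>u v. u \<noteq> v \<longrightarrow> (adj u v \<longleftrightarrow> cball (ctr u) (r u) \<inter> cball (ctr v) (r v) \<noteq> {}))
   \<and> (\<Union>v. cball (ctr v) (r v)) \<union>
       \<Union>{interstice ctr r a b c | a b c. \<exists>F\<in>faces adj pos ep. triangle_face adj ep a b c F}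
       = ball 0 1"

end

theory Submission
  imports Defs
begin

text \<open>All estimates are of length-area type. A circle around a boundary point \<open>\<xi>\<close> of the disc meets
  a tangency-connected set of discs, which separates the discs near \<open>\<xi>\<close> from the root. For any
  square-summable weight on the vertices, some small circle of this kind has small total weight.
  The hitting probability \<open>1 - y\<close> of the root is a limit of finitely supported functions of bounded
  energy, so weights given by their increments show \<open>y \<rightarrow> 1\<close> at \<open>\<xi>\<close>; since the widths of the
  intervals \<open>I(v)\<close> are bounded by the increments of \<open>y\<close>, and a generic vertical line of the tiling
  descends through adjacent vertices to the root, the angles \<open>\<theta>\<close> of the vertices behind such a crosscut
  are trapped in a short arc, whence they converge.

  Injectivity of the resulting boundary map exchanges the two pictures: a box around a boundary
  point of the cylinder meets a connected set of edges that separates from the root, the weights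
  are now the radii of the packing, and a suitable box carries discs of small total radius. Such a set
  cannot separate two distinct boundary points of the disc from the root at once. Finally, a
  continuous injection of the circle into itself is a homeomorphism.\<close>

section \<open>Length-area estimates\<close>

text \<open>Square-summability yields light contours because the length-area bound is scale
  invariant: the objects met by contours of scale \<epsilon> have squared widths summing to
  O(\<epsilon>^2), while the parameters fill an interval of length \<epsilon>. So the weight of a
  good contour is controlled by the square root of the energy near it, which is small off a finite
  set. For the packing a squared width is an area, and a disc much larger than \<epsilon> is
  replaced by a small disc inside it. For the tiling, conductances in [1/M, M] give every rectangle
  comparable sides, so that area again controls squared diameter.

  The obstacle is the passage from curves to vertices. A circle also runs through interstices, and
  nothing in the definition openly forbids a disc inside an interstice or two faces on the same side
  of an edge. This is excluded first; then the discs met by a connected set are connected by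
  tangencies. In the tiling, rectangles may meet at corners without their edges having a common
  vertex, and tiles of height zero may occur; contours are therefore chosen off a countable set of
  parameters.\<close>

definition linked :: "('i \<Rightarrow> 'i \<Rightarrow> bool) \<Rightarrow> 'i set \<Rightarrow> bool" where
  "linked R S \<longleftrightarrow> (\<forall>P. P \<subseteq> S \<and> P \<noteq> {} \<and> P \<noteq> S \<longrightarrow> (\<exists>i\<in>P. \<exists>j\<in>S - P. R i j))"

lemma linkedD:
  assumes "linked R S" "P \<subseteq> S" "P \<noteq> {}" "P \<noteq> S"
  obtains i j where "i \<in> P" "j \<in> S - P" "R i j"
  using assms unfolding linked_def by blast

text \<open>\<open>linked\<close> asks for a step out of every proper nonempty part instead of for
  paths, since this is what connectedness of a plane set delivers. Here finite sets of indices grow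
  from \<open>i\<close>: adjoining an index whose set meets one already reached costs its
  \<open>d\<close> once. The union of all such finite sets admits no step outwards, so it is
  \<open>S\<close>.\<close>

lemma linked_dist_le:
  fixes K :: "'i \<Rightarrow> 'a::metric_space set"
  assumes link: "linked R S"
    and meet: "\<And>i j. i \<in> S \<Longrightarrow> j \<in> S \<Longrightarrow> R i j \<Longrightarrow> K i \<inter> K j \<noteq> {}"
    and diam: "\<And>i x y. i \<in> S \<Longrightarrow> x \<in> K i \<Longrightarrow> y \<in> K i \<Longrightarrow> dist x y \<le> d i"
    and d0: "\<And>i. i \<in> S \<Longrightarrow> 0 \<le> d i"
    and bound: "\<And>P. finite P \<Longrightarrow> P \<subseteq> S \<Longrightarrow> sum d P \<le> B"
    and i: "i \<in> S" "x \<in> K i" and j: "j \<in> S" "y \<in> K j"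
  shows "dist x y \<le> B"
proof -
  define good where "good P \<longleftrightarrow> finite P \<and> P \<subseteq> S \<and> (\<forall>j\<in>P. \<forall>y\<in>K j. dist x y \<le> sum d P)" for P
  define Q where "Q = \<Union>{P. good P}"
  have "good {i}" unfolding good_def using i diam by auto
  hence iQ: "i \<in> Q" unfolding Q_def by auto
  have QS: "Q \<subseteq> S" unfolding Q_def good_def by auto
  have "Q = S"
  proof (rule ccontr)
    assume "Q \<noteq> S"
    then obtain p q where p: "p \<in> Q" and q: "q \<in> S - Q" and "R p q"
      using linkedD[OF link QS] iQ by blast
    from p obtain P where P: "good P" "p \<in> P" unfolding Q_def by auto
    have qP: "q \<notin> P" using P q unfolding Q_def by auto
    obtain t where t: "t \<in> K p" "t \<in> K q" using meet[of p q] \<open>R p q\<close> p q QS by blast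
    have "good (insert q P)"
      unfolding good_def
    proof (intro conjI ballI)
      show "finite (insert q P)" "insert q P \<subseteq> S" using P q unfolding good_def by auto
      fix j y assume j: "j \<in> insert q P" "y \<in> K j"
      have s: "sum d (insert q P) = d q + sum d P" using P qP unfolding good_def by simp
      show "dist x y \<le> sum d (insert q P)"
      proof (cases "j = q")
        case True
        have "dist x y \<le> dist x t + dist t y" by (rule dist_triangle)
        moreover have "dist x t \<le> sum d P" using P t unfolding good_def by auto
        moreover have "dist t y \<le> d q" using diam[of q t y] t j q True by auto
        ultimately show ?thesis using s by simp
      next
        case False
        hence "dist x y \<le> sum d P" using P j unfolding good_def by auto
        thus ?thesis using s d0[of q] q by auto
      qed
    qed
    thus False using q unfolding Q_def by auto
  qed
  then obtain P where "good P" "j \<in> P" using j unfolding Q_def by auto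
  thus ?thesis using bound[of P] j unfolding good_def by force
qed

text \<open>\<open>F0\<close> nearly attains the supremum of the finite sums, which leaves at most
  \<open>e\<close> for any disjoint set.\<close>

lemma finite_sums_tail:
  fixes f :: "'i \<Rightarrow> real"
  assumes bd: "\<And>F. finite F \<Longrightarrow> sum f F \<le> B" and "0 < e"
  shows "\<exists>F0. finite F0 \<and> (\<forall>F. finite F \<and> F \<inter> F0 = {} \<longrightarrow> sum f F \<le> e)"
proof -
  define A where "A = sum f ` {F. finite F}"
  have ne: "A \<noteq> {}" unfolding A_def by auto
  have bA: "bdd_above A" unfolding A_def bdd_above_def using bd by auto
  obtain F0 where F0: "finite F0" "Sup A - e < sum f F0"
    using less_cSup_iff[OF ne bA, of "Sup A - e"] \<open>0 < e\<close> unfolding A_def by auto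
  have "sum f F \<le> e" if F: "finite F" "F \<inter> F0 = {}" for F
  proof -
    have "sum f (F0 \<union> F) = sum f F0 + sum f F"
      by (rule sum.union_disjoint) (use F F0 in auto)
    moreover have "sum f (F0 \<union> F) \<le> Sup A"
      by (rule cSup_upper[OF _ bA]) (use F F0 in \<open>auto simp: A_def\<close>)
    ultimately show ?thesis using F0 by simp
  qed
  thus ?thesis using F0(1) by blast
qed

lemma nn_integral_count_space_le:
  fixes f :: "'i \<Rightarrow> real"
  assumes X: "countable X" and f0: "\<And>i. i \<in> X \<Longrightarrow> 0 \<le> f i"
    and bd: "\<And>F. finite F \<Longrightarrow> F \<subseteq> X \<Longrightarrow> sum f F \<le> B"
  shows "(\<integral>\<^sup>+i. ennreal (f i) \<partial>count_space X) \<le> ennreal B"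
proof (cases "finite X")
  case True
  have "(\<integral>\<^sup>+i. ennreal (f i) \<partial>count_space X) = (\<Sum>i\<in>X. ennreal (f i))"
    using True by (rule nn_integral_count_space_finite)
  also have "\<dots> = ennreal (sum f X)" using f0 by (simp add: sum_ennreal)
  also have "\<dots> \<le> ennreal B" using bd[OF True] by (simp add: ennreal_leI)
  finally show ?thesis .
next
  case False
  let ?g = "from_nat_into X"
  have bij: "bij_betw ?g UNIV X" using X False by (rule bij_betw_from_nat_into)
  have gX: "?g i \<in> X" for i using bij by (auto simp: bij_betw_def)
  have "(\<integral>\<^sup>+i. ennreal (f i) \<partial>count_space X) = (\<integral>\<^sup>+i. ennreal (f (?g i)) \<partial>count_space UNIV)"
    using nn_integral_bij_count_space[OF bij, of "\<lambda>i. ennreal (f i)"] by simp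
  also have "\<dots> = (\<Sum>i. ennreal (f (?g i)))" by (rule nn_integral_count_space_nat)
  also have "\<dots> = (SUP n. \<Sum>i<n. ennreal (f (?g i)))" by (rule suminf_eq_SUP)
  also have "\<dots> \<le> ennreal B"
  proof (rule SUP_least)
    fix n
    have "(\<Sum>i<n. ennreal (f (?g i))) = ennreal (\<Sum>i<n. f (?g i))"
      using f0 gX by (simp add: sum_ennreal)
    also have "(\<Sum>i<n. f (?g i)) = sum f (?g ` {..<n})"
      using bij by (subst sum.reindex) (auto simp: bij_betw_def intro: inj_on_subset)
    also have "ennreal (sum f (?g ` {..<n})) \<le> ennreal B" using gX by (intro ennreal_leI bd) auto
    finally show "(\<Sum>i<n. ennreal (f (?g i))) \<le> ennreal B" .
  qed
  finally show ?thesis .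
qed

text \<open>Each \<open>i\<close> is hit only for parameters in an interval of length
  \<open>d i\<close>, so the integral over \<open>s\<close> of the mass hit at \<open>s\<close> is
  at most the sum of \<open>m i * d i\<close>, which Cauchy-Schwarz bounds by
  \<open>sqrt (A * B)\<close>. If almost every \<open>s\<close> in an interval of length
  \<open>\<rho>\<close> carried more than \<open>c\<close>, the integral would be at least
  \<open>c * \<rho>\<close>. The set \<open>N\<close> holds countably many parameters to be
  avoided.\<close>

lemma length_area:
  fixes m d :: "'i \<Rightarrow> real"
  assumes X: "countable X" and N: "countable N" and "0 < \<rho>"
    and m0: "\<And>i. i \<in> X \<Longrightarrow> 0 \<le> m i" and d0: "\<And>i. i \<in> X \<Longrightarrow> 0 \<le> d i"
    and hit: "\<And>i. i \<in> X \<Longrightarrow> \<exists>l. \<forall>s\<in>{\<rho>..2*\<rho>}. hit i s \<longrightarrow> l \<le> s \<and> s \<le> l + d i"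
    and A: "\<And>F. finite F \<Longrightarrow> F \<subseteq> X \<Longrightarrow> (\<Sum>i\<in>F. (m i)\<^sup>2) \<le> A"
    and B: "\<And>F. finite F \<Longrightarrow> F \<subseteq> X \<Longrightarrow> (\<Sum>i\<in>F. (d i)\<^sup>2) \<le> B"
    and c: "sqrt (A * B) < c * \<rho>"
  obtains s where "s \<in> {\<rho>..2*\<rho>} - N"
    "\<And>F. finite F \<Longrightarrow> F \<subseteq> {i\<in>X. hit i s} \<Longrightarrow> sum m F \<le> c"
proof -
  have A0: "0 \<le> A" and B0: "0 \<le> B" using A[of "{}"] B[of "{}"] by auto
  have c0: "0 < c" using c \<open>0 < \<rho>\<close> real_sqrt_ge_zero[of "A * B"] A0 B0
    by (smt (verit) mult_nonneg_nonneg mult_nonpos_nonneg)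
  obtain l where l: "\<And>i s. i \<in> X \<Longrightarrow> s \<in> {\<rho>..2*\<rho>} \<Longrightarrow> hit i s \<Longrightarrow> l i \<le> s \<and> s \<le> l i + d i"
    using hit by metis
  \<comment> \<open>The interval replaces the set of hitting parameters, which need not be
    measurable.\<close>
  define g where "g i s = ennreal (m i) * indicator {l i..l i + d i} s" for i and s :: real
  define G where "G s = (\<integral>\<^sup>+i. g i s \<partial>count_space X)" for s
  have int_g: "(\<integral>\<^sup>+s. g i s \<partial>lborel) = ennreal (m i * d i)" if "i \<in> X" for i
    unfolding g_def using that d0 m0
    by (subst nn_integral_cmult_indicator) (auto simp: ennreal_mult)
  have fin: "(\<Sum>i\<in>F. m i * d i) \<le> sqrt (A * B)" if F: "finite F" "F \<subseteq> X" for F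
  proof -
    have "(\<Sum>i\<in>F. m i * d i)\<^sup>2 \<le> (\<Sum>i\<in>F. (m i)\<^sup>2) * (\<Sum>i\<in>F. (d i)\<^sup>2)"
      by (rule Cauchy_Schwarz_ineq_sum)
    also have "\<dots> \<le> A * B" using A[OF F] B[OF F] A0 by (intro mult_mono) (auto intro: sum_nonneg)
    finally show ?thesis by (rule real_le_rsqrt)
  qed
  have "(\<integral>\<^sup>+s. G s \<partial>lborel) = (\<integral>\<^sup>+i. (\<integral>\<^sup>+s. g i s \<partial>lborel) \<partial>count_space X)"
    unfolding G_def by (rule nn_integral_count_space_nn_integral[OF X]) (simp add: g_def)
  also have "\<dots> = (\<integral>\<^sup>+i. ennreal (m i * d i) \<partial>count_space X)"
    by (rule nn_integral_cong) (simp add: int_g)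
  also have "\<dots> \<le> ennreal (sqrt (A * B))"
    by (rule nn_integral_count_space_le[OF X]) (use m0 d0 A0 B0 fin in auto)
  also have "\<dots> < ennreal (c * \<rho>)" using c c0 \<open>0 < \<rho>\<close> by (intro ennreal_lessI) auto
  finally have small: "(\<integral>\<^sup>+s. G s \<partial>lborel) < ennreal (c * \<rho>)" .
  have "\<exists>s\<in>{\<rho>..2*\<rho>} - N. \<forall>F. finite F \<and> F \<subseteq> {i\<in>X. hit i s} \<longrightarrow> sum m F \<le> c"
  proof (rule ccontr)
    assume neg: "\<not> ?thesis"
    have big: "ennreal c \<le> G s" if "s \<in> {\<rho>..2*\<rho>} - N" for s
    proof -
      obtain F where F: "finite F" "F \<subseteq> {i\<in>X. hit i s}" "c < sum m F" using neg \<open>s \<in> _\<close> by (meson not_le)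
      have "ennreal c \<le> ennreal (sum m F)" using F by (simp add: ennreal_leI)
      also have "\<dots> = (\<Sum>i\<in>F. ennreal (m i))" using F m0 by (subst sum_ennreal) auto
      also have "\<dots> = (\<Sum>i\<in>F. g i s)"
        by (rule sum.cong) (use F l \<open>s \<in> _\<close> in \<open>auto simp: g_def indicator_def\<close>)
      also have "\<dots> = (\<Sum>i\<in>F. g i s * indicator F i)" by (rule sum.cong) auto
      also have "\<dots> = (\<integral>\<^sup>+i. g i s * indicator F i \<partial>count_space X)"
        using F by (intro nn_integral_count_space'[symmetric]) auto
      also have "\<dots> \<le> G s" unfolding G_def by (intro nn_integral_mono) (auto simp: indicator_def)
      finally show ?thesis .
    qed
    have "ennreal (c * \<rho>) = ennreal c * ennreal \<rho>" using c0 \<open>0 < \<rho>\<close> by (simp add: ennreal_mult)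
    also have "\<dots> = (\<integral>\<^sup>+s. ennreal c * indicator {\<rho>..2*\<rho>} s \<partial>lborel)"
      using \<open>0 < \<rho>\<close> by (subst nn_integral_cmult_indicator) auto
    also have "\<dots> \<le> (\<integral>\<^sup>+s. G s \<partial>lborel)"
    proof (rule nn_integral_mono_AE)
      have "AE s in lborel. s \<notin> N"
        using N by (intro AE_not_in) (simp add: countable_imp_null_set_lborel)
      thus "AE s in lborel. ennreal c * indicator {\<rho>..2*\<rho>} s \<le> G s"
        by (rule eventually_mono) (use big in \<open>auto simp: indicator_def\<close>)
    qed
    finally show False using small by simp
  qed
  thus thesis using that by blast
qed

section \<open>Hitting probabilities and energy\<close>

locale network =
  fixes adj :: "'v \<Rightarrow> 'v \<Rightarrow> bool" and c :: "'v \<Rightarrow> 'v \<Rightarrow> real" and \<rho> :: 'v and M :: real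
  assumes net: "is_network adj c" and simple: "simple_graph adj"
    and M0: "M > 0" and deg: "\<And>v. real (card (nbrs adj v)) \<le> M"
    and c_bounds: "\<And>u v. adj u v \<Longrightarrow> inverse M \<le> c u v \<and> c u v \<le> M"
    and infinite_V: "infinite (UNIV :: 'v set)"
begin

abbreviation "y \<equiv> escape adj c \<rho>"
abbreviation "hp \<equiv> hit_prob adj c \<rho>"

lemma adj_sym: "adj u v \<Longrightarrow> adj v u" and adj_commute: "adj u v \<longleftrightarrow> adj v u"
  and finite_nbrs: "finite (nbrs adj v)" and reach: "adj\<^sup>*\<^sup>* u v"
  and c_pos: "adj u v \<Longrightarrow> 0 < c u v" and c_sym: "adj u v \<Longrightarrow> c u v = c v u"
  and irrefl: "\<not> adj v v"
  using net simple unfolding is_network_def simple_graph_def by blast+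

lemma closed_under_adj_UNIV:
  assumes "v \<in> X" and "\<And>u w. u \<in> X \<Longrightarrow> adj u w \<Longrightarrow> w \<in> X"
  shows "X = UNIV"
proof -
  have "w \<in> X" for w
    using reach[of v w] by (induction rule: rtranclp_induct) (use assms in auto)
  thus ?thesis by auto
qed

lemma ex_nbr: "\<exists>u. adj v u"
proof (rule ccontr)
  assume "\<not> ?thesis"
  hence "{v} = UNIV" by (intro closed_under_adj_UNIV) auto
  thus False using infinite_V by (metis finite.simps)
qed

lemma cond_pos: "0 < cond adj c v"
  unfolding cond_def using ex_nbr[of v] finite_nbrs c_pos
  by (intro sum_pos) (auto simp: nbrs_def)

lemma cond_le: "cond adj c v \<le> M * M"
proof -
  have "cond adj c v \<le> (\<Sum>u\<in>nbrs adj v. M)"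
    unfolding cond_def using c_bounds by (intro sum_mono) (auto simp: nbrs_def)
  also have "\<dots> \<le> M * M" using deg[of v] M0 by (simp add: mult_right_mono)
  finally show ?thesis .
qed

lemma trans_prob_eq: "u \<in> nbrs adj v \<Longrightarrow> trans_prob adj c v u = c v u / cond adj c v"
  by (simp add: trans_prob_def nbrs_def)

lemma trans_prob_nonneg: "0 \<le> trans_prob adj c v u"
  using cond_pos[of v] c_pos[of v u] by (auto simp: trans_prob_def less_imp_le)

lemma trans_prob_sum: "(\<Sum>u\<in>nbrs adj v. trans_prob adj c v u) = 1"
proof -
  have "(\<Sum>u\<in>nbrs adj v. trans_prob adj c v u) = (\<Sum>u\<in>nbrs adj v. c v u / cond adj c v)"
    by (rule sum.cong) (auto simp: trans_prob_eq)
  also have "\<dots> = 1" using cond_pos[of v] by (simp add: sum_divide_distrib[symmetric] cond_def)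
  finally show ?thesis .
qed

lemma trans_prob_avg_le:
  assumes "\<And>u. adj v u \<Longrightarrow> f u \<le> b"
  shows "(\<Sum>u\<in>nbrs adj v. trans_prob adj c v u * f u) \<le> b"
proof -
  have "(\<Sum>u\<in>nbrs adj v. trans_prob adj c v u * f u) \<le> (\<Sum>u\<in>nbrs adj v. trans_prob adj c v u * b)"
    using assms trans_prob_nonneg by (intro sum_mono mult_left_mono) (auto simp: nbrs_def)
  also have "\<dots> = b" by (simp add: sum_distrib_right[symmetric] trans_prob_sum)
  finally show ?thesis .
qed

lemma hp_nonneg: "0 \<le> hp n v"
  by (induction n arbitrary: v) (auto intro!: sum_nonneg mult_nonneg_nonneg trans_prob_nonneg)

lemma hp_le_1: "hp n v \<le> 1"
  by (induction n arbitrary: v) (auto intro!: trans_prob_avg_le)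

lemma hp_root [simp]: "hp n \<rho> = 1"
  by (cases n) auto

lemma hp_Suc_ge: "hp n v \<le> hp (Suc n) v"
proof (induction n arbitrary: v)
  case 0
  show ?case by (auto intro!: sum_nonneg mult_nonneg_nonneg trans_prob_nonneg)
next
  case (Suc n)
  have "(\<Sum>u\<in>nbrs adj v. trans_prob adj c v u * hp n u)
     \<le> (\<Sum>u\<in>nbrs adj v. trans_prob adj c v u * hp (Suc n) u)"
    by (intro sum_mono mult_left_mono Suc trans_prob_nonneg)
  thus ?case by simp
qed

lemma hp_mono: "m \<le> n \<Longrightarrow> hp m v \<le> hp n v"
  by (rule lift_Suc_mono_le[of "\<lambda>n. hp n v"]) (use hp_Suc_ge in auto)

lemma hp_tendsto: "(\<lambda>n. hp n v) \<longlonglongrightarrow> 1 - y v"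
proof -
  have "convergent (\<lambda>n. hp n v)"
    by (rule Bseq_mono_convergent)
       (use hp_nonneg hp_le_1 hp_mono in \<open>auto intro!: BseqI'[of _ 1]\<close>)
  thus ?thesis by (simp add: escape_def convergent_LIMSEQ_iff)
qed

lemma hp_le: "hp n v \<le> 1 - y v"
  by (rule incseq_le[OF _ hp_tendsto]) (auto simp: incseq_def hp_mono)

lemma y_ge_0: "0 \<le> y v"
proof -
  have "1 - y v \<le> 1" by (rule LIMSEQ_le_const2[OF hp_tendsto]) (use hp_le_1 in auto)
  thus ?thesis by simp
qed

lemma y_root [simp]: "y \<rho> = 0"
  using hp_le[of 0 \<rho>] y_ge_0[of \<rho>] by simp

text \<open>The root is hit from a vertex with positive probability in finitely many steps as soon
  as this holds for a neighbour; connectedness does the rest.\<close>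

lemma y_lt_1: "y v < 1"
proof -
  have "{v. \<exists>n. 0 < hp n v} = UNIV"
  proof (rule closed_under_adj_UNIV[of \<rho>])
    show "\<rho> \<in> {v. \<exists>n. 0 < hp n v}" by simp
    fix u w assume "u \<in> {v. \<exists>n. 0 < hp n v}" "adj u w"
    then obtain n where n: "0 < hp n u" by auto
    have uw: "u \<in> nbrs adj w" using adj_sym[OF \<open>adj u w\<close>] by (simp add: nbrs_def)
    have "0 < trans_prob adj c w u * hp n u"
      using n adj_sym[OF \<open>adj u w\<close>] c_pos[of w u] cond_pos[of w] by (simp add: trans_prob_def)
    also have "\<dots> \<le> (\<Sum>x\<in>nbrs adj w. trans_prob adj c w x * hp n x)"
      by (rule member_le_sum[OF uw]) (auto simp: finite_nbrs trans_prob_nonneg hp_nonneg)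
    finally have "0 < hp (Suc n) w" by simp
    thus "w \<in> {v. \<exists>n. 0 < hp n v}" by blast
  qed
  then obtain n where "0 < hp n v" by auto
  thus ?thesis using hp_le[of n v] by simp
qed

text \<open>Within \<open>n\<close> steps the walk reaches the root from finitely many vertices
  only. Hence the summation by parts is finite, and every infinite set of vertices contains a zero
  of \<open>hp n\<close>.\<close>

lemma finite_hp_support: "finite {v. hp n v \<noteq> 0}"
proof (induction n)
  case 0
  show ?case by simp
next
  case (Suc n)
  have "{v. hp (Suc n) v \<noteq> 0} \<subseteq> insert \<rho> (\<Union>u\<in>{v. hp n v \<noteq> 0}. nbrs adj u)"
  proof
    fix v assume v: "v \<in> {v. hp (Suc n) v \<noteq> 0}"
    show "v \<in> insert \<rho> (\<Union>u\<in>{v. hp n v \<noteq> 0}. nbrs adj u)"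
    proof (cases "v = \<rho>")
      case False
      hence "(\<Sum>u\<in>nbrs adj v. trans_prob adj c v u * hp n u) \<noteq> 0" using v by simp
      then obtain u where "u \<in> nbrs adj v" "trans_prob adj c v u * hp n u \<noteq> 0"
        by (rule sum.not_neutral_contains_not_neutral)
      hence "v \<in> nbrs adj u" "hp n u \<noteq> 0" using adj_sym[of v u] by (simp_all add: nbrs_def)
      thus ?thesis by blast
    qed simp
  qed
  moreover have "finite (insert \<rho> (\<Union>u\<in>{v. hp n v \<noteq> 0}. nbrs adj u))"
    using Suc finite_nbrs by (intro finite.insertI finite_UN_I)
  ultimately show ?case by (rule finite_subset)
qed

text \<open>\<open>G\<close> contains the outer boundary of \<open>R\<close>. Off the root,
  \<open>hp\<close> at one time is the average of \<open>hp\<close> at the time before, so the bound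
  spreads by induction on time; monotonicity in time makes the bound on \<open>G\<close> at time
  \<open>n\<close> available at all earlier times.\<close>

lemma max_principle:
  assumes nb: "\<And>v u. v \<in> R \<Longrightarrow> adj v u \<Longrightarrow> u \<in> R \<union> G" and "\<rho> \<notin> R"
    and G: "\<And>v. v \<in> G \<Longrightarrow> hp n v \<le> e" and "0 \<le> e" and v: "v \<in> R"
  shows "hp n v \<le> e"
proof -
  have "k \<le> n \<Longrightarrow> \<forall>v\<in>R \<union> G. hp k v \<le> e" for k
  proof (induction k)
    case 0
    have "hp 0 v \<le> e" if "v \<in> G" for v using G[OF that] hp_mono[of 0 n v] by linarith
    thus ?case using \<open>\<rho> \<notin> R\<close> \<open>0 \<le> e\<close> by (metis Un_iff hit_prob.simps(1))
  next
    case (Suc k)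
    have "hp (Suc k) v \<le> e" if "v \<in> G" for v
      using G[OF that] hp_mono[OF Suc.prems, of v] by linarith
    moreover have "hp (Suc k) v \<le> e" if "v \<in> R" for v
      using that \<open>\<rho> \<notin> R\<close> Suc nb by (auto intro!: trans_prob_avg_le)
    ultimately show ?case by blast
  qed
  thus ?thesis using v by blast
qed

section \<open>Gradients and Dirichlet energy\<close>

definition grad :: "('v \<Rightarrow> real) \<Rightarrow> 'v \<Rightarrow> real" where
  "grad f v = (\<Sum>u\<in>nbrs adj v. c v u * \<bar>f v - f u\<bar>)"

lemma grad_nonneg: "0 \<le> grad f v"
  unfolding grad_def using c_pos by (intro sum_nonneg) (auto simp: nbrs_def less_imp_le intro!: mult_nonneg_nonneg)

lemma diff_le_grad:
  assumes "adj v u"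
  shows "\<bar>f v - f u\<bar> \<le> M * grad f v"
proof -
  have "c v u * \<bar>f v - f u\<bar> \<le> grad f v"
    unfolding grad_def using assms c_pos
    by (intro member_le_sum[of u _ "\<lambda>u. c v u * \<bar>f v - f u\<bar>"])
       (auto simp: nbrs_def finite_nbrs[unfolded nbrs_def] less_imp_le)
  moreover have "inverse M * \<bar>f v - f u\<bar> \<le> c v u * \<bar>f v - f u\<bar>"
    using c_bounds[OF assms] by (intro mult_right_mono) auto
  ultimately have "inverse M * \<bar>f v - f u\<bar> \<le> grad f v" by linarith
  thus ?thesis using M0 by (simp add: field_simps)
qed

definition energy_density :: "('v \<Rightarrow> real) \<Rightarrow> 'v \<Rightarrow> real" where
  "energy_density f v = (\<Sum>u\<in>nbrs adj v. c v u * (f v - f u)\<^sup>2)"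

lemma energy_density_nonneg: "0 \<le> energy_density f v"
  unfolding energy_density_def using c_pos by (intro sum_nonneg) (auto simp: nbrs_def less_imp_le intro!: mult_nonneg_nonneg)

text \<open>Cauchy-Schwarz with each conductance split into two square roots. Thus
  \<open>grad f\<close> is a vertex weight that controls the increments of \<open>f\<close> at
  \<open>v\<close> and is square-summable when the energy is finite.\<close>

lemma grad_square_le: "(grad f v)\<^sup>2 \<le> M\<^sup>2 * energy_density f v"
proof -
  have "(grad f v)\<^sup>2 = (\<Sum>u\<in>nbrs adj v. sqrt (c v u) * (sqrt (c v u) * \<bar>f v - f u\<bar>))\<^sup>2"
    unfolding grad_def using c_pos
    by (intro arg_cong[where f = "\<lambda>x. x\<^sup>2"] sum.cong)
       (auto simp: nbrs_def less_imp_le mult.assoc[symmetric])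
  also have "\<dots> \<le> (\<Sum>u\<in>nbrs adj v. (sqrt (c v u))\<^sup>2) * (\<Sum>u\<in>nbrs adj v. (sqrt (c v u) * \<bar>f v - f u\<bar>)\<^sup>2)"
    by (rule Cauchy_Schwarz_ineq_sum)
  also have "(\<Sum>u\<in>nbrs adj v. (sqrt (c v u))\<^sup>2) = cond adj c v"
    unfolding cond_def using c_pos by (intro sum.cong) (auto simp: nbrs_def less_imp_le)
  also have "(\<Sum>u\<in>nbrs adj v. (sqrt (c v u) * \<bar>f v - f u\<bar>)\<^sup>2) = energy_density f v"
    unfolding energy_density_def using c_pos
    by (intro sum.cong) (auto simp: nbrs_def less_imp_le power_mult_distrib)
  also have "cond adj c v * energy_density f v \<le> M\<^sup>2 * energy_density f v"
    using cond_le[of v] energy_density_nonneg by (intro mult_right_mono) (auto simp: power2_eq_square)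
  finally show ?thesis .
qed

text \<open>Summation by parts: only the root, where the hitting probability fails to be
  subharmonic, contributes positively to the energy.\<close>

lemma energy_hp_le:
  assumes "finite F"
  shows "(\<Sum>v\<in>F. energy_density (hp n) v) \<le> 2 * cond adj c \<rho>"
proof -
  define f where "f = hp n"
  define A where "A = {v. f v \<noteq> 0}"
  \<comment> \<open>Neighbours outside \<open>B\<close> then contribute nothing to the energy, and
    there are none at vertices where \<open>f\<close> is nonzero.\<close>
  define B where "B = insert \<rho> (F \<union> A \<union> (\<Union>v\<in>A. nbrs adj v))"
  define w where "w v u = (if adj v u then c v u else 0)" for v u
  have finA: "finite A" unfolding A_def f_def by (rule finite_hp_support)
  have finB: "finite B" unfolding B_def using finA assms finite_nbrs by auto
  have wsym: "w v u = w u v" for v u unfolding w_def using adj_commute[of v u] c_sym by auto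
  have conv: "(\<Sum>u\<in>nbrs adj v. c v u * g u) = (\<Sum>u\<in>B. w v u * g u)"
    if "\<And>u. adj v u \<Longrightarrow> u \<notin> B \<Longrightarrow> g u = 0" for v and g :: "'v \<Rightarrow> real"
  proof -
    have "(\<Sum>u\<in>B. w v u * g u) = (\<Sum>u\<in>B \<inter> nbrs adj v. w v u * g u)"
      using finB by (intro sum.mono_neutral_right) (auto simp: w_def nbrs_def)
    also have "\<dots> = (\<Sum>u\<in>B \<inter> nbrs adj v. c v u * g u)"
      by (intro sum.cong) (auto simp: w_def nbrs_def)
    also have "\<dots> = (\<Sum>u\<in>nbrs adj v. c v u * g u)"
      using finite_nbrs that by (intro sum.mono_neutral_left) (auto simp: nbrs_def)
    finally show ?thesis by simp
  qed
  have out: "f u = 0" if "u \<notin> B" for u using that unfolding B_def A_def by auto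
  have nbA: "u \<in> B" if "adj v u" "f v \<noteq> 0" for u v using that unfolding B_def A_def nbrs_def by auto
  have "(\<Sum>v\<in>F. energy_density f v) \<le> (\<Sum>v\<in>B. energy_density f v)"
    using finB by (intro sum_mono2) (auto simp: B_def energy_density_nonneg)
  also have "\<dots> = (\<Sum>v\<in>B. \<Sum>u\<in>B. w v u * (f v - f u)\<^sup>2)"
    unfolding energy_density_def
  proof (rule sum.cong[OF refl], rule conv)
    fix v u assume "adj v u" "u \<notin> B"
    hence "f v = 0" "f u = 0" using nbA out by blast+
    thus "(f v - f u)\<^sup>2 = 0" by simp
  qed
  also have "\<dots> = (\<Sum>v\<in>B. \<Sum>u\<in>B. w v u * (f v - f u) * f v) - (\<Sum>v\<in>B. \<Sum>u\<in>B. w v u * (f v - f u) * f u)"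
    by (simp add: sum_subtractf[symmetric] power2_eq_square algebra_simps)
  \<comment> \<open>Exchanging \<open>u\<close> and \<open>v\<close> shows that the second double
    sum is minus the first, so the energy is twice the first.\<close>
  also have "(\<Sum>v\<in>B. \<Sum>u\<in>B. w v u * (f v - f u) * f u) = (\<Sum>u\<in>B. \<Sum>v\<in>B. w v u * (f v - f u) * f u)"
    by (rule sum.swap)
  also have "\<dots> = - (\<Sum>v\<in>B. \<Sum>u\<in>B. w v u * (f v - f u) * f v)"
    unfolding sum_negf[symmetric] by (intro sum.cong refl) (metis wsym minus_diff_eq mult_minus_left mult_minus_right)
  also have "(\<Sum>v\<in>B. \<Sum>u\<in>B. w v u * (f v - f u) * f v) \<le> (\<Sum>v\<in>B. if v = \<rho> then cond adj c \<rho> else 0)"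
  proof (rule sum_mono)
    fix v assume "v \<in> B"
    show "(\<Sum>u\<in>B. w v u * (f v - f u) * f v) \<le> (if v = \<rho> then cond adj c \<rho> else 0)"
    proof (cases "f v = 0")
      case True
      thus ?thesis using cond_pos[of \<rho>] by simp
    next
      case False
      have "(\<Sum>u\<in>B. w v u * (f v - f u) * f v) = (\<Sum>u\<in>B. w v u * (f v - f u)) * f v"
        by (simp add: sum_distrib_right)
      also have "(\<Sum>u\<in>B. w v u * (f v - f u)) = (\<Sum>u\<in>nbrs adj v. c v u * (f v - f u))"
        by (rule conv[symmetric]) (use nbA False in auto)
      also have "\<dots> = cond adj c v * f v - (\<Sum>u\<in>nbrs adj v. c v u * f u)"
        by (simp add: cond_def algebra_simps sum_subtractf sum_distrib_left)
      finally have eq: "(\<Sum>u\<in>B. w v u * (f v - f u) * f v)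
        = (cond adj c v * f v - (\<Sum>u\<in>nbrs adj v. c v u * f u)) * f v" .
      show ?thesis
      proof (cases "v = \<rho>")
        case True
        have "0 \<le> (\<Sum>u\<in>nbrs adj v. c v u * f u)"
          using c_pos hp_nonneg by (intro sum_nonneg) (auto simp: nbrs_def f_def less_imp_le)
        thus ?thesis using eq True by (simp add: f_def)
      next
        case False
        \<comment> \<open>\<open>hp (Suc n) v\<close> is the average of \<open>f\<close> over the
          neighbours of \<open>v\<close>, so monotonicity in time is subharmonicity off the
          root.\<close>
        have "f v \<le> hp (Suc n) v" unfolding f_def by (rule hp_Suc_ge)
        also have "\<dots> = (\<Sum>u\<in>nbrs adj v. c v u * f u / cond adj c v)"
          using False by (auto simp: trans_prob_eq f_def intro!: sum.cong)
        also have "\<dots> = (\<Sum>u\<in>nbrs adj v. c v u * f u) / cond adj c v"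
          by (simp add: sum_divide_distrib)
        finally have "cond adj c v * f v \<le> (\<Sum>u\<in>nbrs adj v. c v u * f u)"
          using cond_pos[of v] by (simp add: field_simps)
        hence "(cond adj c v * f v - (\<Sum>u\<in>nbrs adj v. c v u * f u)) * f v \<le> 0"
          using hp_nonneg[of n v] by (intro mult_nonpos_nonneg) (auto simp: f_def)
        thus ?thesis using eq False by simp
      qed
    qed
  qed
  also have "(\<Sum>v\<in>B. if v = \<rho> then cond adj c \<rho> else 0) = cond adj c \<rho>"
    using finB by (simp add: sum.delta B_def)
  finally show ?thesis unfolding f_def by simp
qed

text \<open>Finite sums pass to the limit in \<open>n\<close>, and \<open>y\<close> has the same
  squared increments as \<open>1 - y\<close>.\<close>

lemma energy_y_le:
  assumes "finite F"
  shows "(\<Sum>v\<in>F. energy_density y v) \<le> 2 * cond adj c \<rho>"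
proof -
  have "(\<lambda>n. \<Sum>v\<in>F. energy_density (hp n) v) \<longlonglongrightarrow> (\<Sum>v\<in>F. \<Sum>u\<in>nbrs adj v. c v u * ((1 - y v) - (1 - y u))\<^sup>2)"
    unfolding energy_density_def by (intro tendsto_intros hp_tendsto)
  also have "(\<Sum>v\<in>F. \<Sum>u\<in>nbrs adj v. c v u * ((1 - y v) - (1 - y u))\<^sup>2) = (\<Sum>v\<in>F. energy_density y v)"
    unfolding energy_density_def by (simp add: power2_commute)
  finally show ?thesis
    by (rule LIMSEQ_le_const2) (use energy_hp_le[OF assms] in auto)
qed

definition E0 :: real where "E0 = M\<^sup>2 * (2 * cond adj c \<rho>)"

lemma grad_sum_le:
  assumes "finite F" and "(\<Sum>v\<in>F. energy_density f v) \<le> 2 * cond adj c \<rho>"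
  shows "(\<Sum>v\<in>F. (grad f v)\<^sup>2) \<le> E0"
proof -
  have "(\<Sum>v\<in>F. (grad f v)\<^sup>2) \<le> (\<Sum>v\<in>F. M\<^sup>2 * energy_density f v)"
    by (intro sum_mono grad_square_le)
  also have "\<dots> \<le> E0"
    unfolding sum_distrib_left[symmetric] E0_def using assms(2) by (intro mult_left_mono) auto
  finally show ?thesis .
qed

lemmas grad_hp_sum = grad_sum_le[OF _ energy_hp_le]
lemmas grad_y_sum = grad_sum_le[OF _ energy_y_le]

lemma E0_pos: "0 < E0"
  unfolding E0_def using M0 cond_pos[of \<rho>] by simp

text \<open>Transience says that \<open>1 - y\<close> has average below 1 over the neighbours of the
  root, and the average of \<open>y\<close> there is \<open>eta\<close> divided by the conductance
  of the root.\<close>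

lemma eta_pos:
  assumes "transient adj c \<rho>"
  shows "0 < eta adj c \<rho>"
proof -
  have "(\<Sum>u\<in>nbrs adj \<rho>. trans_prob adj c \<rho> u * (1 - y u)) = 1 - (\<Sum>u\<in>nbrs adj \<rho>. trans_prob adj c \<rho> u * y u)"
    by (simp add: right_diff_distrib sum_subtractf trans_prob_sum)
  also have "(\<Sum>u\<in>nbrs adj \<rho>. trans_prob adj c \<rho> u * y u) = (\<Sum>u\<in>nbrs adj \<rho>. c \<rho> u * y u / cond adj c \<rho>)"
    by (intro sum.cong) (auto simp: trans_prob_eq)
  also have "\<dots> = eta adj c \<rho> / cond adj c \<rho>" unfolding eta_def by (simp add: sum_divide_distrib)
  finally show ?thesis using assms cond_pos[of \<rho>] by (simp add: transient_def zero_less_divide_iff)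
qed

end

section \<open>Proper plane triangulations\<close>

text \<open>The inverse of the arc would map an open disc injectively and continuously into the
  line, against invariance of dimension.\<close>

lemma arc_image_not_ball:
  fixes g :: "real \<Rightarrow> complex"
  assumes "arc g" "0 < e"
  shows "\<not> ball p e \<subseteq> path_image g"
proof
  assume sub: "ball p e \<subseteq> path_image g"
  obtain h where h: "homeomorphism {0..1} (path_image g) g h" using homeomorphism_arc[OF \<open>arc g\<close>] .
  have "aff_dim (ball p e) \<le> aff_dim (UNIV :: real set)"
  proof (rule invariance_of_dimension_convex_domain)
    show "continuous_on (ball p e) h"
      using h sub by (meson continuous_on_subset homeomorphism_cont2)
    show "inj_on h (ball p e)"
      using h sub by (intro inj_on_inverseI[where g = g]) (auto simp: homeomorphism_def)
  qed auto
  thus False using \<open>0 < e\<close> by (simp add: aff_dim_open)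
qed

locale plane_triangulation =
  fixes adj :: "'v \<Rightarrow> 'v \<Rightarrow> bool" and pos :: "'v \<Rightarrow> complex" and ep :: "'v \<Rightarrow> 'v \<Rightarrow> real \<Rightarrow> complex"
  assumes tri: "proper_plane_triangulation adj pos ep"
    and symm: "adj u v \<Longrightarrow> adj v u"
    and no_loop: "\<not> adj v v"
    and infinite_V: "infinite (UNIV :: 'v set)"
begin

abbreviation "E \<equiv> emb_image adj pos ep"
abbreviation "edge u v \<equiv> path_image (ep u v)"
abbreviation "Faces \<equiv> faces adj pos ep"
abbreviation "tface \<equiv> triangle_face adj ep"

lemma emb: "proper_embedding adj pos ep" using tri unfolding proper_plane_triangulation_def by blast

lemma face_triangle: "F \<in> Faces \<Longrightarrow> \<exists>a b c. tface a b c F"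
  using tri unfolding proper_plane_triangulation_def by blast

lemma inj_pos: "inj pos"
  using emb unfolding proper_embedding_def by (rule conjunct1)

lemma edge_facts:
  assumes "adj u v"
  shows edge_arc: "arc (ep u v)" and edge_start: "pathstart (ep u v) = pos u"
    and edge_finish: "pathfinish (ep u v) = pos v" and edge_rev: "ep v u = reversepath (ep u v)"
proof -
  have "\<forall>u v. adj u v \<longrightarrow> arc (ep u v) \<and> pathstart (ep u v) = pos u \<and> pathfinish (ep u v) = pos v
    \<and> ep v u = reversepath (ep u v)"
    using emb unfolding proper_embedding_def by (elim conjE)
  thus "arc (ep u v)" "pathstart (ep u v) = pos u" "pathfinish (ep u v) = pos v"
    "ep v u = reversepath (ep u v)" using assms by simp_all
qed

lemma pos_notin_edge: "adj u v \<Longrightarrow> w \<notin> {u, v} \<Longrightarrow> pos w \<notin> edge u v"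
proof -
  have "\<forall>u v w. adj u v \<and> w \<notin> {u, v} \<longrightarrow> pos w \<notin> edge u v"
    using emb unfolding proper_embedding_def by (elim conjE)
  thus "adj u v \<Longrightarrow> w \<notin> {u, v} \<Longrightarrow> pos w \<notin> edge u v" by simp
qed

lemma edges_Int:
  assumes "adj u v" "adj u' v'" "{u, v} \<noteq> {u', v'}"
  shows "edge u v \<inter> edge u' v' \<subseteq> pos ` ({u, v} \<inter> {u', v'})"
proof -
  have "\<forall>u v u' v'. adj u v \<and> adj u' v' \<and> {u, v} \<noteq> {u', v'} \<longrightarrow>
      edge u v \<inter> edge u' v' \<subseteq> pos ` ({u, v} \<inter> {u', v'})"
    using emb unfolding proper_embedding_def by (elim conjE)
  thus ?thesis using assms by meson
qed

lemma
  assumes "compact K"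
  shows finite_pos: "finite {v. pos v \<in> K}"
    and finite_edges: "finite {(u, v). adj u v \<and> edge u v \<inter> K \<noteq> {}}"
proof -
  have "\<forall>K. compact K \<longrightarrow> finite {v. pos v \<in> K} \<and> finite {(u, v). adj u v \<and> edge u v \<inter> K \<noteq> {}}"
    using emb unfolding proper_embedding_def by (elim conjE)
  thus "finite {v. pos v \<in> K}" "finite {(u, v). adj u v \<and> edge u v \<inter> K \<noteq> {}}"
    using assms by simp_all
qed

lemma edge_commute: "adj u v \<Longrightarrow> edge v u = edge u v"
  by (simp add: edge_rev)

lemma pos_in_edge: "adj u v \<Longrightarrow> pos u \<in> edge u v" "adj u v \<Longrightarrow> pos v \<in> edge u v"
  using edge_start edge_finish by (metis pathstart_in_path_image pathfinish_in_path_image)+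

lemma pos_in_edge_iff: "adj u v \<Longrightarrow> pos w \<in> edge u v \<longleftrightarrow> w = u \<or> w = v"
  using pos_in_edge pos_notin_edge by blast

lemma closed_edge: "adj u v \<Longrightarrow> closed (edge u v)"
  using edge_arc by (simp add: arc_imp_path closed_path_image)

lemma edge_subset_E: "adj u v \<Longrightarrow> edge u v \<subseteq> E" and pos_in_E: "pos v \<in> E"
  unfolding emb_image_def by blast+

text \<open>The edges and vertices that meet the unit disc around \<open>x\<close> but miss
  \<open>x\<close> are finitely many, so their union is closed.\<close>

lemma locally_finite:
  obtains e where "0 < e" "\<And>u v. adj u v \<Longrightarrow> edge u v \<inter> ball x e \<noteq> {} \<Longrightarrow> x \<in> edge u v"
    "\<And>v. pos v \<in> ball x e \<Longrightarrow> pos v = x"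
proof -
  define I where "I = {(u, v). adj u v \<and> edge u v \<inter> cball x 1 \<noteq> {}}"
  define C where "C = (\<Union>(u,v)\<in>{(u,v)\<in>I. x \<notin> edge u v}. edge u v) \<union> pos ` {v. pos v \<in> cball x 1 \<and> pos v \<noteq> x}"
  have "finite I" unfolding I_def by (rule finite_edges) simp
  have "finite {v. pos v \<in> cball x 1 \<and> pos v \<noteq> x}" using finite_pos[of "cball x 1"] by (rule rev_finite_subset) auto
  moreover have "finite {(u,v)\<in>I. x \<notin> edge u v}" using \<open>finite I\<close> by (rule rev_finite_subset) auto
  ultimately have "closed C" unfolding C_def
    using closed_edge by (intro closed_Un closed_UN finite_imp_closed finite_imageI) (auto simp: I_def)
  moreover have "x \<notin> C" unfolding C_def by auto
  ultimately obtain d where d: "0 < d" "ball x d \<subseteq> - C"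
    by (metis Compl_iff open_Compl openE)
  show thesis
  proof (rule that[of "min d 1"])
    show "0 < min d 1" using d by simp
    fix u v assume uv: "adj u v" "edge u v \<inter> ball x (min d 1) \<noteq> {}"
    hence "(u, v) \<in> I" unfolding I_def by auto
    thus "x \<in> edge u v" using uv d unfolding C_def by fastforce
  next
    fix v assume "pos v \<in> ball x (min d 1)"
    hence "pos v \<in> cball x 1" "pos v \<notin> C" using d by auto
    thus "pos v = x" unfolding C_def by blast
  qed
qed

lemma closed_E: "closed E"
proof -
  have "open (- E)"
  proof (rule openI)
    fix x assume x: "x \<in> - E"
    obtain e where e: "0 < e" "\<And>u v. adj u v \<Longrightarrow> edge u v \<inter> ball x e \<noteq> {} \<Longrightarrow> x \<in> edge u v"
      "\<And>v. pos v \<in> ball x e \<Longrightarrow> pos v = x" using locally_finite[of x] by metis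
    have "ball x e \<subseteq> - E"
    proof
      fix q assume q: "q \<in> ball x e"
      show "q \<in> - E"
      proof
        assume "q \<in> E"
        then consider v where "q = pos v" | u v where "adj u v" "q \<in> edge u v"
          unfolding emb_image_def by blast
        thus False
        proof cases
          case 1 thus ?thesis using e(3) q x pos_in_E by auto
        next
          case 2
          hence "x \<in> edge u v" using e(2)[OF 2(1)] q by blast
          thus ?thesis using x edge_subset_E[OF 2(1)] by auto
        qed
      qed
    qed
    thus "\<exists>e>0. ball x e \<subseteq> - E" using e by blast
  qed
  thus ?thesis by (simp add: closed_def)
qed

lemma face_open: "F \<in> Faces \<Longrightarrow> open F"
  unfolding faces_def using closed_E by (meson open_Compl open_components)

lemma face_connected: "F \<in> Faces \<Longrightarrow> connected F" and face_nonempty: "F \<in> Faces \<Longrightarrow> F \<noteq> {}"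
  and face_disjoint_E: "F \<in> Faces \<Longrightarrow> F \<inter> E = {}"
  unfolding faces_def using in_components_connected in_components_nonempty in_components_subset by blast+

lemma ex_face: "q \<notin> E \<Longrightarrow> \<exists>F\<in>Faces. q \<in> F"
  unfolding faces_def by (metis ComplI UnionE Union_components)

lemma tface_facts:
  assumes "tface a b c F"
  shows "distinct [a, b, c]" "adj a b" "adj b c" "adj c a" "adj b a" "adj c b" "adj a c"
    "frontier F = edge a b \<union> edge b c \<union> edge c a"
  using assms symm unfolding triangle_face_def by auto

lemma tface_rotate: "tface a b c F \<Longrightarrow> tface b c a F"
  unfolding triangle_face_def by auto

lemma tface_flip:
  assumes "tface a b c F"
  shows "tface b a c F"
proof -
  note t = tface_facts[OF assms]
  have "edge b a = edge a b" "edge a c = edge c a" "edge c b = edge b c" using t edge_commute by blast+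
  thus ?thesis using t unfolding triangle_face_def by (auto simp: Un_ac)
qed

lemma pos_in_frontier_iff:
  assumes "tface a b c F"
  shows "pos v \<in> frontier F \<longleftrightarrow> v \<in> {a, b, c}"
  using pos_in_edge_iff[of a b v] pos_in_edge_iff[of b c v] pos_in_edge_iff[of c a v] tface_facts(2-4)[OF assms]
  by (simp add: tface_facts(8)[OF assms] disj_ac)

text \<open>The frontier is a Jordan curve, and a face agrees with the side of the curve that it
  meets, because the two connected sets have the same frontier and avoid it. The outer side is
  impossible: all vertices would lie in a compact set, against properness and the infinity of the
  graph.\<close>

lemma face_is_inside:
  assumes F: "F \<in> Faces" and t: "tface a b c F"
  shows "F = inside (frontier F)" "connected (outside (frontier F))" "open (outside (frontier F))"
    "frontier (outside (frontier F)) = frontier F"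
    "\<And>v. v \<notin> {a, b, c} \<Longrightarrow> pos v \<in> outside (frontier F)"
proof -
  note tf = tface_facts[OF t]
  define g where "g = ep a b +++ (ep b c +++ ep c a)"
  define J where "J = frontier F"
  have st: "pathstart (ep a b) = pos a" "pathfinish (ep a b) = pos b" "pathstart (ep b c) = pos b"
    "pathfinish (ep b c) = pos c" "pathstart (ep c a) = pos c" "pathfinish (ep c a) = pos a"
    using tf edge_start edge_finish by auto
  have ne: "{a, b} \<noteq> {b, c}" "{b, c} \<noteq> {c, a}" "{a, b} \<noteq> {c, a}" using tf by (auto simp: doubleton_eq_iff)
  have arc2: "arc (ep b c +++ ep c a)"
    using edge_arc tf st edges_Int[OF tf(3) tf(4) ne(2)] by (intro arc_join) auto
  have "simple_path g"
    unfolding g_def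
  proof (rule simple_path_join_loop)
    show "path_image (ep a b) \<inter> path_image (ep b c +++ ep c a) \<subseteq> {pathstart (ep a b), pathstart (ep b c +++ ep c a)}"
      using edges_Int[OF tf(2) tf(3) ne(1)] edges_Int[OF tf(2) tf(4) ne(3)] tf(1) st
      by (subst path_image_join) (auto simp: st)
  qed (use arc2 edge_arc tf st in auto)
  moreover have "pathfinish g = pathstart g" unfolding g_def using st by simp
  moreover have "path_image g = J"
    unfolding g_def J_def tf(8) using st by (simp add: path_image_join Un_assoc)
  ultimately have jor: "inside J \<noteq> {}" "open (inside J)" "connected (inside J)" "outside J \<noteq> {}"
    "open (outside J)" "connected (outside J)" "bounded (inside J)" "\<not> bounded (outside J)"
    "inside J \<inter> outside J = {}" "inside J \<union> outside J = - J"
    "frontier (inside J) = J" "frontier (outside J) = J"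
    using Jordan_inside_outside[of g] by auto
  have JE: "J \<subseteq> E" unfolding J_def tf(8) using edge_subset_E tf by auto
  have FJ: "F \<inter> J = {}" using face_disjoint_E[OF F] JE by auto
  obtain q where q: "q \<in> F" using face_nonempty[OF F] by auto
  have eqC: "F = C" if C: "connected C" "C \<inter> J = {}" "F \<subseteq> C \<or> F \<inter> C \<noteq> {}" "frontier C = J" for C
  proof
    have meet: "F \<inter> C \<noteq> {}" using C q by auto
    show "F \<subseteq> C"
      using connected_Int_frontier[OF face_connected[OF F], of C] meet C(4) FJ by auto
    show "C \<subseteq> F"
      using connected_Int_frontier[OF C(1), of F] meet C(2) unfolding J_def by auto
  qed
  have "F \<noteq> outside J"
  proof
    assume eq: "F = outside J"
    have "range pos \<subseteq> J \<union> inside J"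
      using face_disjoint_E[OF F] pos_in_E jor(10) unfolding eq by blast
    moreover have "bounded J" unfolding J_def tf(8)
      using edge_arc tf by (simp add: arc_imp_path bounded_path_image)
    hence "bounded (J \<union> inside J)" using jor by simp
    ultimately have "finite {v. pos v \<in> closure (J \<union> inside J)}"
      by (intro finite_pos iffD2[OF compact_closure])
    moreover have "{v. pos v \<in> closure (J \<union> inside J)} = UNIV"
      using \<open>range pos \<subseteq> J \<union> inside J\<close> closure_subset[of "J \<union> inside J"] by blast
    ultimately show False using infinite_V by metis
  qed
  moreover have "F = inside J \<or> F = outside J"
  proof (cases "q \<in> inside J")
    case True
    have "F = inside J" by (rule eqC) (use True q jor in auto)
    thus ?thesis ..
  next
    case False
    hence "q \<in> outside J" using q FJ jor(10) by blast
    have "F = outside J" by (rule eqC) (use \<open>q \<in> outside J\<close> q jor in auto)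
    thus ?thesis ..
  qed
  ultimately have Fin: "F = inside J" by blast
  thus "F = inside (frontier F)" "connected (outside (frontier F))" "open (outside (frontier F))"
    "frontier (outside (frontier F)) = frontier F" using jor unfolding J_def by auto
  fix v assume "v \<notin> {a, b, c}"
  hence "pos v \<notin> J" unfolding J_def using pos_in_frontier_iff[OF t] by blast
  moreover have "pos v \<notin> inside J" using face_disjoint_E[OF F] pos_in_E[of v] Fin by blast
  ultimately have "pos v \<in> outside J" using jor(10) by blast
  thus "pos v \<in> outside (frontier F)" unfolding J_def .
qed

text \<open>The segment from \<open>q\<close> to \<open>x\<close> must leave the face of
  \<open>q\<close>, and the edge at which it does so passes through \<open>x\<close> by the choice
  of \<open>e\<close>. Rotating the names makes it the edge from \<open>a\<close> to
  \<open>b\<close>.\<close>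

lemma face_near:
  assumes e: "0 < e" "\<And>u v. adj u v \<Longrightarrow> edge u v \<inter> ball x e \<noteq> {} \<Longrightarrow> x \<in> edge u v"
    and x: "x \<in> E" and q: "q \<in> ball x e" "q \<notin> E"
  obtains F a b c where "F \<in> Faces" "q \<in> F" "tface a b c F" "x \<in> edge a b"
proof -
  obtain F where F: "F \<in> Faces" "q \<in> F" using ex_face q by blast
  obtain a b c where t: "tface a b c F" using face_triangle[OF F(1)] by blast
  have "x \<notin> F" using face_disjoint_E[OF F(1)] x by auto
  hence "closed_segment q x \<inter> frontier F \<noteq> {}"
    using F(2) by (intro connected_Int_frontier) auto
  then obtain z where z: "z \<in> closed_segment q x" "z \<in> frontier F" by blast
  have "closed_segment q x \<subseteq> ball x e" using q e by (intro closed_segment_subset) auto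
  hence zb: "z \<in> ball x e" using z by blast
  consider "z \<in> edge a b" | "z \<in> edge b c" | "z \<in> edge c a" using z(2) tface_facts(8)[OF t] by auto
  thus thesis
  proof cases
    case 1
    hence "x \<in> edge a b" using e(2)[of a b] zb tface_facts[OF t] by blast
    thus ?thesis using that[OF F t] by simp
  next
    case 2
    hence "x \<in> edge b c" using e(2)[of b c] zb tface_facts[OF t] by blast
    thus ?thesis using that[OF F tface_rotate[OF t]] by simp
  next
    case 3
    hence "x \<in> edge c a" using e(2)[of c a] zb tface_facts[OF t] by blast
    thus ?thesis using that[OF F tface_rotate[OF tface_rotate[OF t]]] by simp
  qed
qed

text \<open>Near the midpoint of the edge the graph is just this edge, so all faces there have it as
  a side. A point off the edge gives one of them; a point beyond its bounding curve gives the other,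
  which has another apex because a face is determined by its frontier.\<close>

lemma edge_two_faces:
  assumes vw: "adj v w"
  obtains b b' F F' where "F \<in> Faces" "F' \<in> Faces" "tface v w b F" "tface v w b' F'" "b \<noteq> b'"
proof -
  define p where "p = ep v w (1/2)"
  have inj: "inj_on (ep v w) {0..1}" using edge_arc[OF vw] by (rule arc_imp_inj_on)
  have p_in: "p \<in> edge v w" unfolding p_def path_image_def by auto
  have "p \<noteq> pathstart (ep v w)" "p \<noteq> pathfinish (ep v w)"
    using inj_onD[OF inj, of "1/2" 0] inj_onD[OF inj, of "1/2" 1]
    unfolding p_def pathstart_def pathfinish_def by auto
  hence p_pos: "p \<noteq> pos u" for u
    using p_in pos_in_edge_iff[OF vw, of u] edge_start[OF vw] edge_finish[OF vw] by metis
  have p_edge: "{u, u'} = {v, w}" if "adj u u'" "p \<in> edge u u'" for u u'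
    using edges_Int[OF that(1) vw] that(2) p_in p_pos by blast
  have pE: "p \<in> E" using p_in edge_subset_E[OF vw] by auto
  obtain e where e: "0 < e" "\<And>u u'. adj u u' \<Longrightarrow> edge u u' \<inter> ball p e \<noteq> {} \<Longrightarrow> p \<in> edge u u'"
    "\<And>u. pos u \<in> ball p e \<Longrightarrow> pos u = p" using locally_finite[of p] by metis
  have ballE: "q \<in> edge v w" if q: "q \<in> ball p e" "q \<in> E" for q
  proof -
    consider u where "q = pos u" | u u' where "adj u u'" "q \<in> edge u u'"
      using q(2) unfolding emb_image_def by blast
    thus ?thesis
    proof cases
      case 1 thus ?thesis using e(3) q p_pos by metis
    next
      case 2
      hence "{u, u'} = {v, w}" using p_edge e(2) q by blast
      thus ?thesis using 2 edge_commute[OF vw] by (auto simp: doubleton_eq_iff)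
    qed
  qed
  have face: "\<exists>F b. F \<in> Faces \<and> q \<in> F \<and> tface v w b F" if q: "q \<in> ball p e" "q \<notin> E" for q
  proof -
    obtain F a b c where F: "F \<in> Faces" "q \<in> F" "tface a b c F" "p \<in> edge a b"
      using face_near[OF e(1,2) pE q] by blast
    have "{a, b} = {v, w}" using p_edge[OF _ F(4)] tface_facts(2)[OF F(3)] by blast
    hence "tface v w c F" using F(3) tface_flip[OF F(3)] by (auto simp: doubleton_eq_iff)
    thus ?thesis using F by blast
  qed
  obtain q where "q \<in> ball p e" "q \<notin> edge v w" using arc_image_not_ball[OF edge_arc[OF vw] e(1)] by blast
  then obtain F b where F: "F \<in> Faces" "tface v w b F" using face ballE by blast
  have "p \<in> frontier (outside (frontier F))"
    using face_is_inside(4)[OF F] tface_facts(8)[OF F(2)] p_in by auto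
  hence "p \<in> closure (outside (frontier F))" unfolding frontier_def[of "outside (frontier F)"] by blast
  then obtain q' where q': "q' \<in> ball p e" "q' \<in> outside (frontier F)"
    using e(1) unfolding closure_approachable by (metis dist_commute mem_ball)
  have "q' \<notin> E"
  proof
    assume "q' \<in> E"
    hence "q' \<in> frontier F" using ballE[OF q'(1)] tface_facts(8)[OF F(2)] by auto
    thus False using q'(2) by (metis IntI empty_iff outside_no_overlap)
  qed
  then obtain F' b' where F': "F' \<in> Faces" "q' \<in> F'" "tface v w b' F'" using face q' by blast
  have "b \<noteq> b'"
  proof
    assume "b = b'"
    hence "frontier F' = frontier F" using tface_facts(8)[OF F(2)] tface_facts(8)[OF F'(3)] by simp
    hence "F' = F" using face_is_inside(1)[OF F] face_is_inside(1)[OF F'(1,3)] by simp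
    thus False using F' q' face_is_inside(1)[OF F] by (metis IntI empty_iff inside_Int_outside)
  qed
  thus thesis using that F F' by blast
qed

text \<open>A partition of the remaining vertices without connecting edges would induce a partition
  into open sets of the connected region outside the facial triangle.\<close>

lemma face_complement_connected:
  assumes F: "F \<in> Faces" and t: "tface a b c F"
    and XY: "X \<union> Y = - {a, b, c}" "X \<inter> Y = {}"
    and no_edge: "\<And>u v. u \<in> X \<Longrightarrow> v \<in> Y \<Longrightarrow> \<not> adj u v"
    and ne: "X \<noteq> {}" "Y \<noteq> {}"
  shows False
proof -
  define J where "J = frontier F"
  define O' where "O' = outside J"
  note inF = face_is_inside[OF F t, folded J_def, folded O'_def]
  \<comment> \<open>An edge or face belongs to the class of those of its vertices that lie outside
    the triangle; its corners among \<open>a\<close>, \<open>b\<close>, \<open>c\<close> do not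
    count.\<close>
  define U where "U Z = {p\<in>O'. (\<exists>v\<in>Z. p = pos v) \<or> (\<exists>u v. adj u v \<and> u \<in> Z \<and> p \<in> edge u v)
     \<or> (\<exists>G\<in>Faces. p \<in> G \<and> (\<exists>v\<in>Z. pos v \<in> frontier G))}" for Z
  have OJ: "p \<notin> J" if "p \<in> O'" for p using that unfolding O'_def by (metis IntI empty_iff outside_no_overlap)
  have no_edge': "\<not> adj u v" if "u \<in> Y" "v \<in> X" for u v using no_edge[of v u] that symm by blast
  have edge_J: "edge u v \<subseteq> J" if "adj u v" "u \<in> {a, b, c}" "v \<in> {a, b, c}" for u v
    using that tface_facts[OF t] edge_commute[of a b] edge_commute[of b c] edge_commute[of c a] no_loop
    unfolding J_def by auto
  have in_XY: "v \<in> X \<union> Y" if "pos v \<in> O'" for v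
    using XY(1) OJ[OF that] pos_in_frontier_iff[OF t, of v] unfolding J_def by blast
  have edge_XY: "u \<in> X \<union> Y \<or> v \<in> X \<union> Y" if "adj u v" "p \<in> edge u v" "p \<in> O'" for u v p
    using XY(1) edge_J[OF that(1)] OJ[OF that(3)] that(2) by blast
  \<comment> \<open>A face with all corners on the triangle would have its frontier in
    \<open>J\<close> and hence contain the whole outside, in which the vertices of \<open>X\<close>
    lie.\<close>
  have face_XY: "\<exists>v\<in>X \<union> Y. pos v \<in> frontier G" if GF: "G \<in> Faces" "p \<in> G" "p \<in> O'" for G p
  proof (rule ccontr)
    assume neg: "\<not> ?thesis"
    obtain a' b' c' where t': "tface a' b' c' G" using face_triangle[OF GF(1)] by blast
    have "{a', b', c'} \<subseteq> {a, b, c}" using neg XY(1) pos_in_frontier_iff[OF t'] by blast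
    hence "edge a' b' \<subseteq> J" "edge b' c' \<subseteq> J" "edge c' a' \<subseteq> J"
      using tface_facts[OF t'] edge_J by simp_all
    hence "frontier G \<subseteq> J" using tface_facts(8)[OF t'] by blast
    hence "O' \<inter> frontier G = {}" using OJ by blast
    hence "O' \<subseteq> G"
      using connected_Int_frontier[of O' G] GF inF(2) by blast
    moreover obtain x where "x \<in> X" using ne by blast
    hence "pos x \<in> O'" using inF(5) XY by blast
    ultimately show False using face_disjoint_E[OF GF(1)] pos_in_E by blast
  qed
  have edgeU: "p \<in> U Z" if e: "adj u v" "p \<in> edge u v" "p \<in> O'" "u \<in> Z \<or> v \<in> Z" for u v p Z
  proof -
    have "adj v u" "p \<in> edge v u" using e symm[OF e(1)] edge_commute[OF e(1)] by auto
    hence "\<exists>u v. adj u v \<and> u \<in> Z \<and> p \<in> edge u v" using e by metis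
    thus ?thesis using e(3) unfolding U_def by simp
  qed
  have cover: "O' \<subseteq> U X \<union> U Y"
  proof
    fix p assume p: "p \<in> O'"
    show "p \<in> U X \<union> U Y"
    proof (cases "p \<in> E")
      case True
      then consider v where "p = pos v" | u v where "adj u v" "p \<in> edge u v"
        unfolding emb_image_def by blast
      thus ?thesis
      proof cases
        case 1
        hence "v \<in> X \<or> v \<in> Y" using in_XY p by blast
        thus ?thesis using 1 p unfolding U_def by auto
      next
        case 2
        show ?thesis using edge_XY[OF 2 p] edgeU[OF 2 p] by blast
      qed
    next
      case False
      then obtain G where "G \<in> Faces" "p \<in> G" using ex_face by blast
      thus ?thesis using face_XY[of G p] p unfolding U_def by blast
    qed
  qed
  have disj: "U X \<inter> U Y = {}"
  proof (rule ccontr)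
    assume "U X \<inter> U Y \<noteq> {}"
    then obtain p where pX: "p \<in> U X" and pY: "p \<in> U Y" by blast
    hence p: "p \<in> O'" unfolding U_def by blast
    have vertex: False if pz: "p = pos z" for z
    proof -
      have E: "p \<in> E" using pz pos_in_E by simp
      have zX: "z \<in> X"
      proof -
        have "(\<exists>v\<in>X. p = pos v) \<or> (\<exists>u v. adj u v \<and> u \<in> X \<and> p \<in> edge u v)"
          using pX E face_disjoint_E unfolding U_def by blast
        thus ?thesis
        proof
          assume "\<exists>v\<in>X. p = pos v" thus ?thesis using pz inj_pos by (auto dest: injD)
        next
          assume "\<exists>u v. adj u v \<and> u \<in> X \<and> p \<in> edge u v"
          then obtain u v where "adj u v" "u \<in> X" "z = u \<or> z = v" using pos_in_edge_iff pz by metis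
          thus ?thesis using in_XY[of z] p pz no_edge by blast
        qed
      qed
      have zY: "z \<in> Y"
      proof -
        have "(\<exists>v\<in>Y. p = pos v) \<or> (\<exists>u v. adj u v \<and> u \<in> Y \<and> p \<in> edge u v)"
          using pY E face_disjoint_E unfolding U_def by blast
        thus ?thesis
        proof
          assume "\<exists>v\<in>Y. p = pos v" thus ?thesis using pz inj_pos by (auto dest: injD)
        next
          assume "\<exists>u v. adj u v \<and> u \<in> Y \<and> p \<in> edge u v"
          then obtain u v where "adj u v" "u \<in> Y" "z = u \<or> z = v" using pos_in_edge_iff pz by metis
          thus ?thesis using in_XY[of z] p pz no_edge' by blast
        qed
      qed
      show False using zX zY XY by blast
    qed
    show False
    proof (cases "p \<in> E")
      case True
      then obtain u v u' v' where "adj u v" "u \<in> X" "p \<in> edge u v" "adj u' v'" "u' \<in> Y" "p \<in> edge u' v'"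
        using pX pY vertex face_disjoint_E unfolding U_def by blast
      thus False using edges_Int[of u v u' v'] vertex no_edge XY(2) by (auto simp: doubleton_eq_iff)
    next
      case False
      then obtain G v G' v' where G: "G \<in> Faces" "p \<in> G" "v \<in> X" "pos v \<in> frontier G"
        "G' \<in> Faces" "p \<in> G'" "v' \<in> Y" "pos v' \<in> frontier G'"
        using pX pY pos_in_E edge_subset_E unfolding U_def by blast
      hence "G = G'" unfolding faces_def by (meson components_nonoverlap disjoint_iff)
      obtain a' b' c' where t': "tface a' b' c' G" using face_triangle[OF G(1)] by blast
      have "v \<in> {a', b', c'}" "v' \<in> {a', b', c'}"
        using G \<open>G = G'\<close> pos_in_frontier_iff[OF t'] by blast+
      moreover have "v \<noteq> v'" using G XY(2) by blast
      ultimately have "adj v v'" using tface_facts[OF t'] by auto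
      thus False using no_edge G by blast
    qed
  qed
  have opn: "open (U Z)" if Z: "Z = X \<and> Z' = Y \<or> Z = Y \<and> Z' = X" for Z Z'
  proof (rule openI)
    have dj: "U Z \<inter> U Z' = {}" using Z disj by blast
    have ZZ: "Z \<union> Z' = X \<union> Y" using Z by blast
    fix p assume p: "p \<in> U Z"
    hence pO: "p \<in> O'" unfolding U_def by blast
    then obtain d where d: "0 < d" "ball p d \<subseteq> O'" using inF(3) openE by blast
    show "\<exists>e>0. ball p e \<subseteq> U Z"
    proof (cases "p \<in> E")
      case False
      then obtain G v where G: "G \<in> Faces" "p \<in> G" "v \<in> Z" "pos v \<in> frontier G"
        using p pos_in_E edge_subset_E unfolding U_def by blast
      obtain e where e: "0 < e" "ball p e \<subseteq> G" using face_open[OF G(1)] G(2) openE by blast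
      have "ball p (min d e) \<subseteq> U Z" using d e G unfolding U_def by auto
      thus ?thesis using d e by (metis min_less_iff_conj)
    next
      case True
      obtain e where e: "0 < e" "\<And>u v. adj u v \<Longrightarrow> edge u v \<inter> ball p e \<noteq> {} \<Longrightarrow> p \<in> edge u v"
        "\<And>v. pos v \<in> ball p e \<Longrightarrow> pos v = p" using locally_finite[of p] by metis
      have edgeZ: "u \<in> Z \<or> v \<in> Z" if "adj u v" "p \<in> edge u v" for u v
      proof (rule ccontr)
        assume "\<not> (u \<in> Z \<or> v \<in> Z)"
        hence "u \<in> Z' \<or> v \<in> Z'" using edge_XY[OF that pO] ZZ by blast
        hence "p \<in> U Z'" using edgeU[OF that pO] by simp
        thus False using dj p by blast
      qed
      have "ball p (min d e) \<subseteq> U Z"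
      proof
        fix q assume q: "q \<in> ball p (min d e)"
        hence qO: "q \<in> O'" and qe: "q \<in> ball p e" using d by auto
        show "q \<in> U Z"
        proof (cases "q \<in> E")
          case True
          then consider v where "q = pos v" | u v where "adj u v" "q \<in> edge u v"
            unfolding emb_image_def by blast
          thus ?thesis
          proof cases
            case 1 thus ?thesis using e(3) qe p by metis
          next
            case 2
            hence "u \<in> Z \<or> v \<in> Z" using edgeZ e(2) qe by blast
            thus ?thesis using edgeU[OF 2 qO] by simp
          qed
        next
          case False
          obtain G a' b' c' where G: "G \<in> Faces" "q \<in> G" "tface a' b' c' G" "p \<in> edge a' b'"
            using face_near[OF e(1,2) \<open>p \<in> E\<close> qe False] by blast
          have "a' \<in> Z \<or> b' \<in> Z" using edgeZ[OF _ G(4)] tface_facts(2)[OF G(3)] by blast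
          thus ?thesis using G qO pos_in_frontier_iff[OF G(3)] unfolding U_def by blast
        qed
      qed
      thus ?thesis using d e by (metis min_less_iff_conj)
    qed
  qed
  have mem: "pos v \<in> U X" if "v \<in> X" for v using that inF(5) XY unfolding U_def by blast
  have mem': "pos v \<in> U Y" if "v \<in> Y" for v using that inF(5) XY unfolding U_def by blast
  have sub: "U Z \<subseteq> O'" for Z unfolding U_def by blast
  have opX: "open (U X)" by (rule opn[of X Y]) simp
  have opY: "open (U Y)" by (rule opn[of Y X]) simp
  have emp: "U X \<inter> U Y \<inter> O' = {}" using disj by blast
  have "U X \<inter> O' = {} \<or> U Y \<inter> O' = {}"
    by (rule connectedD[OF inF(2) opX opY emp cover])
  thus False using mem mem' ne sub by blast
qed

text \<open>Two pairs from the three corners of a triangle intersect. In the tiling this converts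
  contact along vertical sides into a common vertex.\<close>

lemma common_face_share:
  assumes "common_face adj pos ep u v u' v'" "adj u v" "adj u' v'"
  shows "{u, v} \<inter> {u', v'} \<noteq> {}"
proof -
  obtain F where F: "F \<in> Faces" "edge u v \<subseteq> frontier F" "edge u' v' \<subseteq> frontier F"
    using assms(1) unfolding common_face_def by blast
  obtain a b c where t: "tface a b c F" using face_triangle[OF F(1)] by blast
  have "{u, v} \<subseteq> {a, b, c}" "{u', v'} \<subseteq> {a, b, c}"
    using F pos_in_edge[OF assms(2)] pos_in_edge[OF assms(3)] pos_in_frontier_iff[OF t] by blast+
  thus ?thesis using assms no_loop by auto
qed

end

section \<open>Tangent discs\<close>

lemma norm_add_eq_imp_parallel:
  fixes x y :: complex
  assumes "norm (x + y) = norm x + norm y"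
  shows "norm x *\<^sub>R y = norm y *\<^sub>R x"
  using assms norm_triangle_eq by blast

lemma dist_ge_of_disjoint_balls:
  fixes x y :: complex
  assumes "0 < r" "0 < s" "ball x r \<inter> ball y s = {}"
  shows "r + s \<le> dist x y"
proof (rule ccontr)
  assume "\<not> ?thesis"
  hence lt: "dist x y < r + s" by simp
  define t where "t = r / (r + s)"
  define p where "p = x + t *\<^sub>R (y - x)"
  have t: "0 < t" "t < 1" "1 - t = s / (r + s)" using assms unfolding t_def by (auto simp: field_simps)
  have "dist x p = t * dist x y" unfolding p_def using t by (simp add: dist_norm norm_minus_commute)
  also have "\<dots> < t * (r + s)" using lt t by simp
  also have "\<dots> = r" using assms unfolding t_def by simp
  finally have 1: "dist x p < r" .
  have "y - p = (1 - t) *\<^sub>R (y - x)" unfolding p_def by (simp add: algebra_simps)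
  hence "dist y p = (1 - t) * dist x y" using t assms(1,2) by (simp add: dist_norm norm_minus_commute)
  also have "\<dots> < (1 - t) * (r + s)" using lt t(2) by (intro mult_strict_left_mono) auto
  also have "\<dots> = s" using assms unfolding t by simp
  finally have "dist y p < s" .
  thus False using 1 assms(3) by auto
qed

text \<open>Equality in the triangle inequality puts \<open>p\<close> on the segment of
  centres.\<close>

lemma touching_discs_point:
  fixes x y p :: complex
  assumes "0 < r" "0 < s" "r + s \<le> dist x y" "p \<in> cball x r" "p \<in> cball y s"
  shows "dist x p = r" "dist y p = s" "dist x y = r + s" "s *\<^sub>R (p - x) = r *\<^sub>R (y - p)"
    "p = x + (r / (r + s)) *\<^sub>R (y - x)"
proof -
  have tr: "dist x y \<le> dist x p + dist y p" by (metis dist_triangle2)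
  show 1: "dist x p = r" "dist y p = s" "dist x y = r + s" using assms tr by auto
  have "norm ((p - x) + (y - p)) = norm (p - x) + norm (y - p)"
    using 1 by (simp add: dist_norm norm_minus_commute)
  hence par: "norm (p - x) *\<^sub>R (y - p) = norm (y - p) *\<^sub>R (p - x)" by (rule norm_add_eq_imp_parallel)
  thus 2: "s *\<^sub>R (p - x) = r *\<^sub>R (y - p)" using 1 by (simp add: dist_norm norm_minus_commute)
  have "(r + s) *\<^sub>R (p - x) = r *\<^sub>R (y - x)" using 2 by (simp add: algebra_simps)
  hence "inverse (r + s) *\<^sub>R ((r + s) *\<^sub>R (p - x)) = inverse (r + s) *\<^sub>R (r *\<^sub>R (y - x))" by simp
  hence "p - x = (r / (r + s)) *\<^sub>R (y - x)" using assms(1,2) by (simp add: divide_inverse mult.commute)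
  thus "p = x + (r / (r + s)) *\<^sub>R (y - x)" by (simp add: algebra_simps)
qed

text \<open>Seen from \<open>p\<close>, the three centres would lie in pairwise opposite
  directions.\<close>

lemma no_three_discs_at_point:
  fixes x y z p :: complex
  assumes "0 < r" "0 < s" "0 < t" "r + s \<le> dist x y" "r + t \<le> dist x z" "s + t \<le> dist y z"
    and p: "p \<in> cball x r" "p \<in> cball y s" "p \<in> cball z t"
  shows False
proof -
  have 1: "s *\<^sub>R (p - x) = r *\<^sub>R (y - p)" and n: "dist x p = r"
    using touching_discs_point[OF assms(1,2,4) p(1,2)] by auto
  have 2: "t *\<^sub>R (p - x) = r *\<^sub>R (z - p)" using touching_discs_point[OF assms(1,3,5) p(1,3)] by auto
  have 3: "t *\<^sub>R (p - y) = s *\<^sub>R (z - p)" using touching_discs_point[OF assms(2,3,6) p(2,3)] by auto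
  have "(s * t) *\<^sub>R (p - x) = s *\<^sub>R (r *\<^sub>R (z - p))" using 2 by (metis scaleR_scaleR)
  also have "\<dots> = r *\<^sub>R (t *\<^sub>R (p - y))" using 3 by (metis scaleR_scaleR mult.commute)
  also have "\<dots> = - (t *\<^sub>R (r *\<^sub>R (y - p)))" by (simp add: algebra_simps)
  also have "\<dots> = - ((s * t) *\<^sub>R (p - x))" using 1 by (metis scaleR_scaleR mult.commute)
  finally have "(s * t) *\<^sub>R (p - x) = 0" by (simp add: eq_neg_iff_add_eq_0 scaleR_2[symmetric])
  hence "p = x" using assms by simp
  thus False using n assms by simp
qed

lemma segment_subset_discs:
  fixes x y :: complex
  assumes "0 < r" "0 < s" "dist x y = r + s"
  shows "closed_segment x y \<subseteq> cball x r \<union> cball y s"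
proof
  fix p assume "p \<in> closed_segment x y"
  hence "dist x y = dist x p + dist p y" using between between_mem_segment by metis
  thus "p \<in> cball x r \<union> cball y s" using assms by (auto simp: dist_commute)
qed

text \<open>Cramer's rule: \<open>Im (cnj w * b)\<close> is the determinant of the vectors
  \<open>w\<close> and \<open>b\<close>.\<close>

lemma real_cross_decomposition:
  fixes w b x :: complex
  assumes "Im (cnj w * b) \<noteq> 0"
  obtains s t :: real where "x = s *\<^sub>R w + t *\<^sub>R b" "s = Im (cnj x * b) / Im (cnj w * b)"
    "t = Im (cnj w * x) / Im (cnj w * b)"
proof -
  have "Im (cnj w * b) *\<^sub>R x = Im (cnj x * b) *\<^sub>R w + Im (cnj w * x) *\<^sub>R b"
    by (simp add: complex_eq_iff algebra_simps)
  hence "(1 / Im (cnj w * b)) *\<^sub>R (Im (cnj w * b) *\<^sub>R x)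
    = (1 / Im (cnj w * b)) *\<^sub>R (Im (cnj x * b) *\<^sub>R w + Im (cnj w * x) *\<^sub>R b)" by simp
  hence "x = (Im (cnj x * b) / Im (cnj w * b)) *\<^sub>R w + (Im (cnj w * x) / Im (cnj w * b)) *\<^sub>R b"
    using assms by (simp add: scaleR_add_right del: Im_complex_of_real)
  thus thesis using that by blast
qed

text \<open>In the coordinates \<open>p\<close>, \<open>q\<close> along the two sides at
  \<open>v\<close>, four strict inequalities cut out a neighbourhood of \<open>z\<close>. Its part
  with \<open>q x \<ge> 0\<close> lies in the first triangle, the rest in the second after a change
  of basis from \<open>b - v\<close> to \<open>b2 - v\<close>; \<open>0 < \<beta>\<close> says that
  the third corners are on opposite sides of the common side.\<close>

lemma two_triangles_nbhd:
  fixes v w b b2 z :: complex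
  assumes cr: "Im (cnj (w - v) * (b - v)) \<noteq> 0"
    and b2: "b2 - v = \<tau> *\<^sub>R (w - v) - \<beta> *\<^sub>R (b - v)" and \<beta>: "0 < \<beta>"
    and z: "z = v + s *\<^sub>R (w - v)" "0 < s" "s < 1"
  shows "z \<in> interior (convex hull {v, w, b} \<union> convex hull {v, w, b2})"
proof -
  define p where "p x = Im (cnj (x - v) * (b - v)) / Im (cnj (w - v) * (b - v))" for x
  define q where "q x = Im (cnj (w - v) * (x - v)) / Im (cnj (w - v) * (b - v))" for x
  have dec: "x - v = p x *\<^sub>R (w - v) + q x *\<^sub>R (b - v)" for x
    using real_cross_decomposition[OF cr, of "x - v"] unfolding p_def q_def by metis
  define U where "U = {x. 0 < p x} \<inter> {x. p x + q x < 1} \<inter> {x. 0 < p x + q x * \<tau> / \<beta>}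
    \<inter> {x. p x + q x * \<tau> / \<beta> - q x / \<beta> < 1}"
  have cont: "continuous_on UNIV p" "continuous_on UNIV q"
    unfolding p_def q_def using cr by (auto intro!: continuous_intros)
  have "open U" unfolding U_def
    using \<beta> by (intro open_Int open_Collect_less continuous_intros cont) auto
  have pz: "p z = s" using cr unfolding p_def z by simp
  have qz: "q z = 0" unfolding q_def z by (simp add: algebra_simps)
  have "z \<in> U" unfolding U_def using pz qz z by simp
  moreover have "U \<subseteq> convex hull {v, w, b} \<union> convex hull {v, w, b2}"
  proof
    fix x assume x: "x \<in> U"
    show "x \<in> convex hull {v, w, b} \<union> convex hull {v, w, b2}"
    proof (cases "0 \<le> q x")
      case True
      have "x = v + p x *\<^sub>R (w - v) + q x *\<^sub>R (b - v)" using dec[of x] by (simp add: algebra_simps)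
      thus ?thesis using x True unfolding U_def convex_hull_3_alt by (auto intro: less_imp_le)
    next
      case False
      have "\<beta> *\<^sub>R (b - v) = \<tau> *\<^sub>R (w - v) - (b2 - v)" using b2 by (simp add: algebra_simps)
      hence "(1 / \<beta>) *\<^sub>R (\<beta> *\<^sub>R (b - v)) = (1 / \<beta>) *\<^sub>R (\<tau> *\<^sub>R (w - v) - (b2 - v))" by simp
      hence bv: "b - v = (\<tau> / \<beta>) *\<^sub>R (w - v) - (1 / \<beta>) *\<^sub>R (b2 - v)"
        using \<beta> by (simp add: scaleR_diff_right)
      have "x - v = p x *\<^sub>R (w - v) + q x *\<^sub>R ((\<tau> / \<beta>) *\<^sub>R (w - v) - (1 / \<beta>) *\<^sub>R (b2 - v))"
        using dec[of x] bv by simp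
      also have "\<dots> = (p x + q x * \<tau> / \<beta>) *\<^sub>R (w - v) + (- q x / \<beta>) *\<^sub>R (b2 - v)"
        by (simp add: scaleR_diff_right scaleR_left_distrib)
      finally have "x = v + (p x + q x * \<tau> / \<beta>) *\<^sub>R (w - v) + (- q x / \<beta>) *\<^sub>R (b2 - v)"
        by (simp add: algebra_simps)
      moreover have "0 \<le> p x + q x * \<tau> / \<beta>" "0 \<le> - q x / \<beta>" "p x + q x * \<tau> / \<beta> + - q x / \<beta> \<le> 1"
        using x False \<beta> unfolding U_def by (auto simp: divide_nonpos_pos)
      ultimately show ?thesis unfolding convex_hull_3_alt by blast
    qed
  qed
  ultimately show ?thesis using \<open>open U\<close> by (meson interiorI)
qed

lemma Union_bounded_components: "\<Union>{K \<in> components (- S). bounded K} = inside S"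
proof (rule set_eqI)
  fix x
  have "(\<exists>K\<in>components (- S). bounded K \<and> x \<in> K) \<longleftrightarrow> x \<in> - S \<and> bounded (connected_component_set (- S) x)"
  proof
    assume "\<exists>K\<in>components (- S). bounded K \<and> x \<in> K"
    then obtain K where K: "K \<in> components (- S)" "bounded K" "x \<in> K" by blast
    have "x \<in> - S" using K in_components_subset by blast
    moreover have "K = connected_component_set (- S) x"
      using K by (metis components_iff connected_component_eq)
    ultimately show "x \<in> - S \<and> bounded (connected_component_set (- S) x)" using K by simp
  next
    assume x: "x \<in> - S \<and> bounded (connected_component_set (- S) x)"
    hence "connected_component_set (- S) x \<in> components (- S)" by (simp add: componentsI)
    moreover have "x \<in> connected_component_set (- S) x" using x by simp
    ultimately show "\<exists>K\<in>components (- S). bounded K \<and> x \<in> K" using x by blast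
  qed
  thus "x \<in> \<Union>{K \<in> components (- S). bounded K} \<longleftrightarrow> x \<in> inside S" unfolding inside_def by blast
qed

lemma interstice_eq_inside:
  "interstice ctr r a b c = inside (cball (ctr a) (r a) \<union> cball (ctr b) (r b) \<union> cball (ctr c) (r c))"
  unfolding interstice_def by (rule Union_bounded_components)

lemma inside_connected_subset:
  assumes "connected L" "L \<inter> S = {}" "L \<inter> inside S \<noteq> {}"
  shows "L \<subseteq> inside S"
proof -
  obtain x where x: "x \<in> L" "x \<in> inside S" using assms(3) by blast
  have "connected_component (- S) x y'" if "y' \<in> L" for y'
    using assms x that unfolding connected_component_def by blast
  thus ?thesis using x inside_same_component by blast
qed

text \<open>The hull of finitely many discs is compact, whereas the carrier is an open disc.\<close>

lemma carrier_not_in_finite_hull: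
  assumes "circle_packing_disc adj pos ep (ctr :: 'v \<Rightarrow> complex) r"
    and sub: "\<And>a b c. interstice ctr r a b c \<subseteq> convex hull (\<Union>v\<in>V. cball (ctr v) (r v))"
    and V: "finite V" "\<And>v. cball (ctr v) (r v) \<subseteq> convex hull (\<Union>v\<in>V. cball (ctr v) (r v))"
  shows False
proof -
  define H where "H = convex hull (\<Union>v\<in>V. cball (ctr v) (r v))"
  have carrier: "(\<Union>v. cball (ctr v) (r v)) \<union>
       \<Union>{interstice ctr r a b c | a b c. \<exists>F\<in>faces adj pos ep. triangle_face adj ep a b c F} = ball 0 1"
    using assms(1) unfolding circle_packing_disc_def by (elim conjE)
  have "compact (\<Union>v\<in>V. cball (ctr v) (r v))" using V(1) by (intro compact_UN) auto
  hence cH: "compact H" unfolding H_def by (rule compact_convex_hull)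
  have "(\<Union>v\<in>V. cball (ctr v) (r v)) \<subseteq> (\<Union>v. cball (ctr v) (r v))" by blast
  also have "\<dots> \<subseteq> ball 0 1" unfolding carrier[symmetric] by (rule Un_upper1)
  finally have "H \<subseteq> ball 0 1" unfolding H_def by (intro hull_minimal convex_ball)
  moreover have "ball 0 1 \<subseteq> H" unfolding carrier[symmetric]
  proof (rule Un_least)
    show "(\<Union>v. cball (ctr v) (r v)) \<subseteq> H" using V(2) unfolding H_def by (rule UN_least)
  next
    show "\<Union>{interstice ctr r a b c | a b c. \<exists>F\<in>faces adj pos ep. triangle_face adj ep a b c F} \<subseteq> H"
    proof (rule Union_least)
      fix I assume "I \<in> {interstice ctr r a b c | a b c. \<exists>F\<in>faces adj pos ep. triangle_face adj ep a b c F}"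
      then obtain a b c where "I = interstice ctr r a b c" by blast
      thus "I \<subseteq> H" using sub unfolding H_def by metis
    qed
  qed
  ultimately have "H = ball 0 1" by blast
  hence "closed (ball (0::complex) 1)" using cH compact_imp_closed by metis
  hence "ball (0::complex) 1 = cball 0 1" using closure_ball[of 1 "0::complex"] closure_closed by (metis zero_less_one)
  moreover have "(1::complex) \<in> cball 0 1" "(1::complex) \<notin> ball 0 1" by auto
  ultimately show False by blast
qed

section \<open>Circle packings of triangulations\<close>

text \<open>Points off a convex set that contains the discs lie in the unbounded part of their
  complement.\<close>

lemma interstice_subset_convex:
  assumes "convex H" "cball (ctr a) (r a) \<subseteq> H" "cball (ctr b) (r b) \<subseteq> H" "cball (ctr c) (r c) \<subseteq> H"
  shows "interstice ctr r a b c \<subseteq> H"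
proof -
  define S where "S = cball (ctr a) (r a) \<union> cball (ctr b) (r b) \<union> cball (ctr c) (r c)"
  have "S \<subseteq> H" using assms unfolding S_def by blast
  hence "- H \<subseteq> outside S" using outside_mono outside_convex[OF assms(1)] by blast
  hence "inside S \<subseteq> H" using inside_Int_outside[of S] by blast
  thus ?thesis unfolding interstice_eq_inside S_def .
qed

lemma infinite_of_circle_packing:
  assumes "circle_packing_disc adj pos ep (ctr :: 'v \<Rightarrow> complex) r"
  shows "infinite (UNIV :: 'v set)"
proof
  assume fin: "finite (UNIV :: 'v set)"
  define H where "H = convex hull (\<Union>v\<in>(UNIV :: 'v set). cball (ctr v) (r v))"
  have "(\<Union>v. cball (ctr v) (r v)) \<subseteq> H" unfolding H_def by (rule hull_subset)
  hence sub: "cball (ctr v) (r v) \<subseteq> H" for v by blast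
  have "interstice ctr r a b c \<subseteq> H" for a b c
    by (rule interstice_subset_convex) (use sub in \<open>auto simp: H_def\<close>)
  thus False using carrier_not_in_finite_hull[OF assms _ fin] sub unfolding H_def by blast
qed

locale packing = plane_triangulation adj pos ep
  for adj :: "'v \<Rightarrow> 'v \<Rightarrow> bool" and pos :: "'v \<Rightarrow> complex" and ep :: "'v \<Rightarrow> 'v \<Rightarrow> real \<Rightarrow> complex" +
  fixes ctr :: "'v \<Rightarrow> complex" and r :: "'v \<Rightarrow> real"
  assumes pack: "circle_packing_disc adj pos ep ctr r"
    and fin_nbrs: "finite (nbrs adj v)" and nbr_ex: "\<exists>u. adj v u"
begin

abbreviation "D v \<equiv> cball (ctr v) (r v)"
abbreviation "B v \<equiv> ball (ctr v) (r v)"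
abbreviation "gap \<equiv> interstice ctr r"
abbreviation "tri_discs a b c \<equiv> D a \<union> D b \<union> D c"
abbreviation "hull3 a b c \<equiv> convex hull {ctr a, ctr b, ctr c}"

lemma pack_facts:
  shows r_pos: "\<And>v. 0 < r v"
    and B_disjoint: "\<And>u v. u \<noteq> v \<Longrightarrow> B u \<inter> B v = {}"
    and adj_iff: "\<And>u v. u \<noteq> v \<Longrightarrow> adj u v \<longleftrightarrow> D u \<inter> D v \<noteq> {}"
    and carrier: "(\<Union>v. D v) \<union> \<Union>{gap a b c | a b c. \<exists>F\<in>Faces. tface a b c F} = ball 0 1"
proof -
  have 1: "\<forall>v. 0 < r v" using pack unfolding circle_packing_disc_def by (elim conjE)
  have 2: "\<forall>u v. u \<noteq> v \<longrightarrow> B u \<inter> B v = {}" using pack unfolding circle_packing_disc_def by (elim conjE)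
  have 3: "\<forall>u v. u \<noteq> v \<longrightarrow> (adj u v \<longleftrightarrow> D u \<inter> D v \<noteq> {})"
    using pack unfolding circle_packing_disc_def by (elim conjE)
  show "(\<Union>v. D v) \<union> \<Union>{gap a b c | a b c. \<exists>F\<in>Faces. tface a b c F} = ball 0 1"
    using pack unfolding circle_packing_disc_def by (elim conjE)
  show "\<And>v. 0 < r v" using 1 by simp
  show "\<And>u v. u \<noteq> v \<Longrightarrow> B u \<inter> B v = {}" using 2 by simp
  show "\<And>u v. u \<noteq> v \<Longrightarrow> adj u v \<longleftrightarrow> D u \<inter> D v \<noteq> {}" using 3 by simp
qed

lemma D_subset: "D v \<subseteq> ball 0 1"
  unfolding carrier[symmetric] by blast

lemma carrier_cases:
  assumes "z \<in> ball 0 1"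
  obtains v where "z \<in> D v" | F a b c where "F \<in> Faces" "tface a b c F" "z \<in> gap a b c"
proof -
  have "z \<in> (\<Union>v. D v) \<union> \<Union>{gap a b c | a b c. \<exists>F\<in>Faces. tface a b c F}"
    using assms unfolding carrier .
  thus thesis using that by blast
qed

lemma centre_in_D [simp]: "ctr v \<in> D v" and centre_in_B [simp]: "ctr v \<in> B v"
  using r_pos[of v] by auto

lemma dist_ge: "u \<noteq> v \<Longrightarrow> r u + r v \<le> dist (ctr u) (ctr v)"
  by (intro dist_ge_of_disjoint_balls r_pos B_disjoint)

lemma adj_neq: "adj u v \<Longrightarrow> u \<noteq> v"
  using no_loop by blast

lemma tangent_point:
  assumes "adj u v" "p \<in> D u" "p \<in> D v"
  shows "dist (ctr u) p = r u" "dist (ctr v) p = r v"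
    "p = ctr u + (r u / (r u + r v)) *\<^sub>R (ctr v - ctr u)"
  using touching_discs_point[OF r_pos r_pos dist_ge[OF adj_neq[OF assms(1)]] assms(2,3)] by auto

lemma tangent_dist:
  assumes "adj u v"
  shows "dist (ctr u) (ctr v) = r u + r v"
proof -
  obtain p where "p \<in> D u" "p \<in> D v" using adj_iff[OF adj_neq[OF assms]] assms by blast
  thus ?thesis using touching_discs_point(3)[OF r_pos r_pos dist_ge[OF adj_neq[OF assms]]] by blast
qed

lemma D_Int_imp_adj: "p \<in> D u \<Longrightarrow> p \<in> D v \<Longrightarrow> u = v \<or> adj u v"
  using adj_iff by blast

lemma no_triple:
  assumes "distinct [u, v, w]" "p \<in> D u" "p \<in> D v" "p \<in> D w"
  shows False
  using no_three_discs_at_point[OF r_pos r_pos r_pos dist_ge dist_ge dist_ge assms(2-4)] assms(1) by auto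

lemma B_D_disjoint:
  assumes "u \<noteq> v"
  shows "B u \<inter> D v = {}"
  using B_disjoint[OF assms] open_Int_closure_eq_empty[of "B u" "B v"] closure_ball[OF r_pos[of v], of "ctr v"] by simp

lemma closed_tri_discs: "closed (tri_discs a b c)" by (intro closed_Un closed_cball)

lemma open_gap: "open (gap a b c)"
  unfolding interstice_eq_inside by (rule open_inside[OF closed_tri_discs])

lemma gap_disjoint: "gap a b c \<inter> tri_discs a b c = {}"
  unfolding interstice_eq_inside by (rule inside_no_overlap)

lemma connected_subset_gap:
  assumes "connected L" "L \<inter> tri_discs a b c = {}" "L \<inter> gap a b c \<noteq> {}"
  shows "L \<subseteq> gap a b c"
  using inside_connected_subset[OF assms(1,2)] assms(3) unfolding interstice_eq_inside .

lemma segment_subset_D: "adj u v \<Longrightarrow> closed_segment (ctr u) (ctr v) \<subseteq> D u \<union> D v"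
  by (intro segment_subset_discs r_pos tangent_dist)

text \<open>The sides of the triangle of centres are covered by the discs, so a component of their
  complement that meets the triangle cannot leave it and is bounded.\<close>

lemma hull3_subset:
  assumes "adj a b" "adj b c" "adj c a"
  shows "hull3 a b c \<subseteq> tri_discs a b c \<union> gap a b c"
proof
  fix x assume x: "x \<in> hull3 a b c"
  show "x \<in> tri_discs a b c \<union> gap a b c"
  proof (cases "x \<in> tri_discs a b c")
    case False
    define K where "K = connected_component_set (- tri_discs a b c) x"
    have "x \<in> - tri_discs a b c" using False by blast
    hence K: "connected K" "x \<in> K" "K \<subseteq> - tri_discs a b c"
      unfolding K_def using connected_connected_component connected_component_subset
      by (metis, metis connected_component_refl mem_Collect_eq, metis)
    have "frontier (hull3 a b c) \<subseteq> tri_discs a b c"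
      using frontier_of_triangle[of "ctr a" "ctr b" "ctr c"] segment_subset_D[OF assms(1)]
        segment_subset_D[OF assms(2)] segment_subset_D[OF assms(3)] by auto
    hence "K \<subseteq> hull3 a b c"
      using connected_Int_frontier[OF K(1), of "hull3 a b c"] K x by blast
    moreover have "bounded (hull3 a b c)" by (intro bounded_convex_hull finite_imp_bounded) simp
    ultimately have "bounded K" using bounded_subset by blast
    hence "x \<in> inside (tri_discs a b c)" unfolding inside_def K_def using False by blast
    thus ?thesis unfolding interstice_eq_inside by blast
  qed simp
qed

text \<open>Removing a facial triangle leaves the graph connected, so all other discs lie on one
  side of it; on the inner side, they would make the carrier lie in a compact convex set.\<close>

lemma gap_disjoint_D:
  assumes F: "F \<in> Faces" and t: "tface a b c F"
  shows "D u \<inter> gap a b c = {}"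
proof -
  note tf = tface_facts[OF t]
  define X where "X = {u. u \<notin> {a, b, c} \<and> B u \<subseteq> gap a b c}"
  define Y where "Y = {u. u \<notin> {a, b, c} \<and> B u \<inter> gap a b c = {}}"
  have BS: "B u \<inter> tri_discs a b c = {}" if "u \<notin> {a, b, c}" for u
    using B_D_disjoint[of u a] B_D_disjoint[of u b] B_D_disjoint[of u c] that by blast
  have "B u \<subseteq> gap a b c \<or> B u \<inter> gap a b c = {}" if "u \<notin> {a, b, c}" for u
    using connected_subset_gap[OF connected_ball BS[OF that]] by blast
  hence XY: "X \<union> Y = - {a, b, c}" unfolding X_def Y_def by blast
  have XYd: "X \<inter> Y = {}" unfolding X_def Y_def using centre_in_B by blast
  \<comment> \<open>The segment between tangent centres stays in their two discs; another disc can
    meet it only at the tangency point, where three discs would meet. So the segment avoids the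
    discs of the face and cannot leave the interstice.\<close>
  have no_edge: "\<not> adj u v" if u: "u \<in> X" and v: "v \<in> Y" for u v
  proof
    assume uv: "adj u v"
    define L where "L = closed_segment (ctr u) (ctr v)"
    have "q \<notin> D w" if q: "q \<in> L" and w: "w \<in> {a, b, c}" for q w
    proof
      assume qw: "q \<in> D w"
      have ne: "w \<noteq> u" "w \<noteq> v" "u \<noteq> v" using u v w adj_neq[OF uv] unfolding X_def Y_def by auto
      have "q \<notin> B u" "q \<notin> B v" using B_D_disjoint[of u w] B_D_disjoint[of v w] ne qw by blast+
      moreover have "dist (ctr u) (ctr v) = dist (ctr u) q + dist q (ctr v)"
        using q unfolding L_def by (metis between between_mem_segment)
      ultimately have "q \<in> D u" "q \<in> D v" using tangent_dist[OF uv] by (auto simp: dist_commute)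
      thus False using no_triple[of u v w q] qw ne by simp
    qed
    hence "L \<inter> tri_discs a b c = {}" by blast
    moreover have "ctr u \<in> L \<inter> gap a b c" using u centre_in_B unfolding L_def X_def by blast
    ultimately have "L \<subseteq> gap a b c"
      using connected_subset_gap[of L a b c] unfolding L_def by blast
    hence "ctr v \<in> gap a b c" unfolding L_def by auto
    thus False using v centre_in_B[of v] unfolding Y_def by blast
  qed
  have "X = {} \<or> Y = {}"
    using face_complement_connected[OF F t XY XYd no_edge] by blast
  moreover have "Y \<noteq> {}"
  proof
    assume Y: "Y = {}"
    define V where "V = {a, b, c}"
    define H where "H = convex hull (\<Union>v\<in>V. D v)"
    have "(\<Union>v\<in>V. D v) \<subseteq> H" unfolding H_def by (rule hull_subset)
    hence abc: "D a \<subseteq> H" "D b \<subseteq> H" "D c \<subseteq> H" unfolding V_def by blast+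
    have H: "convex H" "closed H"
      unfolding H_def V_def by (auto intro!: compact_imp_closed compact_convex_hull compact_Un)
    have gH: "gap a b c \<subseteq> H" by (rule interstice_subset_convex) (use abc H in auto)
    have DH: "D v \<subseteq> H" for v
    proof (cases "v \<in> {a, b, c}")
      case False
      hence "B v \<subseteq> H" using gH XY Y unfolding X_def by blast
      hence "closure (B v) \<subseteq> H" using H closure_minimal by blast
      thus ?thesis using closure_ball[OF r_pos[of v], of "ctr v"] by simp
    qed (use abc in auto)
    have "gap a' b' c' \<subseteq> H" for a' b' c' by (rule interstice_subset_convex) (use DH H in auto)
    moreover have "finite V" unfolding V_def by simp
    ultimately show False using carrier_not_in_finite_hull[OF pack, of V] DH unfolding H_def by blast
  qed
  ultimately have "X = {}" by blast
  hence "B u \<inter> gap a b c = {}" if "u \<notin> {a, b, c}" for u using XY that unfolding Y_def by blast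
  moreover have "B u \<inter> gap a b c = {}" if "u \<in> {a, b, c}" for u
    using gap_disjoint[of a b c] ball_subset_cball[of "ctr u" "r u"] that by blast
  ultimately have "gap a b c \<inter> B u = {}" by blast
  hence "gap a b c \<inter> closure (B u) = {}" using open_Int_closure_eq_empty[OF open_gap] by blast
  thus ?thesis using closure_ball[OF r_pos[of u]] by auto
qed

text \<open>On a line, one of the three distances would be the sum of the other two, which forces a
  radius to vanish.\<close>

lemma tface_cross_nonzero:
  assumes "tface v w b F"
  shows "Im (cnj (ctr w - ctr v) * (ctr b - ctr v)) \<noteq> 0"
proof
  note tf = tface_facts[OF assms]
  let ?w = "ctr w - ctr v" and ?b = "ctr b - ctr v"
  assume 0: "Im (cnj ?w * ?b) = 0"
  define d where "d = r v + r w"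
  have d: "norm ?w = d" "0 < d" using tangent_dist[OF tf(2)] r_pos[of v] r_pos[of w]
    by (auto simp: d_def dist_norm norm_minus_commute)
  define t where "t = Re (cnj ?w * ?b) / (d * d)"
  have real: "W = of_real (Re W)" if "Im W = 0" for W using that by (simp add: complex_eq_iff)
  have cancel: "x = x / (d * d) * (d * d)" for x using d(2) by simp
  have re: "cnj ?w * ?b = of_real (t * (d * d))"
    unfolding t_def cancel[symmetric] by (rule real[OF 0])
  have "of_real (d * d) * ?b = ?w * cnj ?w * ?b"
    using d by (metis complex_norm_square power2_eq_square of_real_mult)
  also have "\<dots> = ?w * of_real (t * (d * d))" by (simp only: mult.assoc re)
  also have "\<dots> = of_real (d * d) * (of_real t * ?w)" by (simp only: of_real_mult mult_ac)
  finally have "?b = of_real t * ?w" using d by (simp only: mult_cancel_left of_real_eq_0_iff mult_eq_0_iff) simp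
  hence bt: "?b = t *\<^sub>R ?w" by (simp only: scaleR_conv_of_real)
  have "r v + r b = \<bar>t\<bar> * d"
    using tangent_dist[OF tf(7)] bt d by (simp add: dist_norm norm_minus_commute)
  moreover have "ctr b - ctr w = (t - 1) *\<^sub>R ?w" using bt by (simp add: algebra_simps)
  hence "r w + r b = \<bar>t - 1\<bar> * d"
    using tangent_dist[OF tf(3)] d by (simp add: dist_norm norm_minus_commute)
  ultimately show False using r_pos[of v] r_pos[of w] r_pos[of b] d
    by (cases "t \<le> 0"; cases "t \<le> 1") (auto simp: d_def algebra_simps abs_if split: if_splits)
qed

text \<open>Move from \<open>ctr v\<close> towards \<open>ctr x\<close>, through the tangency point
  at parameter \<open>\<kappa>\<close>. If that point lies strictly before the side opposite to
  \<open>v\<close>, the ray enters the open disc of \<open>x\<close> within the triangle, hence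
  within an interstice. Otherwise the ray meets the side inside \<open>D v\<close>; as the side is
  covered by \<open>D w\<close> and \<open>D b\<close>, this happens at the tangency point, where
  three discs would meet.\<close>

lemma no_nbr_in_sector:
  assumes F: "F \<in> Faces" and t: "tface v w b F" and x: "x \<noteq> w" "x \<noteq> b" "adj v x"
    and dec: "ctr x - ctr v = \<tau> *\<^sub>R (ctr w - ctr v) + \<beta> *\<^sub>R (ctr b - ctr v)" and pos: "0 < \<tau>" "0 < \<beta>"
  shows False
proof -
  note tf = tface_facts[OF t]
  have xv: "x \<noteq> v" using adj_neq[OF x(3)] by simp
  define \<kappa> where "\<kappa> = r v / (r v + r x)"
  have \<kappa>: "0 < \<kappa>" "\<kappa> < 1" using r_pos[of v] r_pos[of x] unfolding \<kappa>_def by (auto simp: field_simps)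
  have nx: "norm (ctr x - ctr v) = r v + r x"
    using tangent_dist[OF x(3)] by (simp add: dist_norm norm_minus_commute)
  define pt where "pt l = ctr v + l *\<^sub>R (ctr x - ctr v)" for l
  have dv: "dist (ctr v) (pt l) = l * (r v + r x)" if "0 \<le> l" for l
    using that nx unfolding pt_def by (simp add: dist_norm)
  have dx: "dist (ctr x) (pt l) = (1 - l) * (r v + r x)" if "l \<le> 1" for l
  proof -
    have "ctr x - pt l = (1 - l) *\<^sub>R (ctr x - ctr v)" unfolding pt_def by (simp add: algebra_simps)
    thus ?thesis using that nx by (simp add: dist_norm)
  qed
  have kr: "\<kappa> * (r v + r x) = r v" "(1 - \<kappa>) * (r v + r x) = r x"
    using r_pos[of v] r_pos[of x] unfolding \<kappa>_def by (auto simp: field_simps)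
  have ptx: "pt \<kappa> \<in> D x" "pt \<kappa> \<in> D v" using dx[of \<kappa>] dv[of \<kappa>] kr \<kappa> by auto
  have ptdec: "pt l = ctr v + (l * \<tau>) *\<^sub>R (ctr w - ctr v) + (l * \<beta>) *\<^sub>R (ctr b - ctr v)" for l
    unfolding pt_def dec by (simp add: scaleR_add_right)
  show False
  proof (cases "\<kappa> * (\<tau> + \<beta>) < 1")
    case True
    \<comment> \<open>The largest parameter up to 1 whose point is still in the triangle of
      centres.\<close>
    define l where "l = min 1 (1 / (\<tau> + \<beta>))"
    have l: "\<kappa> < l" "l \<le> 1" "l * (\<tau> + \<beta>) \<le> 1" "0 < l"
      using True \<kappa> pos unfolding l_def by (auto simp: min_def field_simps split: if_splits)
    have "pt l \<in> hull3 v w b"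
      unfolding ptdec convex_hull_3_alt using l pos by (auto simp: distrib_left intro!: exI mult_nonneg_nonneg)
    moreover have "dist (ctr x) (pt l) < r x"
    proof -
      have "(1 - l) * (r v + r x) < (1 - \<kappa>) * (r v + r x)"
        using l r_pos[of v] r_pos[of x] by (intro mult_strict_right_mono) auto
      thus ?thesis using dx[OF l(2)] kr by simp
    qed
    hence ptB: "pt l \<in> B x" by simp
    moreover have "pt l \<notin> tri_discs v w b"
      using ptB B_D_disjoint[OF xv] B_D_disjoint[OF x(1)] B_D_disjoint[OF x(2)] by blast
    ultimately have "pt l \<in> gap v w b" using hull3_subset[OF tf(2-4)] by blast
    thus False using gap_disjoint_D[OF F t, of x] ptB ball_subset_cball by blast
  next
    case False
    define l where "l = 1 / (\<tau> + \<beta>)"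
    have "\<tau> + \<beta> \<noteq> 0" using pos by simp
    hence "l * (\<tau> + \<beta>) = 1" unfolding l_def by simp
    hence "l * \<tau> + l * \<beta> = 1" by (simp only: distrib_left)
    moreover have "0 < l" "l \<le> \<kappa>" using False pos unfolding l_def by (auto simp: field_simps)
    ultimately have l: "0 < l" "l \<le> \<kappa>" "l * \<tau> + l * \<beta> = 1" by auto
    have "pt l = (1 - l * \<beta>) *\<^sub>R ctr w + (l * \<beta>) *\<^sub>R ctr b"
    proof -
      have lt: "l * \<tau> = 1 - l * \<beta>" using l by simp
      show ?thesis unfolding ptdec lt by (simp add: algebra_simps)
    qed
    moreover have "l * \<beta> \<le> 1" using l pos mult_pos_pos[of l \<tau>] by linarith
    ultimately have "pt l \<in> closed_segment (ctr w) (ctr b)"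
      unfolding in_segment using l pos by (intro exI[of _ "l * \<beta>"]) (auto simp: mult_pos_pos)
    hence wb: "pt l \<in> D w \<union> D b" using segment_subset_D[OF tf(3)] by blast
    have "l = \<kappa>"
    proof (rule ccontr)
      assume "l \<noteq> \<kappa>"
      hence "l * (r v + r x) < \<kappa> * (r v + r x)"
        using l r_pos[of v] r_pos[of x] by (intro mult_strict_right_mono) auto
      hence "pt l \<in> B v" using dv[of l] l kr by simp
      thus False using wb B_D_disjoint[of v w] B_D_disjoint[of v b] tf(1) by auto
    qed
    thus False using wb ptx no_triple[of x v w "pt \<kappa>"] no_triple[of x v b "pt \<kappa>"] xv x tf(1) by auto
  qed
qed

text \<open>With both apexes on one side of the edge, the sign of \<open>\<tau>\<close> decides: for
  \<open>\<tau> > 0\<close> the centre of \<open>b'\<close> lies in the sector of the first face,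
  for \<open>\<tau> < 0\<close> that of \<open>b\<close> lies in the sector of the second, and for
  \<open>\<tau> = 0\<close> both discs touch \<open>D v\<close> at one point.\<close>

lemma opposite_sides:
  assumes F: "F \<in> Faces" and t: "tface v w b F" and F': "F' \<in> Faces" and t': "tface v w b' F'" and ne: "b \<noteq> b'"
  obtains \<tau> \<beta> where "0 < \<beta>" "ctr b' - ctr v = \<tau> *\<^sub>R (ctr w - ctr v) - \<beta> *\<^sub>R (ctr b - ctr v)"
proof -
  note tf = tface_facts[OF t] and tf' = tface_facts[OF t']
  have cr: "Im (cnj (ctr w - ctr v) * (ctr b - ctr v)) \<noteq> 0" by (rule tface_cross_nonzero[OF t])
  obtain \<tau> \<beta> where dec: "ctr b' - ctr v = \<tau> *\<^sub>R (ctr w - ctr v) + \<beta> *\<^sub>R (ctr b - ctr v)"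
    "\<beta> = Im (cnj (ctr w - ctr v) * (ctr b' - ctr v)) / Im (cnj (ctr w - ctr v) * (ctr b - ctr v))"
    using real_cross_decomposition[OF cr, of "ctr b' - ctr v"] by metis
  have "\<beta> \<noteq> 0" using dec(2) cr tface_cross_nonzero[OF t'] by simp
  moreover have "\<not> 0 < \<beta>"
  proof
    assume \<beta>: "0 < \<beta>"
    consider "0 < \<tau>" | "\<tau> = 0" | "\<tau> < 0" by linarith
    thus False
    proof cases
      case 1
      show False by (rule no_nbr_in_sector[OF F t _ _ _ dec(1) 1 \<beta>]) (use tf' ne in auto)
    next
      case 2
      hence eq: "ctr b' - ctr v = \<beta> *\<^sub>R (ctr b - ctr v)" using dec by simp
      have n: "norm (ctr b' - ctr v) = r v + r b'" "norm (ctr b - ctr v) = r v + r b"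
        using tangent_dist[OF tf(7)] tangent_dist[OF tf'(7)] by (auto simp: dist_norm norm_minus_commute)
      hence n2: "r v + r b' = \<beta> * (r v + r b)" using eq \<beta> by simp
      define p where "p = ctr v + (r v / (r v + r b)) *\<^sub>R (ctr b - ctr v)"
      obtain q where q: "q \<in> D v" "q \<in> D b" using adj_iff[OF adj_neq[OF tf(7)]] tf(7) by blast
      obtain q' where q': "q' \<in> D v" "q' \<in> D b'" using adj_iff[OF adj_neq[OF tf'(7)]] tf'(7) by blast
      have "q' = ctr v + (r v / (r v + r b')) *\<^sub>R (ctr b' - ctr v)"
        using tangent_point(3)[OF tf'(7) q'] .
      also have "\<dots> = ctr v + (r v / (r v + r b)) *\<^sub>R (ctr b - ctr v)"
        unfolding eq n2 using \<beta> by simp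
      also have "\<dots> = q" using tangent_point(3)[OF tf(7) q] by simp
      finally show False using no_triple[of v b b' q] q q' ne tf(1) tf'(1) by auto
    next
      case 3
      have "\<beta> *\<^sub>R (ctr b - ctr v) = (ctr b' - ctr v) - \<tau> *\<^sub>R (ctr w - ctr v)" using dec(1) by simp
      hence "(1 / \<beta>) *\<^sub>R (\<beta> *\<^sub>R (ctr b - ctr v)) = (1 / \<beta>) *\<^sub>R ((ctr b' - ctr v) - \<tau> *\<^sub>R (ctr w - ctr v))" by simp
      hence dec': "ctr b - ctr v = (- \<tau> / \<beta>) *\<^sub>R (ctr w - ctr v) + (1 / \<beta>) *\<^sub>R (ctr b' - ctr v)"
        using \<beta> by (simp add: scaleR_diff_right)
      have "0 < - \<tau> / \<beta>" "0 < 1 / \<beta>" using 3 \<beta> by (auto simp: divide_neg_pos)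
      thus False by (intro no_nbr_in_sector[OF F' t' _ _ _ dec']) (use tf ne in auto)
    qed
  qed
  ultimately have "0 < - \<beta>" by simp
  moreover have "ctr b' - ctr v = \<tau> *\<^sub>R (ctr w - ctr v) - (- \<beta>) *\<^sub>R (ctr b - ctr v)" using dec(1) by simp
  ultimately show thesis by (rule that)
qed

section \<open>Stars of centre triangles around a disc\<close>

definition star :: "'v \<Rightarrow> complex set" where
  "star v = \<Union>{hull3 v w b | w b. \<exists>F\<in>Faces. tface v w b F}"

lemma closed_star: "closed (star v)"
proof -
  have "{(w, b). \<exists>F\<in>Faces. tface v w b F} \<subseteq> nbrs adj v \<times> nbrs adj v"
    by (auto simp: nbrs_def dest: tface_facts(2,7))
  hence fin: "finite {(w, b). \<exists>F\<in>Faces. tface v w b F}" using fin_nbrs by (meson finite_SigmaI finite_subset)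
  have "star v = (\<Union>(w, b)\<in>{(w, b). \<exists>F\<in>Faces. tface v w b F}. hull3 v w b)" unfolding star_def by blast
  moreover have "closed \<dots>"
    using fin by (intro closed_UN) (auto intro!: compact_imp_closed[OF compact_convex_hull[OF finite_imp_compact]])
  ultimately show ?thesis by simp
qed

text \<open>The two faces at the edge lie on opposite sides of the segment of centres, so their
  triangles together surround the tangency point.\<close>

lemma tangency_in_interior_star:
  assumes vw: "adj v w" and z: "z \<in> D v" "z \<in> D w"
  shows "z \<in> interior (star v)"
proof -
  obtain b b' F F' where F: "F \<in> Faces" "F' \<in> Faces" "tface v w b F" "tface v w b' F'" "b \<noteq> b'"
    by (rule edge_two_faces[OF vw])
  obtain \<tau> \<beta> where op: "0 < \<beta>" "ctr b' - ctr v = \<tau> *\<^sub>R (ctr w - ctr v) - \<beta> *\<^sub>R (ctr b - ctr v)"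
    using opposite_sides[OF F(1,3,2,4,5)] by blast
  have "z \<in> interior (hull3 v w b \<union> hull3 v w b')"
    by (rule two_triangles_nbhd[OF tface_cross_nonzero[OF F(3)] op(2,1) tangent_point(3)[OF vw z]])
       (use r_pos[of v] r_pos[of w] in \<open>auto simp: field_simps\<close>)
  moreover have "hull3 v w b \<union> hull3 v w b' \<subseteq> star v" unfolding star_def using F by blast
  ultimately show ?thesis using interior_mono by blast
qed

text \<open>A clopen argument on the circle: the star is closed, and it is a neighbourhood of each
  of its points on the circle, which are interior to a triangle or tangency points. A tangency point
  shows that the intersection is not empty.\<close>

lemma sphere_subset_interior_star: "sphere (ctr v) (r v) \<subseteq> interior (star v)"
proof -
  let ?S = "sphere (ctr v) (r v)"
  have sub: "?S \<inter> star v \<subseteq> interior (star v)"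
  proof
    fix z assume z: "z \<in> ?S \<inter> star v"
    then obtain w b F where F: "F \<in> Faces" "tface v w b F" "z \<in> hull3 v w b" unfolding star_def by blast
    note tf = tface_facts[OF F(2)]
    have zD: "z \<in> D v" using z by simp
    show "z \<in> interior (star v)"
    proof (cases "z \<in> interior (hull3 v w b)")
      case True
      moreover have "hull3 v w b \<subseteq> star v" unfolding star_def using F by blast
      ultimately show ?thesis using interior_mono by blast
    next
      case False
      hence "z \<in> frontier (hull3 v w b)" using F(3) closure_subset unfolding frontier_def by blast
      hence "z \<in> closed_segment (ctr v) (ctr w) \<union> closed_segment (ctr w) (ctr b) \<union> closed_segment (ctr b) (ctr v)"
        by (subst (asm) frontier_of_triangle) auto
      then consider "z \<in> closed_segment (ctr v) (ctr w)" | "z \<in> closed_segment (ctr w) (ctr b)"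
        | "z \<in> closed_segment (ctr v) (ctr b)" by (auto simp: closed_segment_commute)
      moreover have on_edge: "z \<in> D u" if u: "adj v u" "z \<in> closed_segment (ctr v) (ctr u)" for u
      proof -
        have "dist (ctr v) (ctr u) = dist (ctr v) z + dist z (ctr u)"
          using u(2) by (metis between between_mem_segment)
        thus ?thesis using z tangent_dist[OF u(1)] by (simp add: dist_commute)
      qed
      \<comment> \<open>The side opposite to \<open>v\<close> is covered by \<open>D w\<close> and
        \<open>D b\<close>, so it too meets the circle at tangency points only.\<close>
      ultimately have "z \<in> D w \<or> z \<in> D b" using segment_subset_D[OF tf(3)] tf(2,7) by blast
      thus ?thesis using tangency_in_interior_star[OF tf(2) zD] tangency_in_interior_star[OF tf(7) zD] by blast
    qed
  qed
  have op: "openin (top_of_set ?S) (?S \<inter> interior (star v))" by (simp add: openin_open_Int)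
  have eq: "?S \<inter> interior (star v) = ?S \<inter> star v" using sub interior_subset by blast
  have cl: "closedin (top_of_set ?S) (?S \<inter> interior (star v))"
    unfolding eq using closed_star by (simp add: closedin_closed_Int)
  obtain w where vw: "adj v w" using nbr_ex by blast
  then obtain z where z: "z \<in> D v" "z \<in> D w" using adj_iff[OF adj_neq[OF vw]] by blast
  hence "z \<in> ?S \<inter> interior (star v)"
    using tangency_in_interior_star[OF vw z] tangent_point(1)[OF vw z] by simp
  moreover have "connected ?S" by (rule connected_sphere) simp
  ultimately have "?S \<inter> interior (star v) = ?S"
    using op cl unfolding connected_clopen by blast
  thus ?thesis by blast
qed

lemma D_nbhd:
  assumes "z \<in> D v"
  obtains e where "0 < e"
    "\<And>x. x \<in> ball z e \<Longrightarrow> x \<in> D v \<or> (\<exists>w b F. F \<in> Faces \<and> tface v w b F \<and> x \<in> tri_discs v w b \<union> gap v w b)"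
proof -
  have "open (B v \<union> interior (star v))" by blast
  moreover have "z \<in> B v \<union> interior (star v)"
    using assms sphere_subset_interior_star[of v] by (cases "dist (ctr v) z < r v") auto
  ultimately obtain e where e: "0 < e" "ball z e \<subseteq> B v \<union> interior (star v)" using openE by blast
  show thesis
  proof (rule that[OF e(1)])
    fix x assume "x \<in> ball z e"
    hence "x \<in> B v \<or> x \<in> star v" using e interior_subset by blast
    thus "x \<in> D v \<or> (\<exists>w b F. F \<in> Faces \<and> tface v w b F \<and> x \<in> tri_discs v w b \<union> gap v w b)"
    proof
      assume "x \<in> star v"
      then obtain w b F where F: "F \<in> Faces" "tface v w b F" "x \<in> hull3 v w b" unfolding star_def by blast
      hence "x \<in> tri_discs v w b \<union> gap v w b" using hull3_subset[OF tface_facts(2-4)[OF F(2)]] by blast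
      thus ?thesis using F by blast
    qed auto
  qed
qed

text \<open>Around a point of a disc there are only the discs and interstices of its faces, and the
  interstice of a face contains no centre.\<close>

lemma centres_locally_finite:
  assumes "p \<in> ball 0 1"
  obtains e where "0 < e" "finite {v. ctr v \<in> ball p e}"
proof (rule carrier_cases[OF assms])
  fix v assume "p \<in> D v"
  obtain e where e: "0 < e"
    "\<And>x. x \<in> ball p e \<Longrightarrow> x \<in> D v \<or> (\<exists>w b F. F \<in> Faces \<and> tface v w b F \<and> x \<in> tri_discs v w b \<union> gap v w b)"
    using D_nbhd[OF \<open>p \<in> D v\<close>] by blast
  have centre: "u = w" if "ctr u \<in> D w" for u w using B_D_disjoint[of u w] that centre_in_B by blast
  have "{u. ctr u \<in> ball p e} \<subseteq> insert v (nbrs adj v)"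
  proof
    fix u assume "u \<in> {u. ctr u \<in> ball p e}"
    hence "ctr u \<in> D v \<or> (\<exists>w b F. F \<in> Faces \<and> tface v w b F \<and> ctr u \<in> tri_discs v w b \<union> gap v w b)"
      using e(2) by blast
    thus "u \<in> insert v (nbrs adj v)"
    proof
      assume "\<exists>w b F. F \<in> Faces \<and> tface v w b F \<and> ctr u \<in> tri_discs v w b \<union> gap v w b"
      then obtain w b F where F: "F \<in> Faces" "tface v w b F" "ctr u \<in> tri_discs v w b \<union> gap v w b" by blast
      hence "ctr u \<in> tri_discs v w b" using gap_disjoint_D[OF F(1,2), of u] centre_in_D by blast
      thus ?thesis using centre tface_facts(2,7)[OF F(2)] unfolding nbrs_def by blast
    qed (use centre in blast)
  qed
  hence "finite {u. ctr u \<in> ball p e}" using fin_nbrs by (meson finite.insertI finite_subset)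
  thus thesis using that e(1) by blast
next
  fix F a b c assume F: "F \<in> Faces" "tface a b c F" "p \<in> gap a b c"
  obtain e where e: "0 < e" "ball p e \<subseteq> gap a b c" using open_gap F(3) openE by blast
  have "{v. ctr v \<in> ball p e} = {}" using gap_disjoint_D[OF F(1,2)] e(2) centre_in_D by blast
  thus thesis using that[OF e(1)] by simp
qed

text \<open>Two interstices of faces either coincide near a common point or are disjoint, because no
  disc enters an interstice. Hence a partition of the discs meeting \<^term>\<open>L\<close> without tangencies
  between the two classes yields a partition of \<^term>\<open>L\<close> into relatively open sets.\<close>

lemma linked_discs:
  assumes L: "connected L" "L \<subseteq> ball 0 1"
  shows "linked adj {v. D v \<inter> L \<noteq> {}}"
proof -
  define S where "S = {v. D v \<inter> L \<noteq> {}}"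
  have "\<exists>i\<in>P. \<exists>j\<in>S - P. adj i j" if P: "P \<subseteq> S" "P \<noteq> {}" "P \<noteq> S" for P
  proof (rule ccontr)
    assume "\<not> ?thesis"
    hence sep: "\<not> adj u v" if "u \<in> P" "v \<in> S - P" for u v using that by blast
    define Q where "Q = S - P"
    have ne: "P \<noteq> {}" "Q \<noteq> {}" "P \<union> Q = S" "P \<inter> Q = {}" using P unfolding Q_def by blast+
    define U where "U Z = {z\<in>L. (\<exists>v\<in>Z. z \<in> D v) \<or> (\<exists>F a b c. F \<in> Faces \<and> tface a b c F \<and> z \<in> gap a b c
      \<and> {a, b, c} \<inter> Z \<noteq> {})}" for Z
    have U_D: "z \<in> U Z" if "z \<in> L" "z \<in> D v" "v \<in> Z" for z v Z using that unfolding U_def by auto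
    have U_gap: "z \<in> U Z" if "z \<in> L" "F \<in> Faces" "tface a b c F" "z \<in> gap a b c" "{a, b, c} \<inter> Z \<noteq> {}"
      for z F a b c Z using that unfolding U_def by auto
    have sepPQ: "\<not> adj u v" "\<not> adj v u" "u \<noteq> v" if "u \<in> P" "v \<in> Q" for u v
      using sep that symm ne unfolding Q_def by blast+
    \<comment> \<open>The corners of a face are pairwise adjacent, so those whose discs meet
      \<open>L\<close> lie in one class.\<close>
    have same: "u \<in> Z" if Z: "Z = P \<or> Z = Q" and t: "tface a b c F" and x: "x \<in> {a, b, c} \<inter> Z"
      and u: "u \<in> {a, b, c}" "u \<in> S" for u x Z a b c F
    proof -
      have "u = x \<or> adj u x" using x u tface_facts(2-7)[OF t] by auto
      thus ?thesis using Z x u ne sepPQ by blast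
    qed
    have touch: "\<exists>u\<in>{a, b, c}. \<exists>z\<in>L. z \<in> D u" if F: "F \<in> Faces" "tface a b c F" "L \<inter> gap a b c \<noteq> {}" for F a b c
    proof (rule ccontr)
      assume "\<not> ?thesis"
      hence "L \<inter> tri_discs a b c = {}" by blast
      hence "L \<subseteq> gap a b c" using connected_subset_gap[OF L(1)] F(3) by blast
      moreover obtain v where "v \<in> P" using ne by blast
      ultimately show False using P gap_disjoint_D[OF F(1,2), of v] unfolding S_def by blast
    qed
    have cover: "L \<subseteq> U P \<union> U Q"
    proof
      fix z assume z: "z \<in> L"
      hence "z \<in> ball 0 1" using L by blast
      thus "z \<in> U P \<union> U Q"
      proof (rule carrier_cases)
        fix v assume v: "z \<in> D v"
        hence "v \<in> P \<union> Q" using z ne(3) unfolding S_def by blast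
        thus ?thesis using U_D[OF z v] by blast
      next
        fix F a b c assume F: "F \<in> Faces" "tface a b c F" "z \<in> gap a b c"
        then obtain u where "u \<in> {a, b, c}" "u \<in> S" using touch[OF F(1,2)] z unfolding S_def by blast
        hence "{a, b, c} \<inter> P \<noteq> {} \<or> {a, b, c} \<inter> Q \<noteq> {}" using ne(3) by blast
        thus ?thesis using U_gap[OF z F] by blast
      qed
    qed
    have disj: "U P \<inter> U Q = {}"
    proof (rule ccontr)
      assume "U P \<inter> U Q \<noteq> {}"
      then obtain z where zP: "z \<in> U P" and zQ: "z \<in> U Q" by blast
      have zL: "z \<in> L" using zP unfolding U_def by blast
      show False
      proof (cases "\<exists>v. z \<in> D v")
        case True
        hence nogap: "z \<notin> gap a b c" if "F \<in> Faces" "tface a b c F" for F a b c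
          using gap_disjoint_D[OF that] by blast
        obtain u v where "u \<in> P" "z \<in> D u" "v \<in> Q" "z \<in> D v" using zP zQ nogap unfolding U_def by blast
        thus False using D_Int_imp_adj[of z u v] sepPQ by blast
      next
        case False
        obtain F a b c where F: "F \<in> Faces" "tface a b c F" "z \<in> gap a b c" "{a, b, c} \<inter> P \<noteq> {}"
          using zP False unfolding U_def by blast
        obtain F' a' b' c' where F': "F' \<in> Faces" "tface a' b' c' F'" "z \<in> gap a' b' c'" "{a', b', c'} \<inter> Q \<noteq> {}"
          using zQ False unfolding U_def by blast
        \<comment> \<open>The two interstices are compared by components: neither contains a point
          of the discs of the other face, so the components at \<open>z\<close> coincide. Since
          \<open>L\<close> meets discs of \<open>P\<close>, it leaves this component through a
          frontier point, which belongs to a disc of either face.\<close>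
        define K where "K = connected_component_set (gap a b c) z"
        have K: "connected K" "z \<in> K" "K \<subseteq> gap a b c" unfolding K_def using F(3) connected_component_subset by auto
        define K' where "K' = connected_component_set (gap a' b' c') z"
        have K': "connected K'" "z \<in> K'" "K' \<subseteq> gap a' b' c'" unfolding K'_def using F'(3) connected_component_subset by auto
        have "K \<inter> tri_discs a' b' c' = {}" using gap_disjoint_D[OF F(1,2)] K(3) by blast
        hence "K \<subseteq> gap a' b' c'" using connected_subset_gap[OF K(1)] K(2) F'(3) by blast
        hence KK': "K \<subseteq> K'" unfolding K'_def using K by (intro connected_component_maximal) auto
        have "K' \<inter> tri_discs a b c = {}" using gap_disjoint_D[OF F'(1,2)] K'(3) by blast
        hence "K' \<subseteq> gap a b c" using connected_subset_gap[OF K'(1)] K'(2) F(3) by blast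
        hence "K' \<subseteq> K" unfolding K_def using K' by (intro connected_component_maximal) auto
        hence eq: "K = K'" using KK' by blast
        have "\<not> L \<subseteq> K"
        proof
          assume "L \<subseteq> K"
          moreover obtain v where "v \<in> P" using ne by blast
          ultimately show False using P K(3) gap_disjoint_D[OF F(1,2), of v] unfolding S_def by blast
        qed
        hence "L \<inter> frontier K \<noteq> {}" using connected_Int_frontier[OF L(1), of K] zL K(2) by blast
        then obtain q where q: "q \<in> L" "q \<in> frontier K" by blast
        have "q \<in> tri_discs x y' w" if "K = connected_component_set (gap x y' w) z" "z \<in> gap x y' w" for x y' w
        proof -
          have "K = connected_component_set (- tri_discs x y' w) z"
          proof
            show "K \<subseteq> connected_component_set (- tri_discs x y' w) z"
              using gap_disjoint[of x y' w] K(3) unfolding that(1)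
              by (intro connected_component_mono) blast
            show "connected_component_set (- tri_discs x y' w) z \<subseteq> K"
              unfolding that(1)
            proof (rule connected_component_maximal)
              show "z \<in> connected_component_set (- tri_discs x y' w) z"
                using that(2) gap_disjoint[of x y' w] by (simp add: disjoint_iff) 
              show "connected_component_set (- tri_discs x y' w) z \<subseteq> gap x y' w"
              proof (rule connected_subset_gap)
                show "connected_component_set (- tri_discs x y' w) z \<inter> tri_discs x y' w = {}"
                  using connected_component_subset by fast
                show "connected_component_set (- tri_discs x y' w) z \<inter> gap x y' w \<noteq> {}"
                  using that(2) \<open>z \<in> connected_component_set _ z\<close> by blast
              qed auto
            qed auto
          qed
          hence "K \<in> components (- tri_discs x y' w)"
            using that(2) gap_disjoint[of x y' w] by (auto simp: components_def)
          hence "frontier K \<subseteq> tri_discs x y' w"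
            by (intro frontier_of_components_closed_complement closed_tri_discs)
          thus ?thesis using q by blast
        qed
        hence "q \<in> tri_discs a b c" "q \<in> tri_discs a' b' c'"
          using F(3) F'(3) K_def eq K'_def by blast+
        then obtain u u' where u: "u \<in> {a, b, c}" "q \<in> D u" "u' \<in> {a', b', c'}" "q \<in> D u'" by blast
        hence "u \<in> S" "u' \<in> S" using q unfolding S_def by blast+
        hence "u \<in> P" "u' \<in> Q" using same[of P a b c F _ u] same[of Q a' b' c' F' _ u'] F F' u by blast+
        thus False using D_Int_imp_adj[of q u u'] u sepPQ by blast
      qed
    qed
    have opn: "openin (top_of_set L) (U Z)" if Z: "Z = P \<or> Z = Q" for Z
    proof (subst openin_contains_ball, intro conjI ballI)
      show "U Z \<subseteq> L" unfolding U_def by blast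
      fix z assume z: "z \<in> U Z"
      show "\<exists>e>0. ball z e \<inter> L \<subseteq> U Z"
      proof (cases "\<exists>v\<in>Z. z \<in> D v")
        case True
        then obtain v where v: "v \<in> Z" "z \<in> D v" by blast
        obtain e where e: "0 < e"
          "\<And>x. x \<in> ball z e \<Longrightarrow> x \<in> D v \<or> (\<exists>w b F. F \<in> Faces \<and> tface v w b F \<and> x \<in> tri_discs v w b \<union> gap v w b)"
          using D_nbhd[OF v(2)] by blast
        have "ball z e \<inter> L \<subseteq> U Z"
        proof
          fix x assume x: "x \<in> ball z e \<inter> L"
          hence "x \<in> D v \<or> (\<exists>w b F. F \<in> Faces \<and> tface v w b F \<and> x \<in> tri_discs v w b \<union> gap v w b)" using e by blast
          thus "x \<in> U Z"
          proof
            assume "x \<in> D v" thus ?thesis using U_D v(1) x by blast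
          next
            assume "\<exists>w b F. F \<in> Faces \<and> tface v w b F \<and> x \<in> tri_discs v w b \<union> gap v w b"
            then obtain w b F where F: "F \<in> Faces" "tface v w b F" "x \<in> tri_discs v w b \<union> gap v w b" by blast
            show ?thesis
            proof (cases "x \<in> gap v w b")
              case True
              have "{v, w, b} \<inter> Z \<noteq> {}" using v by blast
              thus ?thesis using U_gap[OF _ F(1,2) True] x by blast
            next
              case False
              then obtain u where u: "u \<in> {v, w, b}" "x \<in> D u" using F(3) by blast
              hence "u \<in> S" using x unfolding S_def by blast
              hence "u \<in> Z" using same[OF Z F(2), of v u] v(1) u(1) by blast
              thus ?thesis using U_D[OF _ u(2)] x by blast
            qed
          qed
        qed
        thus ?thesis using e(1) by blast
      next
        case False
        then obtain F a b c where F: "F \<in> Faces" "tface a b c F" "z \<in> gap a b c" "{a, b, c} \<inter> Z \<noteq> {}"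
          using z unfolding U_def by blast
        obtain e where "0 < e" "ball z e \<subseteq> gap a b c" using open_gap F(3) openE by blast
        moreover have "ball z e \<inter> L \<subseteq> U Z" using calculation(2) U_gap[OF _ F(1,2) _ F(4)] by blast
        ultimately show ?thesis by blast
      qed
    qed
    have "U Z \<noteq> {}" if Z: "Z \<noteq> {}" "Z \<subseteq> S" for Z
    proof -
      obtain v z where "v \<in> Z" "z \<in> D v" "z \<in> L" using Z unfolding S_def by blast
      thus ?thesis using U_D by blast
    qed
    hence "U P \<noteq> {}" "U Q \<noteq> {}" using ne by blast+
    moreover have "U P \<subseteq> L" "U Q \<subseteq> L" unfolding U_def by blast+
    ultimately show False
      using L(1) opn[of P] opn[of Q] cover disj unfolding connected_openin by blast
  qed
  thus ?thesis unfolding linked_def S_def by blast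
qed

end

section \<open>Metric geometry of the unit disc\<close>

lemma compact_in_smaller_ball:
  fixes K :: "complex set"
  assumes "compact K" "K \<subseteq> ball 0 1"
  obtains \<kappa> where "0 < \<kappa>" "\<kappa> < 1" "K \<subseteq> ball 0 (1 - \<kappa>)"
proof (cases "K = {}")
  case True
  show thesis using that[of "1/2"] True by simp
next
  case False
  obtain x where x: "x \<in> K" "\<And>z. z \<in> K \<Longrightarrow> norm z \<le> norm x"
    using continuous_attains_sup[OF assms(1) False, of norm] continuous_on_norm_id by blast
  hence "norm x < 1" using assms(2) by auto
  show thesis
  proof (rule that[of "(1 - norm x) / 2"])
    show "K \<subseteq> ball 0 (1 - (1 - norm x) / 2)"
      using x(2) \<open>norm x < 1\<close> by (fastforce simp: field_simps)
    have "- 1 < norm x" by (rule less_le_trans[of _ 0]) auto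
    thus "(1 - norm x) / 2 < 1" by simp
  qed (use \<open>norm x < 1\<close> in simp)
qed

text \<open>Comparison of areas, divided by the area of the unit disc.\<close>

lemma sum_squares_radii_le:
  fixes q :: "'i \<Rightarrow> complex"
  assumes "finite F" "0 \<le> R" and e: "\<And>i. i \<in> F \<Longrightarrow> 0 \<le> e i"
    and sub: "\<And>i. i \<in> F \<Longrightarrow> ball (q i) (e i) \<subseteq> ball z R"
    and disj: "\<And>i j. i \<in> F \<Longrightarrow> j \<in> F \<Longrightarrow> i \<noteq> j \<Longrightarrow> ball (q i) (e i) \<inter> ball (q j) (e j) = {}"
  shows "(\<Sum>i\<in>F. (e i)\<^sup>2) \<le> R\<^sup>2"
proof -
  define u where "u = unit_ball_vol (real DIM(complex))"
  have u: "0 < u" unfolding u_def by simp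
  have cb: "measure lborel (ball x s) = u * s\<^sup>2" if "0 \<le> s" for x :: complex and s
    using content_ball[OF that, of x] unfolding u_def by simp
  have fin: "emeasure lborel (ball x s) \<noteq> \<infinity>" for x :: complex and s
    using emeasure_lborel_ball_finite[of x s] by simp
  have "(\<Sum>i\<in>F. u * (e i)\<^sup>2) = (\<Sum>i\<in>F. measure lborel (ball (q i) (e i)))"
    using e by (intro sum.cong) (auto simp: cb)
  also have "\<dots> = measure lborel (\<Union>i\<in>F. ball (q i) (e i))"
    using assms(1) disj
    by (intro measure_finite_Union[symmetric])
       (auto simp: disjoint_family_on_def fin[simplified])
  also have "\<dots> \<le> measure lborel (ball z R)"
    using sub assms(1) by (intro measure_mono_fmeasurable) (auto simp: fmeasurable_def less_top[symmetric] fin[simplified])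
  also have "\<dots> = u * R\<^sup>2" by (rule cb[OF assms(2)])
  finally show ?thesis using u by (simp add: sum_distrib_left[symmetric])
qed

text \<open>Points of the circle are written with \<open>x\<close>, the cosine of the angle to the
  inward radius. Their squared norm is \<open>1 - 2 * s * x + s\<^sup>2\<close>, so
  \<open>x > s / 2\<close> describes the part in the unit disc: two half arcs joined at
  \<open>x = 1\<close>. As \<open>x\<close> tends to \<open>s / 2\<close> they approach the unit
  circle.\<close>

lemma connected_circle_Int_disc:
  fixes \<xi> :: complex
  assumes \<xi>: "norm \<xi> = 1" and s: "0 < s" "s < 1"
  shows "connected (sphere \<xi> s \<inter> ball 0 1)"
    and "\<And>\<kappa>. 0 < \<kappa> \<Longrightarrow> \<kappa> < 1 \<Longrightarrow> \<exists>x \<in> sphere \<xi> s \<inter> ball 0 1. x \<notin> ball 0 (1 - \<kappa>)"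
proof -
  define f where "f \<sigma> x = \<xi> * (1 - of_real s * Complex x (\<sigma> * sqrt (1 - x\<^sup>2)))" for \<sigma> x :: real
  have xle: "x\<^sup>2 \<le> 1" if "x \<in> {s/2<..1}" for x using that s by (simp add: power_le_one)
  have norm_f: "(norm (f \<sigma> x))\<^sup>2 = 1 - 2 * s * x + s\<^sup>2" and dist_f: "norm (\<xi> - f \<sigma> x) = s"
    if "\<sigma> = 1 \<or> \<sigma> = -1" "x \<in> {s/2<..1}" for \<sigma> x
  proof -
    have sq: "(\<sigma> * sqrt (1 - x\<^sup>2))\<^sup>2 = 1 - x\<^sup>2" using that(1) xle[OF that(2)] by (auto simp: power_mult_distrib)
    have "(norm (f \<sigma> x))\<^sup>2 = (1 - s * x)\<^sup>2 + s\<^sup>2 * (\<sigma> * sqrt (1 - x\<^sup>2))\<^sup>2"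
      unfolding f_def norm_mult \<xi> by (simp add: cmod_power2 power_mult_distrib)
    also have "\<dots> = 1 - 2 * s * x + s\<^sup>2" unfolding sq by (simp add: power2_eq_square algebra_simps)
    finally show "(norm (f \<sigma> x))\<^sup>2 = 1 - 2 * s * x + s\<^sup>2" .
    have "(norm (Complex x (\<sigma> * sqrt (1 - x\<^sup>2))))\<^sup>2 = 1" unfolding cmod_power2 using sq by simp
    hence "norm (Complex x (\<sigma> * sqrt (1 - x\<^sup>2))) = 1"
      by (metis norm_ge_zero power2_eq_1_iff not_one_le_zero neg_0_le_iff_le)
    moreover have "\<xi> - f \<sigma> x = \<xi> * of_real s * Complex x (\<sigma> * sqrt (1 - x\<^sup>2))" unfolding f_def by (simp add: algebra_simps)
    ultimately show "norm (\<xi> - f \<sigma> x) = s" using \<xi> s by (simp add: norm_mult)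
  qed
  have in_arc: "f \<sigma> x \<in> sphere \<xi> s \<inter> ball 0 1" if "\<sigma> = 1 \<or> \<sigma> = -1" "x \<in> {s/2<..1}" for \<sigma> x
  proof -
    have "s * s < 2 * s * x" using that(2) s by simp
    hence "(norm (f \<sigma> x))\<^sup>2 < 1" using norm_f[OF that] by (simp add: power2_eq_square)
    hence "norm (f \<sigma> x) < 1" by (simp add: power2_less_1_iff abs_less_iff) 
    thus ?thesis using dist_f[OF that] by (simp add: dist_norm)
  qed
  have "sphere \<xi> s \<inter> ball 0 1 \<subseteq> f 1 ` {s/2<..1} \<union> f (-1) ` {s/2<..1}"
  proof
    fix z assume z: "z \<in> sphere \<xi> s \<inter> ball 0 1"
    define w where "w = (\<xi> - z) / (of_real s * \<xi>)"
    have \<xi>0: "\<xi> \<noteq> 0" using \<xi> by auto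
    have zw: "z = \<xi> * (1 - of_real s * w)" unfolding w_def using \<xi>0 s by (simp add: field_simps)
    have nw: "norm w = 1" using z \<xi> s unfolding w_def by (simp add: norm_divide norm_mult dist_norm)
    hence w1: "(Re w)\<^sup>2 + (Im w)\<^sup>2 = 1" by (metis cmod_power2 one_power2)
    have "(norm z)\<^sup>2 = (1 - s * Re w)\<^sup>2 + (s * Im w)\<^sup>2" unfolding zw norm_mult \<xi> by (simp add: cmod_power2)
    also have "\<dots> = 1 - 2 * s * Re w + s\<^sup>2 * ((Re w)\<^sup>2 + (Im w)\<^sup>2)" by (simp add: power2_eq_square algebra_simps)
    finally have "(norm z)\<^sup>2 = 1 - 2 * s * Re w + s\<^sup>2" using w1 by simp
    moreover have "(norm z)\<^sup>2 < 1" using z by (simp add: power_less_one_iff)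
    ultimately have "s * (s / 2) < s * Re w" by (simp add: power2_eq_square)
    hence "s / 2 < Re w" using s by (simp only: mult_less_cancel_left_pos)
    moreover have "Re w \<le> 1" using complex_Re_le_cmod[of w] nw by simp
    ultimately have Re: "Re w \<in> {s/2<..1}" by simp
    have "(Im w)\<^sup>2 = 1 - (Re w)\<^sup>2" using w1 by simp
    hence "sqrt (1 - (Re w)\<^sup>2) = \<bar>Im w\<bar>" by (metis real_sqrt_abs)
    hence "w = Complex (Re w) (1 * sqrt (1 - (Re w)\<^sup>2)) \<or> w = Complex (Re w) ((- 1) * sqrt (1 - (Re w)\<^sup>2))"
      by (simp add: complex_eq_iff abs_if)
    hence "z = f 1 (Re w) \<or> z = f (-1) (Re w)" unfolding f_def using zw by metis
    thus "z \<in> f 1 ` {s/2<..1} \<union> f (-1) ` {s/2<..1}" using Re by blast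
  qed
  hence eq: "sphere \<xi> s \<inter> ball 0 1 = f 1 ` {s/2<..1} \<union> f (-1) ` {s/2<..1}" using in_arc by blast
  have conn: "connected (f \<sigma> ` {s/2<..1})" for \<sigma>
  proof (rule connected_continuous_image)
    show "continuous_on {s/2<..1} (f \<sigma>)"
      unfolding f_def Complex_eq by (intro continuous_intros)
  qed simp
  have "f 1 1 = f (-1) 1" unfolding f_def by simp
  moreover have "1 \<in> {s/2<..1}" using s by simp
  ultimately have "f 1 ` {s/2<..1} \<inter> f (-1) ` {s/2<..1} \<noteq> {}" by (metis IntI empty_iff imageI)
  thus "connected (sphere \<xi> s \<inter> ball 0 1)" unfolding eq by (intro connected_Un conn)
  fix \<kappa> :: real assume \<kappa>: "0 < \<kappa>" "\<kappa> < 1"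
  \<comment> \<open>This gives the squared norm \<open>1 - s * \<kappa> / 2\<close>, which is at
    least \<open>(1 - \<kappa>)\<^sup>2\<close>.\<close>
  define x where "x = s / 2 + \<kappa> / 4"
  have x: "x \<in> {s/2<..1}" using s \<kappa> unfolding x_def by simp
  have "(norm (f 1 x))\<^sup>2 = 1 - s * \<kappa> / 2"
    using norm_f[OF _ x, of 1] unfolding x_def by (simp add: power2_eq_square algebra_simps)
  moreover have "s * \<kappa> \<le> \<kappa>" using s \<kappa> mult_right_mono[of s 1 \<kappa>] by simp
  moreover have "\<kappa> * \<kappa> \<le> \<kappa>" using \<kappa> mult_right_mono[of \<kappa> 1 \<kappa>] by simp
  moreover have "(1 - \<kappa>)\<^sup>2 = 1 - 2 * \<kappa> + \<kappa> * \<kappa>" by (simp add: power2_eq_square algebra_simps)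
  ultimately have "(1 - \<kappa>)\<^sup>2 \<le> (norm (f 1 x))\<^sup>2" using \<kappa> by linarith
  hence "1 - \<kappa> \<le> norm (f 1 x)" by (rule power2_le_imp_le) simp
  thus "\<exists>x \<in> sphere \<xi> s \<inter> ball 0 1. x \<notin> ball 0 (1 - \<kappa>)" using in_arc[OF _ x, of 1] by (intro bexI[of _ "f 1 x"]) auto
qed

section \<open>Crosscuts of the packing\<close>

locale packed_network = net?: network adj c \<rho> M + packing adj pos ep ctr r
  for adj :: "'v \<Rightarrow> 'v \<Rightarrow> bool" and c :: "'v \<Rightarrow> 'v \<Rightarrow> real" and \<rho> :: 'v and M :: real
    and pos :: "'v \<Rightarrow> complex" and ep :: "'v \<Rightarrow> 'v \<Rightarrow> real \<Rightarrow> complex"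
    and ctr :: "'v \<Rightarrow> complex" and r :: "'v \<Rightarrow> real"
begin

lemma countable_V: "countable (A :: 'v set)"
proof -
  have "countable (range B)"
  proof (rule countable_disjoint_open_subsets)
    show "pairwise disjnt (range B)"
    proof (rule pairwiseI)
      fix X Y assume "X \<in> range B" "Y \<in> range B" "X \<noteq> Y"
      then obtain u v where "X = B u" "Y = B v" "u \<noteq> v" by blast
      thus "disjnt X Y" using B_disjoint[of u v] by (simp add: disjnt_def)
    qed
  qed auto
  moreover have "inj (\<lambda>v. B v)"
  proof (rule injI)
    fix u v assume "B u = B v"
    hence "ctr u \<in> B u \<inter> B v" using centre_in_B[of u] by blast
    thus "u = v" using B_disjoint[of u v] by blast
  qed
  ultimately have "countable (UNIV :: 'v set)" by (simp add: countable_image_inj_eq)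
  thus ?thesis by (rule countable_subset[rotated]) simp
qed

lemma sum_radii_le:
  assumes "finite F"
  shows "(\<Sum>v\<in>F. (r v)\<^sup>2) \<le> 1"
proof -
  have "(\<Sum>v\<in>F. (r v)\<^sup>2) \<le> 1\<^sup>2"
    using assms
  proof (rule sum_squares_radii_le[where q = ctr and z = 0])
    show "B i \<subseteq> ball 0 1" for i using ball_subset_cball D_subset by (rule subset_trans)
  qed (use r_pos B_disjoint in \<open>auto intro: less_imp_le\<close>)
  thus ?thesis by simp
qed

lemma finite_large_discs:
  assumes "0 < \<eta>"
  shows "finite {v. \<eta> \<le> r v}"
proof (rule ccontr)
  assume inf: "infinite {v. \<eta> \<le> r v}"
  obtain n :: nat where n: "1 / \<eta>\<^sup>2 < n" using reals_Archimedean2 by blast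
  obtain F where F: "F \<subseteq> {v. \<eta> \<le> r v}" "finite F" "card F = n"
    using infinite_arbitrarily_large[OF inf] by blast
  have "real n * \<eta>\<^sup>2 = (\<Sum>v\<in>F. \<eta>\<^sup>2)" using F by simp
  also have "\<dots> \<le> (\<Sum>v\<in>F. (r v)\<^sup>2)" using F assms by (intro sum_mono power_mono) auto
  also have "\<dots> \<le> 1" by (rule sum_radii_le[OF F(2)])
  finally show False using n assms by (simp add: field_simps)
qed

lemma finite_discs_margin:
  assumes "finite F"
  obtains \<kappa> where "0 < \<kappa>" "\<kappa> < 1" "\<forall>v\<in>F. D v \<subseteq> ball 0 (1 - \<kappa>)"
proof -
  have "compact (\<Union>v\<in>F. D v)" using assms by (intro compact_UN) auto
  moreover have "(\<Union>v\<in>F. D v) \<subseteq> ball 0 1" using D_subset by blast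
  ultimately obtain \<kappa> where \<kappa>: "0 < \<kappa>" "\<kappa> < 1" "(\<Union>v\<in>F. D v) \<subseteq> ball 0 (1 - \<kappa>)"
    using compact_in_smaller_ball by metis
  show thesis by (rule that[OF \<kappa>(1,2)]) (use \<kappa>(3) in blast)
qed

lemma cball_boundary_disjoint:
  assumes "norm (\<xi> :: complex) = 1"
  shows "cball \<xi> \<kappa> \<inter> ball 0 (1 - \<kappa>) = {}"
proof -
  have "1 \<le> dist \<xi> z + norm z" for z using assms norm_triangle_ineq4[of "\<xi> - z" "- z"] by (simp add: dist_norm)
  thus ?thesis by (auto simp: disjoint_iff) (smt (verit))
qed

text \<open>By area, only finitely many discs have radius at least \<open>\<eta> / 4\<close>, and
  these keep away from the unit circle. A smaller disc that comes within \<open>\<eta> / 4\<close>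
  of \<open>\<xi>\<close> stays within \<open>3 * \<eta> / 4\<close>.\<close>

lemma discs_near_boundary_small:
  assumes "norm \<xi> = 1" "0 < \<eta>"
  obtains \<delta> where "0 < \<delta>" "\<And>v. D v \<inter> cball \<xi> \<delta> \<noteq> {} \<Longrightarrow> D v \<subseteq> ball \<xi> \<eta>"
proof -
  have fin: "finite {v. \<eta> / 4 \<le> r v}" using assms(2) by (intro finite_large_discs) simp
  obtain \<kappa> where "0 < \<kappa>" and margin: "\<forall>v\<in>{v. \<eta> / 4 \<le> r v}. D v \<subseteq> ball 0 (1 - \<kappa>)"
    using finite_discs_margin[OF fin] by metis
  have \<kappa>: "0 < \<kappa>" "\<And>v. \<eta> / 4 \<le> r v \<Longrightarrow> D v \<subseteq> ball 0 (1 - \<kappa>)" using \<open>0 < \<kappa>\<close> margin by simp_all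
  show thesis
  proof (rule that[of "min \<kappa> (\<eta> / 4)"])
    fix v assume v: "D v \<inter> cball \<xi> (min \<kappa> (\<eta> / 4)) \<noteq> {}"
    have "\<not> \<eta> / 4 \<le> r v"
    proof
      assume "\<eta> / 4 \<le> r v"
      hence "D v \<subseteq> ball 0 (1 - \<kappa>)" by (rule \<kappa>(2))
      moreover have "cball \<xi> (min \<kappa> (\<eta> / 4)) \<subseteq> cball \<xi> \<kappa>" by (rule subset_cball) simp
      ultimately show False using v cball_boundary_disjoint[OF assms(1), of \<kappa>] by blast
    qed
    hence rv: "r v < \<eta> / 4" by simp
    obtain p where p: "dist (ctr v) p \<le> r v" "dist \<xi> p \<le> \<eta> / 4" using v by auto
    show "D v \<subseteq> ball \<xi> \<eta>"
    proof
      fix z assume "z \<in> D v"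
      hence "dist (ctr v) z \<le> r v" by simp
      moreover have "dist \<xi> z \<le> dist \<xi> p + dist p (ctr v) + dist (ctr v) z"
        using dist_triangle[of \<xi> z p] dist_triangle[of p z "ctr v"] by linarith
      ultimately show "z \<in> ball \<xi> \<eta>" using p rv assms(2) by (simp add: dist_commute)
    qed
  qed (use \<kappa>(1) assms(2) in simp)
qed

section \<open>Crosscuts, the regions behind them, and annuli\<close>

definition cross :: "complex \<Rightarrow> real \<Rightarrow> 'v set" where
  "cross \<xi> s = {v. D v \<inter> sphere \<xi> s \<noteq> {}}"

definition behind :: "complex \<Rightarrow> real \<Rightarrow> 'v set" where
  "behind \<xi> s = {v. D v \<subseteq> ball \<xi> s}"

definition ann :: "complex \<Rightarrow> real \<Rightarrow> 'v set" where
  "ann \<xi> \<epsilon> = {v. \<exists>p\<in>D v. \<epsilon> \<le> dist \<xi> p \<and> dist \<xi> p \<le> 2 * \<epsilon>}"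

lemma cross_subset_ann: "s \<in> {\<epsilon>..2*\<epsilon>} \<Longrightarrow> cross \<xi> s \<subseteq> ann \<xi> \<epsilon>"
  unfolding cross_def ann_def by auto

lemma linked_cross:
  assumes "norm \<xi> = 1" "0 < s" "s < 1"
  shows "linked adj (cross \<xi> s)"
proof -
  have "cross \<xi> s = {v. D v \<inter> (sphere \<xi> s \<inter> ball 0 1) \<noteq> {}}" unfolding cross_def using D_subset by blast
  thus ?thesis using linked_discs[OF connected_circle_Int_disc(1)[OF assms]] by simp
qed

text \<open>A tangent disc reaches into the ball, and being connected it cannot also reach out of it
  without meeting the circle.\<close>

lemma behind_nbr:
  assumes "v \<in> behind \<xi> s" "adj v u"
  shows "u \<in> behind \<xi> s \<union> cross \<xi> s"
proof (cases "u \<in> cross \<xi> s")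
  case False
  obtain p where p: "p \<in> D v" "p \<in> D u" using adj_iff[OF adj_neq[OF assms(2)]] assms(2) by blast
  hence pb: "p \<in> D u \<inter> ball \<xi> s" using assms(1) unfolding behind_def by blast
  hence "0 < s" by (metis IntD2 ball_empty empty_iff not_less)
  have "D u \<subseteq> ball \<xi> s"
  proof (rule ccontr)
    assume "\<not> ?thesis"
    hence "D u \<inter> frontier (ball \<xi> s) \<noteq> {}"
      using pb by (intro connected_Int_frontier connected_cball) blast+
    thus False using False \<open>0 < s\<close> unfolding cross_def by simp
  qed
  thus ?thesis unfolding behind_def by blast
qed simp

text \<open>A disc much larger than \<open>\<epsilon>\<close> has too much area, but only
  \<open>\<epsilon>\<close> of the radii concern it. Each disc is therefore replaced by a disc of
  radius \<open>e v\<close>, at most \<open>\<epsilon> / 2\<close>, inside it and near one of its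
  points at distance at most \<open>2 * \<epsilon>\<close>. These are disjoint in a disc of radius
  \<open>3 * \<epsilon>\<close>, and \<open>36 = 4 * 3\<^sup>2\<close>.\<close>

lemma sum_ann_widths:
  assumes \<epsilon>: "0 < \<epsilon>" and F: "finite F" "F \<subseteq> ann \<xi> \<epsilon>"
  shows "(\<Sum>v\<in>F. (min (2 * r v) \<epsilon>)\<^sup>2) \<le> 36 * \<epsilon>\<^sup>2"
proof -
  define e where "e v = min (r v) (\<epsilon> / 2)" for v
  have e: "0 < e v" "e v \<le> r v" "e v \<le> \<epsilon> / 2" for v using r_pos[of v] \<epsilon> unfolding e_def by auto
  have "\<forall>v\<in>F. \<exists>p. p \<in> D v \<and> dist \<xi> p \<le> 2 * \<epsilon>" using F(2) unfolding ann_def by blast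
  from bchoice[OF this] obtain p where p: "\<And>v. v \<in> F \<Longrightarrow> p v \<in> D v \<and> dist \<xi> (p v) \<le> 2 * \<epsilon>" by blast
  \<comment> \<open>Moving from \<open>p v\<close> towards the centre by the proportion
    \<open>e v / r v\<close> puts the small disc into \<open>B v\<close> and keeps its centre within
    \<open>e v\<close> of \<open>p v\<close>.\<close>
  define q where "q v = p v + (e v / r v) *\<^sub>R (ctr v - p v)" for v
  have qB: "ball (q v) (e v) \<subseteq> B v" and qR: "ball (q v) (e v) \<subseteq> ball \<xi> (3 * \<epsilon>)" if v: "v \<in> F" for v
  proof -
    have pv: "norm (ctr v - p v) \<le> r v" using p[OF v] by (simp add: dist_norm)
    have "ctr v - q v = (1 - e v / r v) *\<^sub>R (ctr v - p v)" unfolding q_def by (simp add: algebra_simps)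
    hence "dist (ctr v) (q v) = (1 - e v / r v) * norm (ctr v - p v)"
      using e[of v] r_pos[of v] by (simp add: dist_norm)
    also have "\<dots> \<le> (1 - e v / r v) * r v" using pv e[of v] r_pos[of v] by (intro mult_left_mono) auto
    also have "\<dots> = r v - e v" using r_pos[of v] by (simp add: field_simps)
    finally have 1: "dist (ctr v) (q v) \<le> r v - e v" .
    have "dist (p v) (q v) = e v / r v * norm (ctr v - p v)"
      unfolding q_def using e[of v] r_pos[of v] by (simp add: dist_norm)
    also have "\<dots> \<le> e v / r v * r v" using pv e[of v] r_pos[of v] by (intro mult_left_mono) auto
    also have "\<dots> = e v" using r_pos[of v] by simp
    finally have 2: "dist (p v) (q v) \<le> e v" .
    show "ball (q v) (e v) \<subseteq> B v"
    proof
      fix z assume "z \<in> ball (q v) (e v)"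
      thus "z \<in> B v" using 1 dist_triangle[of "ctr v" z "q v"] by simp
    qed
    show "ball (q v) (e v) \<subseteq> ball \<xi> (3 * \<epsilon>)"
    proof
      fix z assume "z \<in> ball (q v) (e v)"
      thus "z \<in> ball \<xi> (3 * \<epsilon>)"
        using 2 e(3)[of v] p[OF v] dist_triangle[of \<xi> z "p v"] dist_triangle[of "p v" z "q v"] by simp
    qed
  qed
  have "(\<Sum>v\<in>F. (e v)\<^sup>2) \<le> (3 * \<epsilon>)\<^sup>2"
    using F(1)
  proof (rule sum_squares_radii_le[where q = q and z = \<xi>])
    fix i j assume "i \<in> F" "j \<in> F" "i \<noteq> j"
    thus "ball (q i) (e i) \<inter> ball (q j) (e j) = {}" using qB[of i] qB[of j] B_disjoint[of i j] by blast
  qed (use e qR \<epsilon> in \<open>auto intro: less_imp_le\<close>)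
  moreover have "min (2 * r v) \<epsilon> = 2 * e v" for v unfolding e_def by (simp add: min_def)
  hence "(\<Sum>v\<in>F. (min (2 * r v) \<epsilon>)\<^sup>2) = 4 * (\<Sum>v\<in>F. (e v)\<^sup>2)"
    by (simp add: power_mult_distrib sum_distrib_left)
  ultimately show ?thesis by (simp add: power_mult_distrib)
qed

text \<open>The radii at which a disc is hit fill at most \<open>min (2 * r v) \<epsilon>\<close>.
  Both sides of the length-area condition scale with \<open>\<epsilon>\<close>, so the threshold
  \<open>6 * sqrt A\<close> does not depend on it.\<close>

lemma light_crosscut:
  assumes \<epsilon>: "0 < \<epsilon>" and m0: "\<And>v. 0 \<le> m v"
    and A: "\<And>F. finite F \<Longrightarrow> F \<subseteq> ann \<xi> \<epsilon> \<Longrightarrow> (\<Sum>v\<in>F. (m v)\<^sup>2) \<le> A" and e: "6 * sqrt A < e"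
  obtains s where "s \<in> {\<epsilon>..2*\<epsilon>}" "\<And>F. finite F \<Longrightarrow> F \<subseteq> cross \<xi> s \<Longrightarrow> sum m F \<le> e"
proof -
  have sq: "sqrt (A * (36 * \<epsilon>\<^sup>2)) < e * \<epsilon>"
  proof -
    have "sqrt (36 * \<epsilon>\<^sup>2) = 6 * \<epsilon>" using \<epsilon> by (simp add: real_sqrt_mult)
    hence "sqrt (A * (36 * \<epsilon>\<^sup>2)) = (6 * sqrt A) * \<epsilon>" by (simp add: real_sqrt_mult)
    thus ?thesis using e \<epsilon> by simp
  qed
  have hit: "\<exists>l. \<forall>s\<in>{\<epsilon>..2*\<epsilon>}. v \<in> cross \<xi> s \<longrightarrow> l \<le> s \<and> s \<le> l + min (2 * r v) \<epsilon>" for v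
  proof (rule exI[of _ "max \<epsilon> (dist \<xi> (ctr v) - r v)"], intro ballI impI)
    fix s assume s: "s \<in> {\<epsilon>..2*\<epsilon>}" "v \<in> cross \<xi> s"
    then obtain p where "p \<in> D v" "p \<in> sphere \<xi> s" unfolding cross_def by blast
    hence "dist (ctr v) p \<le> r v" "dist \<xi> p = s" by simp_all
    hence "dist \<xi> (ctr v) - r v \<le> s" "s \<le> dist \<xi> (ctr v) + r v"
      using dist_triangle[of \<xi> p "ctr v"] dist_triangle[of \<xi> "ctr v" p] by (auto simp: dist_commute)
    thus "max \<epsilon> (dist \<xi> (ctr v) - r v) \<le> s \<and> s \<le> max \<epsilon> (dist \<xi> (ctr v) - r v) + min (2 * r v) \<epsilon>"
      using s(1) by auto
  qed
  obtain s where s: "s \<in> {\<epsilon>..2*\<epsilon>} - {}"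
    "\<And>F. finite F \<Longrightarrow> F \<subseteq> {v \<in> ann \<xi> \<epsilon>. v \<in> cross \<xi> s} \<Longrightarrow> sum m F \<le> e"
  proof (rule length_area[where X = "ann \<xi> \<epsilon>" and N = "{}" and m = m and d = "\<lambda>v. min (2 * r v) \<epsilon>"
        and hit = "\<lambda>v s. v \<in> cross \<xi> s" and A = A and B = "36 * \<epsilon>\<^sup>2" and c = e])
  qed (use \<epsilon> m0 A sq hit r_pos sum_ann_widths countable_V in \<open>auto intro: less_imp_le\<close>)
  show thesis
  proof (rule that)
    show "s \<in> {\<epsilon>..2*\<epsilon>}" using s(1) by simp
    fix F assume "finite F" "F \<subseteq> cross \<xi> s"
    thus "sum m F \<le> e" using s cross_subset_ann[of s \<epsilon> \<xi>] by blast
  qed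
qed

text \<open>The arc comes arbitrarily close to the unit circle, whereas the discs of
  \<open>F0\<close> and the interstices at them stay in a smaller disc. The arc point found near the
  unit circle may lie in an interstice; as the arc does not stay in a compact part of the disc, it
  meets one of the three discs around, none of which is in \<open>F0\<close>.\<close>

lemma cross_meets_cofinite:
  assumes \<xi>: "norm \<xi> = 1" and s: "0 < s" "s < 1" and F0: "finite F0"
  shows "\<exists>v\<in>cross \<xi> s. v \<notin> F0"
proof -
  define L where "L = sphere \<xi> s \<inter> ball 0 1"
  define G where "G = {(a, b, c). \<exists>F\<in>Faces. tface a b c F \<and> {a, b, c} \<inter> F0 \<noteq> {}}"
  define N where "N = F0 \<union> (\<Union>v\<in>F0. nbrs adj v)"
  have finN: "finite N" unfolding N_def using F0 fin_nbrs by blast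
  have "G \<subseteq> N \<times> N \<times> N"
  proof
    fix t assume "t \<in> G"
    then obtain a b c F where t: "t = (a, b, c)" "tface a b c F" "{a, b, c} \<inter> F0 \<noteq> {}" unfolding G_def by blast
    have "a \<in> N \<and> b \<in> N \<and> c \<in> N"
      using t(3) tface_facts(2-7)[OF t(2)] unfolding N_def nbrs_def by blast
    thus "t \<in> N \<times> N \<times> N" using t(1) by simp
  qed
  hence finG: "finite G" using finN by (meson finite_SigmaI finite_subset)
  define H where "H a b c = convex hull (tri_discs a b c)" for a b c
  have H: "compact (H a b c)" "gap a b c \<subseteq> H a b c" "H a b c \<subseteq> ball 0 1" for a b c
  proof -
    show "compact (H a b c)" unfolding H_def by (intro compact_convex_hull compact_Un compact_cball)
    have "tri_discs a b c \<subseteq> H a b c" unfolding H_def by (rule hull_subset)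
    moreover have "convex (H a b c)" unfolding H_def by (rule convex_convex_hull)
    ultimately show "gap a b c \<subseteq> H a b c" by (intro interstice_subset_convex) auto
    show "H a b c \<subseteq> ball 0 1" unfolding H_def using D_subset by (intro hull_minimal convex_ball Un_least)
  qed
  define K where "K = (\<Union>v\<in>F0. D v) \<union> (\<Union>(a, b, c)\<in>G. H a b c)"
  have "compact K" unfolding K_def
    using F0 finG H(1) by (intro compact_Un compact_UN) auto
  moreover have "K \<subseteq> ball 0 1" unfolding K_def using D_subset H(3) by blast
  ultimately obtain \<kappa> where \<kappa>: "0 < \<kappa>" "\<kappa> < 1" "K \<subseteq> ball 0 (1 - \<kappa>)" using compact_in_smaller_ball by metis
  obtain x where x: "x \<in> L" "x \<notin> ball 0 (1 - \<kappa>)"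
    using connected_circle_Int_disc(2)[OF \<xi> s \<kappa>(1,2)] unfolding L_def by blast
  hence xK: "x \<notin> K" and x1: "x \<in> ball 0 1" using \<kappa>(3) unfolding L_def by blast+
  show ?thesis
  proof (rule carrier_cases[OF x1])
    fix v assume "x \<in> D v"
    hence "v \<in> cross \<xi> s" "v \<notin> F0" using x(1) xK unfolding cross_def L_def K_def by blast+
    thus ?thesis by blast
  next
    fix F a b c assume F: "F \<in> Faces" "tface a b c F" "x \<in> gap a b c"
    have "(a, b, c) \<notin> G" using F(3) H(2) xK unfolding K_def by blast
    hence nF0: "{a, b, c} \<inter> F0 = {}" using F unfolding G_def by blast
    have "L \<inter> tri_discs a b c \<noteq> {}"
    proof
      assume "L \<inter> tri_discs a b c = {}"
      hence "L \<subseteq> gap a b c"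
        using connected_subset_gap[OF connected_circle_Int_disc(1)[OF \<xi> s, folded L_def]] x(1) F(3) by blast
      hence "L \<subseteq> H a b c" using H(2) by blast
      moreover obtain \<kappa>' where \<kappa>': "0 < \<kappa>'" "\<kappa>' < 1" "H a b c \<subseteq> ball 0 (1 - \<kappa>')"
        using compact_in_smaller_ball[OF H(1,3)] by metis
      moreover obtain x' where "x' \<in> L" "x' \<notin> ball 0 (1 - \<kappa>')"
        using connected_circle_Int_disc(2)[OF \<xi> s \<kappa>'(1,2)] unfolding L_def by blast
      ultimately show False by blast
    qed
    then obtain u where "u \<in> {a, b, c}" "D u \<inter> L \<noteq> {}" by blast
    hence "u \<in> cross \<xi> s" "u \<notin> F0" using nF0 unfolding cross_def L_def by blast+
    thus ?thesis by blast
  qed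
qed

text \<open>The next scale \<open>e\<close> is so small that discs meeting the ball of radius
  \<open>2 * e\<close> are contained in the ball whose radius is the least previous scale.\<close>

lemma sparse_annuli:
  assumes \<xi>: "norm \<xi> = 1" and "0 < \<delta>"
  shows "\<exists>\<epsilon> :: nat \<Rightarrow> real. (\<forall>k<N. 0 < \<epsilon> k \<and> \<epsilon> k \<le> \<delta>) \<and> (\<forall>i<N. \<forall>j<N. i \<noteq> j \<longrightarrow> ann \<xi> (\<epsilon> i) \<inter> ann \<xi> (\<epsilon> j) = {})"
proof (induction N)
  case 0
  show ?case by simp
next
  case (Suc N)
  then obtain \<epsilon> where \<epsilon>: "\<And>k. k < N \<Longrightarrow> 0 < \<epsilon> k \<and> \<epsilon> k \<le> \<delta>"
    "\<And>i j. i < N \<Longrightarrow> j < N \<Longrightarrow> i \<noteq> j \<Longrightarrow> ann \<xi> (\<epsilon> i) \<inter> ann \<xi> (\<epsilon> j) = {}" by blast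
  define \<eta> where "\<eta> = Min (insert \<delta> (\<epsilon> ` {..<N}))"
  have "\<eta> \<in> insert \<delta> (\<epsilon> ` {..<N})" unfolding \<eta>_def by (intro Min_in) auto
  hence \<eta>: "0 < \<eta>" using \<epsilon>(1) \<open>0 < \<delta>\<close> by auto
  have \<eta>le: "\<eta> \<le> \<delta>" "\<And>k. k < N \<Longrightarrow> \<eta> \<le> \<epsilon> k" unfolding \<eta>_def by (auto intro: Min_le)
  obtain \<delta>' where \<delta>': "0 < \<delta>'" "\<And>v. D v \<inter> cball \<xi> \<delta>' \<noteq> {} \<Longrightarrow> D v \<subseteq> ball \<xi> \<eta>"
    using discs_near_boundary_small[OF \<xi> \<eta>] by blast
  define e where "e = min \<delta> (\<delta>' / 2)"
  have e: "0 < e" "e \<le> \<delta>" "2 * e \<le> \<delta>'" unfolding e_def using \<open>0 < \<delta>\<close> \<delta>' by auto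
  have dj: "ann \<xi> e \<inter> ann \<xi> (\<epsilon> k) = {}" if "k < N" for k
  proof (rule ccontr)
    assume "\<not> ?thesis"
    then obtain v p q where v: "p \<in> D v" "dist \<xi> p \<le> 2 * e" "q \<in> D v" "\<epsilon> k \<le> dist \<xi> q"
      unfolding ann_def by blast
    have "p \<in> cball \<xi> \<delta>'" using v(2) e(3) by simp
    hence "D v \<subseteq> ball \<xi> \<eta>" using \<delta>'(2)[of v] v(1) by blast
    hence "dist \<xi> q < \<eta>" using v(3) by auto
    thus False using v(4) \<eta>le(2)[OF that] by simp
  qed
  have "\<And>k. k < Suc N \<Longrightarrow> 0 < (\<epsilon>(N := e)) k \<and> (\<epsilon>(N := e)) k \<le> \<delta>"
    using \<epsilon>(1) e by (auto simp: less_Suc_eq)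
  moreover have "ann \<xi> ((\<epsilon>(N := e)) i) \<inter> ann \<xi> ((\<epsilon>(N := e)) j) = {}" if "i < Suc N" "j < Suc N" "i \<noteq> j" for i j
    using \<epsilon>(2)[of i j] dj[of i] dj[of j] that by (cases "i = N"; cases "j = N") (auto simp: less_Suc_eq Int_commute)
  ultimately show ?case by blast
qed

text \<open>Each \<^term>\<open>hp n\<close> vanishes somewhere on every crosscut and its energy is bounded uniformly
  in \<^term>\<open>n\<close>, so among many disjoint annuli one carries a crosscut on which it is small.\<close>

lemma hp_small_near_boundary:
  assumes \<xi>: "norm \<xi> = 1" and "0 < e"
  obtains \<delta> where "0 < \<delta>" "\<And>n v. D v \<subseteq> ball \<xi> \<delta> \<Longrightarrow> hp n v \<le> e"
proof -
  define C where "C = 4 * M\<^sup>2 * E0"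
  have C0: "0 < C" unfolding C_def using M0 E0_pos by simp
  \<comment> \<open>At least one of \<open>N\<close> disjoint annuli carries no more than
    \<open>C / N\<close> of the total, and six times the root of this is less than
    \<open>e\<close>.\<close>
  obtain N :: nat where N: "C / (e / 6)\<^sup>2 < N" using reals_Archimedean2 by blast
  have Npos: "0 < real N" using N C0 \<open>0 < e\<close> by (smt (verit) divide_nonneg_nonneg zero_le_power2)
  have "C / N < (e / 6)\<^sup>2" using N Npos \<open>0 < e\<close> by (simp add: field_simps)
  hence "sqrt (C / N) < e / 6" using \<open>0 < e\<close> by (intro real_less_lsqrt) auto
  hence small: "6 * sqrt (C / N) < e" by simp
  obtain \<kappa> where \<kappa>: "0 < \<kappa>" "\<kappa> < 1" "\<forall>v\<in>{\<rho>}. D v \<subseteq> ball 0 (1 - \<kappa>)"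
    using finite_discs_margin[of "{\<rho>}"] by blast
  have "0 < \<kappa> / 4" using \<kappa>(1) by simp
  then obtain \<epsilon> where \<epsilon>: "\<And>k. k < N \<Longrightarrow> 0 < \<epsilon> k \<and> \<epsilon> k \<le> \<kappa> / 4"
    "\<And>i j. i < N \<Longrightarrow> j < N \<Longrightarrow> i \<noteq> j \<Longrightarrow> ann \<xi> (\<epsilon> i) \<inter> ann \<xi> (\<epsilon> j) = {}"
    using sparse_annuli[OF \<xi>, of "\<kappa> / 4" N] by blast
  define \<delta> where "\<delta> = Min (\<epsilon> ` {..<N})"
  have "\<delta> \<in> \<epsilon> ` {..<N}" unfolding \<delta>_def using Npos by (intro Min_in) auto
  hence \<delta>0: "0 < \<delta>" using \<epsilon>(1) by auto
  have \<delta>le: "\<delta> \<le> \<epsilon> k" if "k < N" for k unfolding \<delta>_def using that by (intro Min_le) auto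
  have "hp n v \<le> e" if v: "D v \<subseteq> ball \<xi> \<delta>" for n v
  proof -
    define m where "m w = 2 * M * grad (hp n) w" for w
    have m0: "0 \<le> m w" for w unfolding m_def using M0 grad_nonneg by simp
    have tot: "(\<Sum>w\<in>F. (m w)\<^sup>2) \<le> C" if "finite F" for F
    proof -
      have "(\<Sum>w\<in>F. (m w)\<^sup>2) = 4 * M\<^sup>2 * (\<Sum>w\<in>F. (grad (hp n) w)\<^sup>2)"
        unfolding m_def by (simp add: power_mult_distrib sum_distrib_left)
      also have "\<dots> \<le> C" unfolding C_def using grad_hp_sum[OF that that] by (intro mult_left_mono) auto
      finally show ?thesis .
    qed
    have "\<exists>k<N. \<forall>F. finite F \<and> F \<subseteq> ann \<xi> (\<epsilon> k) \<longrightarrow> (\<Sum>w\<in>F. (m w)\<^sup>2) \<le> C / N"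
    proof (rule ccontr)
      assume "\<not> ?thesis"
      hence "\<forall>k. \<exists>F. k < N \<longrightarrow> finite F \<and> F \<subseteq> ann \<xi> (\<epsilon> k) \<and> C / N < (\<Sum>w\<in>F. (m w)\<^sup>2)"
        by (meson not_le)
      from choice[OF this] obtain F where
        F: "\<And>k. k < N \<Longrightarrow> finite (F k) \<and> F k \<subseteq> ann \<xi> (\<epsilon> k) \<and> C / N < (\<Sum>w\<in>F k. (m w)\<^sup>2)" by blast
      have "C = (\<Sum>k<N. C / N)" using Npos by simp
      also have "\<dots> < (\<Sum>k<N. \<Sum>w\<in>F k. (m w)\<^sup>2)" using F Npos by (intro sum_strict_mono) auto
      also have "\<dots> = (\<Sum>w\<in>(\<Union>k<N. F k). (m w)\<^sup>2)"
      proof (rule sum.UNION_disjoint[symmetric])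
        show "\<forall>i\<in>{..<N}. \<forall>j\<in>{..<N}. i \<noteq> j \<longrightarrow> F i \<inter> F j = {}"
        proof (intro ballI impI)
          fix i j assume "i \<in> {..<N}" "j \<in> {..<N}" "i \<noteq> j"
          thus "F i \<inter> F j = {}" using F[of i] F[of j] \<epsilon>(2)[of i j] by auto
        qed
      qed (use F in auto)
      also have "\<dots> \<le> C" using F by (intro tot) auto
      finally show False by simp
    qed
    then obtain k where k: "k < N" "\<And>F. finite F \<Longrightarrow> F \<subseteq> ann \<xi> (\<epsilon> k) \<Longrightarrow> (\<Sum>w\<in>F. (m w)\<^sup>2) \<le> C / N" by blast
    have \<epsilon>k: "0 < \<epsilon> k" "\<epsilon> k \<le> \<kappa> / 4" using \<epsilon>(1)[OF k(1)] by auto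
    obtain s where s: "s \<in> {\<epsilon> k..2 * \<epsilon> k}" "\<And>F. finite F \<Longrightarrow> F \<subseteq> cross \<xi> s \<Longrightarrow> sum m F \<le> e"
      using light_crosscut[OF \<epsilon>k(1) m0 k(2) small] by blast
    have s01: "0 < s" "s < 1" "s \<le> \<kappa>" using s(1) \<epsilon>k \<kappa>(1,2) by auto
    obtain w where w: "w \<in> cross \<xi> s" "hp n w = 0"
      using cross_meets_cofinite[OF \<xi> s01(1,2) finite_hp_support[of n]] by blast
    have crossle: "hp n u \<le> e" if u: "u \<in> cross \<xi> s" for u
    proof -
      have "dist (hp n u) (hp n w) \<le> e"
      \<comment> \<open>The intervals around the values at adjacent vertices overlap because
        \<open>M * grad\<close> dominates the increment; \<open>m\<close> is their length.\<close>
      proof (rule linked_dist_le[OF linked_cross[OF \<xi> s01(1,2)], where K = "\<lambda>v. cball (hp n v) (M * grad (hp n) v)" and d = m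
            and i = u and j = w])
        fix i j assume "adj i j"
        hence "hp n j \<in> cball (hp n i) (M * grad (hp n) i)" using diff_le_grad by (simp add: dist_real_def)
        moreover have "hp n j \<in> cball (hp n j) (M * grad (hp n) j)" using M0 grad_nonneg by simp
        ultimately show "cball (hp n i) (M * grad (hp n) i) \<inter> cball (hp n j) (M * grad (hp n) j) \<noteq> {}" by blast
      next
        fix i x y assume "x \<in> cball (hp n i) (M * grad (hp n) i)" "y \<in> cball (hp n i) (M * grad (hp n) i)"
        thus "dist x y \<le> m i" unfolding m_def using dist_triangle2[of x y "hp n i"] by (simp add: dist_commute)
      qed (use m0 s(2) u w(1) M0 grad_nonneg in auto)
      thus ?thesis using w(2) by (simp add: dist_real_def)
    qed
    have "v \<in> behind \<xi> s"
      using v \<delta>le[OF k(1)] s(1) unfolding behind_def by (auto intro: order.trans[OF _ subset_ball])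
    moreover have "\<rho> \<notin> behind \<xi> s"
    proof
      assume "\<rho> \<in> behind \<xi> s"
      hence "ctr \<rho> \<in> ball \<xi> s" unfolding behind_def using centre_in_D by blast
      hence "ctr \<rho> \<in> cball \<xi> \<kappa>" using s01(3) by simp
      moreover have "ctr \<rho> \<in> ball 0 (1 - \<kappa>)" using \<kappa>(3) centre_in_D[of \<rho>] by blast
      ultimately show False using cball_boundary_disjoint[OF \<xi>] by blast
    qed
    ultimately show ?thesis
      using max_principle[of "behind \<xi> s" "cross \<xi> s" n e v] behind_nbr crossle \<open>0 < e\<close> by auto
  qed
  thus thesis using that \<delta>0 by blast
qed

text \<open>The bound on \<open>hp\<close> near \<open>\<xi>\<close> is uniform in time, so it
  passes to the limit \<open>1 - y\<close>.\<close>

lemma y_tendsto_1: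
  assumes \<xi>: "norm \<xi> = 1" and lim: "(\<lambda>n. ctr (vs n)) \<longlonglongrightarrow> \<xi>"
  shows "(\<lambda>n. y (vs n)) \<longlonglongrightarrow> 1"
proof (rule LIMSEQ_I)
  fix e :: real assume "0 < e"
  obtain \<delta> where \<delta>: "0 < \<delta>" "\<And>n v. D v \<subseteq> ball \<xi> \<delta> \<Longrightarrow> hp n v \<le> e / 2"
    using hp_small_near_boundary[OF \<xi>, of "e / 2"] \<open>0 < e\<close> by auto
  obtain \<delta>' where \<delta>': "0 < \<delta>'" "\<And>v. D v \<inter> cball \<xi> \<delta>' \<noteq> {} \<Longrightarrow> D v \<subseteq> ball \<xi> \<delta>"
    using discs_near_boundary_small[OF \<xi> \<delta>(1)] by blast
  obtain N where N: "\<And>n. N \<le> n \<Longrightarrow> dist (ctr (vs n)) \<xi> < \<delta>'"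
    using lim \<delta>'(1) unfolding lim_sequentially by blast
  have "norm (y (vs n) - 1) < e" if "N \<le> n" for n
  proof -
    have "ctr (vs n) \<in> D (vs n) \<inter> cball \<xi> \<delta>'" using N[OF that] by (intro IntI centre_in_D) (simp add: dist_commute)
    hence "D (vs n) \<subseteq> ball \<xi> \<delta>" using \<delta>'(2) by blast
    hence "hp k (vs n) \<le> e / 2" for k by (rule \<delta>(2))
    hence "1 - y (vs n) \<le> e / 2" by (intro LIMSEQ_le_const2[OF hp_tendsto]) auto
    thus ?thesis using y_lt_1[of "vs n"] \<open>0 < e\<close> by simp
  qed
  thus "\<exists>N. \<forall>n\<ge>N. norm (y (vs n) - 1) < e" by blast
qed

lemma infinite_accumulates_at_boundary:
  assumes "infinite A"
  obtains vs :: "nat \<Rightarrow> 'v" and \<xi> where "range vs \<subseteq> A" "norm \<xi> = 1" "(\<lambda>n. ctr (vs n)) \<longlonglongrightarrow> \<xi>"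
proof -
  obtain vs :: "nat \<Rightarrow> 'v" where vs: "inj vs" "range vs \<subseteq> A"
    using infinite_countable_subset[OF assms] by blast
  have "range (ctr \<circ> vs) \<subseteq> cball 0 1" using D_subset centre_in_D ball_subset_cball by fastforce
  then obtain p f where pf: "p \<in> cball 0 1" "strict_mono f" "((ctr \<circ> vs) \<circ> f) \<longlonglongrightarrow> p"
    using compact_cball[of 0 1, unfolded compact_def, rule_format, of "ctr \<circ> vs"] by fastforce
  hence lim: "(\<lambda>n. ctr (vs (f n))) \<longlonglongrightarrow> p" by (simp add: o_def)
  have injf: "inj (\<lambda>n. vs (f n))" using inj_compose[OF vs(1) strict_mono_imp_inj_on[OF pf(2)]] by (simp add: o_def)
  have "norm p = 1"
  proof (rule ccontr)
    assume "norm p \<noteq> 1"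
    hence "p \<in> ball 0 1" using pf(1) by simp
    then obtain e where e: "0 < e" "finite {v. ctr v \<in> ball p e}" using centres_locally_finite by blast
    obtain N where N: "\<And>n. N \<le> n \<Longrightarrow> dist (ctr (vs (f n))) p < e"
      using lim e(1) unfolding lim_sequentially by blast
    have "(\<lambda>n. vs (f n)) ` {N..} \<subseteq> {v. ctr v \<in> ball p e}" using N by (auto simp: dist_commute)
    hence "finite ((\<lambda>n. vs (f n)) ` {N..})" using e(2) finite_subset by blast
    hence "finite {N..}" using injf by (metis finite_imageD inj_on_subset subset_UNIV)
    thus False by (simp add: infinite_Ici)
  qed
  moreover have "range (\<lambda>n. vs (f n)) \<subseteq> A" using vs(2) by blast
  ultimately show thesis using that lim by blast
qed

text \<open>Infinitely many vertices have centres accumulating at the unit circle, where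
  \<open>y\<close> tends to 1. This finiteness lets descending paths terminate.\<close>

lemma finite_y_le:
  assumes "t < 1"
  shows "finite {v. y v \<le> t}"
proof (rule ccontr)
  assume "infinite {v. y v \<le> t}"
  then obtain vs :: "nat \<Rightarrow> 'v" and \<xi> where vs: "range vs \<subseteq> {v. y v \<le> t}" "norm \<xi> = 1" "(\<lambda>n. ctr (vs n)) \<longlonglongrightarrow> \<xi>"
    by (rule infinite_accumulates_at_boundary)
  have "1 \<le> t" by (rule LIMSEQ_le_const2[OF y_tendsto_1[OF vs(2,3)]]) (use vs(1) in auto)
  thus False using assms by simp
qed

lemma finite_centres:
  assumes "t < 1"
  shows "finite {v. norm (ctr v) \<le> t}"
proof (rule ccontr)
  assume "infinite {v. norm (ctr v) \<le> t}"
  then obtain vs :: "nat \<Rightarrow> 'v" and \<xi> where vs: "range vs \<subseteq> {v. norm (ctr v) \<le> t}" "norm \<xi> = 1" "(\<lambda>n. ctr (vs n)) \<longlonglongrightarrow> \<xi>"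
    by (rule infinite_accumulates_at_boundary)
  have "norm \<xi> \<le> t" by (rule LIMSEQ_le_const2[OF tendsto_norm[OF vs(3)]]) (use vs(1) in auto)
  thus False using assms vs(2) by simp
qed

end

section \<open>The rectangle tiling\<close>

lemma per_iff: "x \<in> per \<eta> J \<longleftrightarrow> (\<exists>k::int. x + of_int k * \<eta> \<in> J)"
  unfolding per_def by simp

lemma per_shift: "x + of_int k * \<eta> \<in> per \<eta> J \<longleftrightarrow> x \<in> per \<eta> J"
proof
  assume "x + of_int k * \<eta> \<in> per \<eta> J"
  then obtain l where "x + of_int k * \<eta> + of_int l * \<eta> \<in> J" unfolding per_iff by blast
  hence "x + of_int (k + l) * \<eta> \<in> J" by (simp add: algebra_simps)
  thus "x \<in> per \<eta> J" unfolding per_iff by blast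
next
  assume "x \<in> per \<eta> J"
  then obtain l where "x + of_int l * \<eta> \<in> J" unfolding per_iff by blast
  hence "x + of_int k * \<eta> + of_int (l - k) * \<eta> \<in> J" by (simp add: algebra_simps)
  thus "x + of_int k * \<eta> \<in> per \<eta> J" unfolding per_iff by blast
qed

lemma subset_per: "J \<subseteq> per \<eta> J"
  unfolding per_iff subset_iff by (metis add.right_neutral mult_zero_left of_int_0)

lemma to_circle_shift:
  assumes "\<eta> \<noteq> 0"
  shows "to_circle \<eta> (x + of_int k * \<eta>) = to_circle \<eta> x"
proof -
  have "2 * pi * (x + of_int k * \<eta>) / \<eta> = 2 * pi * x / \<eta> + 2 * pi * of_int k"
    using assms by (simp add: field_simps)
  thus ?thesis unfolding to_circle_def by (simp add: cis_mult[symmetric] cis_multiple_2pi)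
qed

lemma to_circle_eq_iff:
  assumes "\<eta> \<noteq> 0"
  shows "to_circle \<eta> x = to_circle \<eta> x' \<longleftrightarrow> (\<exists>k::int. x = x' + of_int k * \<eta>)"
proof
  assume "to_circle \<eta> x = to_circle \<eta> x'"
  hence "sin (2 * pi * x / \<eta>) = sin (2 * pi * x' / \<eta>) \<and> cos (2 * pi * x / \<eta>) = cos (2 * pi * x' / \<eta>)"
    unfolding to_circle_def by (simp add: complex_eq_iff)
  then obtain n :: int where n: "2 * pi * x / \<eta> = 2 * pi * x' / \<eta> + 2 * pi * of_int n"
    using sin_cos_eq_iff by metis
  have "2 * pi * x = (2 * pi * x / \<eta>) * \<eta>" using assms by simp
  also have "\<dots> = 2 * pi * (x' + of_int n * \<eta>)" unfolding n using assms by (simp add: field_simps)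
  finally have "x = x' + of_int n * \<eta>" by simp
  thus "\<exists>k::int. x = x' + of_int k * \<eta>" by blast
qed (use to_circle_shift[OF assms] in auto)

lemma to_circle_image_per:
  assumes "\<eta> \<noteq> 0"
  shows "to_circle \<eta> ` per \<eta> J = to_circle \<eta> ` J"
proof
  show "to_circle \<eta> ` per \<eta> J \<subseteq> to_circle \<eta> ` J"
  proof
    fix w assume "w \<in> to_circle \<eta> ` per \<eta> J"
    then obtain x where "w = to_circle \<eta> x" "x \<in> per \<eta> J" by blast
    moreover from this obtain k :: int where "x + of_int k * \<eta> \<in> J" unfolding per_iff by blast
    ultimately have "w = to_circle \<eta> x" "x + of_int k * \<eta> \<in> J" by simp_all
    thus "w \<in> to_circle \<eta> ` J" using to_circle_shift[OF assms] by (metis imageI)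
  qed
  show "to_circle \<eta> ` J \<subseteq> to_circle \<eta> ` per \<eta> J" using subset_per by blast
qed

lemma continuous_on_to_circle: "\<eta> \<noteq> 0 \<Longrightarrow> continuous_on A (to_circle \<eta>)"
  unfolding to_circle_def by (intro continuous_intros) simp

lemma norm_to_circle [simp]: "norm (to_circle \<eta> x) = 1"
  by (simp add: to_circle_def)

lemma dist_to_circle_sq: "(dist (to_circle \<eta> x) (to_circle \<eta> x'))\<^sup>2 = 2 - 2 * cos (2 * pi * (x - x') / \<eta>)"
proof -
  have d: "(dist (cis s) (cis t))\<^sup>2 = 2 - 2 * cos (s - t)" for s t
  proof -
    have "(dist (cis s) (cis t))\<^sup>2 = (cos s - cos t)\<^sup>2 + (sin s - sin t)\<^sup>2"
      by (simp add: dist_norm cmod_power2)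
    also have "\<dots> = ((sin s)\<^sup>2 + (cos s)\<^sup>2) + ((sin t)\<^sup>2 + (cos t)\<^sup>2) - 2 * (cos s * cos t + sin s * sin t)"
      by (simp add: power2_eq_square algebra_simps)
    finally show ?thesis by (simp add: cos_diff)
  qed
  have "2 * pi * (x - x') / \<eta> = 2 * pi * x / \<eta> - 2 * pi * x' / \<eta>" by (simp add: diff_divide_distrib right_diff_distrib)
  thus ?thesis unfolding to_circle_def by (simp add: d)
qed

lemma dist_to_circle_le:
  assumes "0 < \<eta>"
  shows "dist (to_circle \<eta> x) (to_circle \<eta> x') \<le> 2 * pi / \<eta> * \<bar>x - x'\<bar>"
proof -
  define t where "t = 2 * pi * (x - x') / \<eta>"
  have "2 - 2 * cos t = (2 * sin (t / 2))\<^sup>2" using cos_double_sin[of "t / 2"] by (simp add: power2_eq_square)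
  hence "dist (to_circle \<eta> x) (to_circle \<eta> x') = \<bar>2 * sin (t / 2)\<bar>"
    using dist_to_circle_sq[of \<eta> x x'] unfolding t_def by (metis real_sqrt_abs abs_of_nonneg zero_le_dist)
  also have "\<dots> \<le> 2 * \<bar>t / 2\<bar>" using abs_sin_x_le_abs_x[of "t / 2"] by (simp add: abs_mult)
  also have "\<dots> = 2 * pi / \<eta> * \<bar>x - x'\<bar>" unfolding t_def using assms by (simp add: abs_mult)
  finally show ?thesis .
qed

text \<open>Rounding chooses the lift whose difference \<open>d\<close> from \<open>p\<close>
  satisfies \<open>\<bar>d\<bar> \<le> \<eta> / 2\<close>, a range in which the chord grows with
  \<open>\<bar>d\<bar>\<close>; \<open>e\<close> is the chord over an arc of length
  \<open>min s (\<eta> / 2)\<close>.\<close>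

lemma to_circle_near:
  assumes \<eta>: "0 < \<eta>" and "0 < s"
  obtains e where "0 < e" "\<And>x. dist (to_circle \<eta> x) (to_circle \<eta> p) < e \<Longrightarrow> \<exists>k::int. \<bar>x + of_int k * \<eta> - p\<bar> < s"
proof -
  define s' where "s' = min s (\<eta> / 2)"
  have s': "0 < s'" "s' \<le> s" "s' \<le> \<eta> / 2" unfolding s'_def using assms by auto
  define \<phi> where "\<phi> = 2 * pi * s' / \<eta>"
  have \<phi>: "0 < \<phi>" "\<phi> \<le> pi" unfolding \<phi>_def using s' \<eta> by (auto simp: field_simps)
  have "cos \<phi> < cos 0" using \<phi> by (intro cos_monotone_0_pi) auto
  hence c1: "cos \<phi> < 1" by simp
  show thesis
  proof (rule that[of "sqrt (2 - 2 * cos \<phi>)"])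
    fix x assume lt: "dist (to_circle \<eta> x) (to_circle \<eta> p) < sqrt (2 - 2 * cos \<phi>)"
    define k where "k = - round ((x - p) / \<eta>)"
    define d where "d = x + of_int k * \<eta> - p"
    have "\<bar>of_int (round ((x - p) / \<eta>)) - (x - p) / \<eta>\<bar> \<le> 1 / 2" by (rule of_int_round_abs_le)
    moreover have "of_int (round ((x - p) / \<eta>)) - (x - p) / \<eta> = - d / \<eta>"
      unfolding d_def k_def using \<eta> by (simp add: field_simps)
    ultimately have dle: "\<bar>d\<bar> \<le> \<eta> / 2" using \<eta> by (simp add: field_simps)
    have "\<bar>d\<bar> < s"
    proof (rule ccontr)
      assume "\<not> \<bar>d\<bar> < s"
      hence ge: "s' \<le> \<bar>d\<bar>" using s' by simp
      have "2 * pi * \<bar>d\<bar> / \<eta> \<le> pi" using dle \<eta> by (simp add: field_simps)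
      moreover have "\<phi> \<le> 2 * pi * \<bar>d\<bar> / \<eta>" unfolding \<phi>_def using ge \<eta> by (simp add: divide_right_mono)
      ultimately have "cos (2 * pi * \<bar>d\<bar> / \<eta>) \<le> cos \<phi>" using \<phi> by (intro cos_monotone_0_pi_le) auto
      also have "2 * pi * \<bar>d\<bar> / \<eta> = \<bar>2 * pi * d / \<eta>\<bar>" using \<eta> by (simp add: abs_mult)
      also have "cos \<dots> = cos (2 * pi * d / \<eta>)" by (rule cos_abs_real)
      finally have "2 - 2 * cos \<phi> \<le> (dist (to_circle \<eta> (x + of_int k * \<eta>)) (to_circle \<eta> p))\<^sup>2"
        unfolding dist_to_circle_sq d_def by simp
      hence "sqrt (2 - 2 * cos \<phi>) \<le> dist (to_circle \<eta> (x + of_int k * \<eta>)) (to_circle \<eta> p)"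
        by (intro real_le_lsqrt) auto
      thus False using lt to_circle_shift[of \<eta> x k] \<eta> by simp
    qed
    thus "\<exists>k::int. \<bar>x + of_int k * \<eta> - p\<bar> < s" unfolding d_def by blast
  qed (use c1 in simp)
qed

lemma closed_per_interval:
  assumes "0 < \<eta>"
  shows "closed (per \<eta> {s..t})"
proof -
  have "per \<eta> {s..t} = to_circle \<eta> -` (to_circle \<eta> ` {s..t})"
  proof
    show "per \<eta> {s..t} \<subseteq> to_circle \<eta> -` (to_circle \<eta> ` {s..t})"
      using to_circle_image_per[of \<eta> "{s..t}"] assms by blast
    show "to_circle \<eta> -` (to_circle \<eta> ` {s..t}) \<subseteq> per \<eta> {s..t}"
    proof
      fix x assume "x \<in> to_circle \<eta> -` (to_circle \<eta> ` {s..t})"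
      then obtain x' where x': "to_circle \<eta> x' = to_circle \<eta> x" "x' \<in> {s..t}" by auto
      then obtain k :: int where "x' = x + of_int k * \<eta>" using to_circle_eq_iff[of \<eta> x' x] assms by auto
      thus "x \<in> per \<eta> {s..t}" using x'(2) unfolding per_iff by blast
    qed
  qed
  moreover have "closed (to_circle \<eta> ` {s..t})"
    using assms by (intro compact_imp_closed compact_continuous_image continuous_on_to_circle) auto
  ultimately show ?thesis
    using continuous_on_to_circle[of \<eta> UNIV] assms by (metis closed_vimage less_irrefl)
qed

locale tiled_network = packed_network adj c \<rho> M pos ep ctr r
  for adj :: "'v \<Rightarrow> 'v \<Rightarrow> bool" and c :: "'v \<Rightarrow> 'v \<Rightarrow> real" and \<rho> :: 'v and M :: real
    and pos :: "'v \<Rightarrow> complex" and ep :: "'v \<Rightarrow> 'v \<Rightarrow> real \<Rightarrow> complex"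
    and ctr :: "'v \<Rightarrow> complex" and r :: "'v \<Rightarrow> real" +
  fixes a :: "'v \<Rightarrow> 'v \<Rightarrow> real"
  assumes trans: "transient adj c \<rho>" and tiling: "rectangle_tiling adj c \<rho> pos ep a"
begin

abbreviation "\<eta> \<equiv> eta adj c \<rho>"
abbreviation "I \<equiv> tile_I adj c \<rho> a"
abbreviation "S \<equiv> tile_S adj c \<rho> a"
abbreviation "Iv \<equiv> tile_Iv adj c \<rho> a"
abbreviation "\<Phi> \<equiv> to_circle \<eta>"
abbreviation "len u v \<equiv> c u v * (y v - y u)"

lemma \<eta>_pos: "0 < \<eta>" by (rule eta_pos[OF trans])

lemma tile_interiors_disjoint:
  "adj u v \<Longrightarrow> adj u' v' \<Longrightarrow> {u, v} \<noteq> {u', v'} \<Longrightarrow> interior (S u v) \<inter> interior (S u' v') = {}"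
  using tiling unfolding rectangle_tiling_def by (elim conjE) simp

lemma tiles_cover: "\<Union>{S u v | u v. adj u v} = UNIV \<times> {0..<1}"
  using tiling unfolding rectangle_tiling_def by (elim conjE)

lemma Iv_circle_interval: "circle_interval \<eta> (Iv v)"
  using tiling unfolding rectangle_tiling_def by (elim conjE) simp

lemma Iv_eq_in: "v \<noteq> \<rho> \<Longrightarrow> Iv v = tile_Iv_in adj c \<rho> a v"
  using tiling unfolding rectangle_tiling_def by (elim conjE) simp

lemma vsides_common_face:
  "adj u v \<Longrightarrow> adj u' v' \<Longrightarrow> tile_vsides adj c \<rho> a u v \<inter> tile_vsides adj c \<rho> a u' v' \<noteq> {}
    \<Longrightarrow> common_face adj pos ep u v u' v'"
  using tiling unfolding rectangle_tiling_def by (elim conjE) simp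

lemma I_eq: "I u v = per \<eta> {a u v..a u v + len u v}"
  by (simp add: tile_I_def)

lemma len_nonneg: "adj u v \<Longrightarrow> y u \<le> y v \<Longrightarrow> 0 \<le> len u v"
  using c_pos[of u v] by simp

lemma len_pos: "adj u v \<Longrightarrow> y u < y v \<Longrightarrow> 0 < len u v"
  using c_pos[of u v] by simp

lemma a_in_I: "adj u v \<Longrightarrow> y u \<le> y v \<Longrightarrow> a u v \<in> I u v"
  using len_nonneg[of u v] subset_per[of "{a u v..a u v + len u v}" \<eta>] unfolding I_eq by auto

lemma I_subset_Iv: "adj v w \<Longrightarrow> y v \<le> y w \<Longrightarrow> I v w \<subseteq> Iv v"
  unfolding tile_Iv_def by blast

lemma I_subset_Iv_in: "adj u v \<Longrightarrow> y u \<le> y v \<Longrightarrow> v \<noteq> \<rho> \<Longrightarrow> I u v \<subseteq> Iv v"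
  unfolding Iv_eq_in tile_Iv_in_def by blast

lemma Iv_outE:
  assumes "x \<in> Iv v"
  obtains w where "adj v w" "y v \<le> y w" "x \<in> I v w"
  using assms unfolding tile_Iv_def by blast

lemma Iv_inE:
  assumes "x \<in> Iv v" "v \<noteq> \<rho>"
  obtains u where "adj u v" "y u \<le> y v" "x \<in> I u v"
  using assms(1) unfolding Iv_eq_in[OF assms(2)] tile_Iv_in_def by blast

text \<open>An edge interval lies in the interval of its lower vertex by definition and in that of
  its upper vertex by conservation of flow.\<close>

lemma adj_Iv_Int:
  assumes "adj u v"
  shows "Iv u \<inter> Iv v \<noteq> {}"
proof -
  have *: "Iv u \<inter> Iv v \<noteq> {}" if uv: "adj u v" "y u \<le> y v" for u v
  proof (cases "v = \<rho>")
    case False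
    thus ?thesis using a_in_I[OF uv] I_subset_Iv[OF uv] I_subset_Iv_in[OF uv] by blast
  next
    \<comment> \<open>The root, for which incoming and outgoing intervals are not equated, can be
      the upper end only if both heights are 0; then the edge is read in the other
      direction.\<close>
    case True
    hence vu: "adj v u" "y v \<le> y u" "u \<noteq> \<rho>" using uv adj_sym y_ge_0[of u] irrefl by auto
    thus ?thesis using a_in_I[OF vu(1,2)] I_subset_Iv[OF vu(1,2)] I_subset_Iv_in[OF vu] by blast
  qed
  show ?thesis using *[of u v] *[of v u] adj_sym[OF assms] assms by (metis Int_commute linear)
qed

section \<open>Lengths of the vertex intervals\<close>

definition upgrad :: "'v \<Rightarrow> real" where
  "upgrad v = (\<Sum>w\<in>{w\<in>nbrs adj v. y v \<le> y w}. len v w)"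

lemma upgrad_le_grad: "upgrad v \<le> grad y v"
proof -
  have "upgrad v = (\<Sum>w\<in>{w\<in>nbrs adj v. y v \<le> y w}. c v w * \<bar>y v - y w\<bar>)"
    unfolding upgrad_def by (intro sum.cong) auto
  also have "\<dots> \<le> grad y v" unfolding grad_def
    using finite_nbrs c_pos by (intro sum_mono2) (auto simp: nbrs_def less_imp_le intro!: mult_nonneg_nonneg)
  finally show ?thesis .
qed

lemma Iv_connected_image: "connected (\<Phi> ` Iv v)"
proof -
  obtain J where J: "is_interval J" "Iv v = per \<eta> J" using Iv_circle_interval[of v] unfolding circle_interval_def by blast
  have "\<Phi> ` Iv v = \<Phi> ` J" unfolding J(2) using \<eta>_pos by (intro to_circle_image_per) simp
  moreover have "connected (\<Phi> ` J)" using J(1) \<eta>_pos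
    by (intro connected_continuous_image continuous_on_to_circle) (auto simp: is_interval_connected)
  ultimately show ?thesis by simp
qed

text \<open>The image of \<open>Iv v\<close> is connected and a finite union of closed arcs, so the
  arcs are linked by intersections: a splitting would give two disjoint closed parts. Distances are
  then summed along the arcs, whose lengths add up to \<open>upgrad v\<close>.\<close>

lemma dist_Iv_le:
  assumes "x \<in> Iv v" "x' \<in> Iv v"
  shows "dist (\<Phi> x) (\<Phi> x') \<le> 2 * pi / \<eta> * upgrad v"
proof -
  define T where "T = {w. adj v w \<and> y v \<le> y w}"
  define K where "K w = \<Phi> ` {a v w..a v w + len v w}" for w
  have T_eq: "T = {w\<in>nbrs adj v. y v \<le> y w}" unfolding T_def nbrs_def by blast
  have finT: "finite T" unfolding T_eq using finite_nbrs by simp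
  have K: "\<Phi> ` I v w = K w" for w unfolding I_eq K_def using \<eta>_pos by (intro to_circle_image_per) simp
  have un: "\<Phi> ` Iv v = (\<Union>w\<in>T. K w)"
  proof -
    have "Iv v = (\<Union>w\<in>T. I v w)" unfolding tile_Iv_def T_def by blast
    hence "\<Phi> ` Iv v = (\<Union>w\<in>T. \<Phi> ` I v w)" by blast
    thus ?thesis by (simp add: K)
  qed
  have clK: "closed (K w)" for w unfolding K_def
    using \<eta>_pos by (intro compact_imp_closed compact_continuous_image continuous_on_to_circle) auto
  have Kne: "K w \<noteq> {}" if "w \<in> T" for w using that len_nonneg[of v w] unfolding K_def T_def by simp
  have link: "linked (\<lambda>i j. K i \<inter> K j \<noteq> {}) T"
    unfolding linked_def
  proof (intro allI impI)
    fix P assume P: "P \<subseteq> T \<and> P \<noteq> {} \<and> P \<noteq> T"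
    show "\<exists>i\<in>P. \<exists>j\<in>T - P. K i \<inter> K j \<noteq> {}"
    proof (rule ccontr)
      assume neg: "\<not> ?thesis"
      define A where "A = (\<Union>w\<in>P. K w)"
      define B' where "B' = (\<Union>w\<in>T - P. K w)"
      have "closed A" "closed B'" unfolding A_def B'_def using finT P finite_subset by (auto intro!: closed_UN clK)
      moreover have "A \<inter> B' = {}" unfolding A_def B'_def using neg by blast
      moreover have "\<Phi> ` Iv v = A \<union> B'" unfolding un A_def B'_def using P by blast
      moreover obtain p q where "p \<in> P" "q \<in> T - P" using P by blast
      hence "A \<noteq> {}" "B' \<noteq> {}" unfolding A_def B'_def using Kne P by blast+
      ultimately show False using Iv_connected_image[of v] connected_closed_set[of "A \<union> B'"] by (metis closed_Un)
    qed
  qed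
  obtain i where i: "i \<in> T" "\<Phi> x \<in> K i" using assms(1) un by blast
  obtain j where j: "j \<in> T" "\<Phi> x' \<in> K j" using assms(2) un by blast
  show ?thesis
  proof (rule linked_dist_le[OF link, where K = K and d = "\<lambda>w. 2 * pi / \<eta> * len v w" and i = i and j = j])
    fix w p q assume w: "w \<in> T" "p \<in> K w" "q \<in> K w"
    then obtain s t where st: "p = \<Phi> s" "q = \<Phi> t" "s \<in> {a v w..a v w + len v w}" "t \<in> {a v w..a v w + len v w}"
      unfolding K_def by blast
    have "dist p q \<le> 2 * pi / \<eta> * \<bar>s - t\<bar>" unfolding st by (rule dist_to_circle_le[OF \<eta>_pos])
    also have "\<dots> \<le> 2 * pi / \<eta> * len v w" using st(3,4) \<eta>_pos by (intro mult_left_mono) auto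
    finally show "dist p q \<le> 2 * pi / \<eta> * len v w" .
  next
    fix w assume "w \<in> T"
    thus "0 \<le> 2 * pi / \<eta> * len v w" using \<eta>_pos len_nonneg[of v w] unfolding T_def
      by (intro mult_nonneg_nonneg[of "2 * pi / \<eta>" "len v w"]) auto
  next
    fix P assume P: "finite P" "P \<subseteq> T"
    have "(\<Sum>w\<in>P. len v w) \<le> upgrad v" unfolding upgrad_def T_eq[symmetric]
      using finT P len_nonneg by (intro sum_mono2) (auto simp: T_def)
    thus "(\<Sum>w\<in>P. 2 * pi / \<eta> * len v w) \<le> 2 * pi / \<eta> * upgrad v"
      unfolding sum_distrib_left[symmetric] using \<eta>_pos by (intro mult_left_mono) auto
  qed (use i j in auto)
qed

section \<open>Generic vertical lines\<close>

definition ends :: "real set" where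
  "ends = (\<Union>u. \<Union>v. per \<eta> {a u v, a u v + len u v})"

lemma countable_ends: "countable ends"
proof -
  have "countable (per \<eta> {p, q})" for p q
  proof -
    have "per \<eta> {p, q} = (\<Union>k::int. {p - of_int k * \<eta>, q - of_int k * \<eta>})"
      unfolding per_def by (auto simp: algebra_simps)
    thus ?thesis by simp
  qed
  thus ?thesis unfolding ends_def using countable_V by (intro countable_UN) auto
qed

text \<open>A point of the interval that is no endpoint forces positive length, so the heights are
  strictly ordered.\<close>

lemma generic_I:
  assumes uv: "adj u v" "y u \<le> y v" and x: "x \<in> I u v" "x \<notin> ends"
  obtains k :: int where "a u v < x + of_int k * \<eta>" "x + of_int k * \<eta> < a u v + len u v" "y u < y v"
proof -
  obtain k :: int where k: "x + of_int k * \<eta> \<in> {a u v..a u v + len u v}" using x(1) unfolding I_eq per_iff by blast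
  have "x \<notin> per \<eta> {a u v, a u v + len u v}" using x(2) unfolding ends_def by blast
  hence "x + of_int k * \<eta> \<noteq> a u v" "x + of_int k * \<eta> \<noteq> a u v + len u v" unfolding per_iff by blast+
  hence lt: "a u v < x + of_int k * \<eta>" "x + of_int k * \<eta> < a u v + len u v" using k by auto
  hence "y u \<noteq> y v" by auto
  thus thesis using that[OF lt] uv by simp
qed

text \<open>The path descends along a generic vertical line, on which every rectangle lies strictly
  below the previous one; by finiteness it can only stop at the root.\<close>

lemma descend:
  assumes nb: "\<And>v u. v \<in> R \<Longrightarrow> adj v u \<Longrightarrow> u \<in> R \<union> G" and "\<rho> \<notin> R"
    and "v \<in> R" "x \<in> Iv v" "x \<notin> ends"
  shows "\<exists>w\<in>G. x \<in> Iv w"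
  using assms(3,4)
proof (induction "card {u. y u < y v}" arbitrary: v rule: less_induct)
  case less
  have "v \<noteq> \<rho>" using less.prems \<open>\<rho> \<notin> R\<close> by blast
  then obtain u where u: "adj u v" "y u \<le> y v" "x \<in> I u v" using Iv_inE less.prems by blast
  have lt: "y u < y v" using generic_I[OF u \<open>x \<notin> ends\<close>] by blast
  have xu: "x \<in> Iv u" using u I_subset_Iv by blast
  have "u \<in> R \<union> G" using nb[OF less.prems(1)] adj_sym[OF u(1)] by blast
  thus ?case
  proof
    assume uR: "u \<in> R"
    have "{w. y w < y u} \<subset> {w. y w < y v}" using lt by auto
    moreover have "finite {w. y w < y v}"
      using finite_y_le[OF y_lt_1[of v]] by (rule rev_finite_subset) auto
    ultimately show ?thesis using less.hyps[OF _ uR xu] psubset_card_mono by blast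
  qed (use xu in blast)
qed

text \<open>If some neighbour is higher, \<open>Iv v\<close> has positive length; its points off
  \<open>ends\<close> descend into \<open>G\<close> and accumulate at \<open>x\<close>, which is why
  the closure appears. If no neighbour is higher, \<open>Iv v\<close> is a single point of the
  circle that the interval of the next vertex on a path to the root contains as well, and the
  induction moves on.\<close>

lemma Iv_behind_in_closure:
  assumes nb: "\<And>v u. v \<in> R \<Longrightarrow> adj v u \<Longrightarrow> u \<in> R \<union> G" and "\<rho> \<notin> R"
    and "v \<in> R" "x \<in> Iv v"
  shows "\<Phi> x \<in> closure (\<Union>w\<in>G. \<Phi> ` Iv w)"
  using reach[of v \<rho>] assms(3,4)
proof (induction arbitrary: x rule: converse_rtranclp_induct)
  case base
  thus ?case using \<open>\<rho> \<notin> R\<close> by blast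
next
  case (step v u)
  show ?case
  proof (cases "\<exists>w. adj v w \<and> y v < y w")
    case True
    then obtain w where w: "adj v w" "y v < y w" by blast
    obtain J where J: "is_interval J" "Iv v = per \<eta> J" using Iv_circle_interval[of v] unfolding circle_interval_def by blast
    obtain k :: int where k: "x + of_int k * \<eta> \<in> J" using step.prems(2) unfolding J(2) per_iff by blast
    define x0 where "x0 = x + of_int k * \<eta>"
    have \<Phi>x: "\<Phi> x0 = \<Phi> x" unfolding x0_def using \<eta>_pos by (intro to_circle_shift) simp
    have "\<not> J \<subseteq> {x0}"
    proof
      assume "J \<subseteq> {x0}"
      have "{a v w..a v w + len v w} \<subseteq> I v w" unfolding I_eq by (rule subset_per)
      also have "\<dots> \<subseteq> Iv v" using w by (intro I_subset_Iv) auto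
      also have "\<dots> \<subseteq> per \<eta> {x0}" unfolding J(2) using \<open>J \<subseteq> {x0}\<close> unfolding per_def by blast
      also have "per \<eta> {x0} = (\<Union>k::int. {x0 - of_int k * \<eta>})" unfolding per_def by (auto simp: algebra_simps)
      finally have "countable {a v w..a v w + len v w}" by (rule countable_subset) simp
      moreover have "uncountable {a v w..a v w + len v w}" using len_pos[OF w] by (simp add: uncountable_closed_interval)
      ultimately show False by blast
    qed
    then obtain x1 where x1: "x1 \<in> J" "x1 \<noteq> x0" by blast
    have seg: "open_segment x0 x1 \<subseteq> J"
      using J(1) k x1(1) segment_open_subset_closed unfolding x0_def
      by (meson closed_segment_subset is_interval_convex order_trans)
    have "x0 \<in> closure (open_segment x0 x1 - ends)"
      unfolding closure_approachable
    proof (intro allI impI)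
      fix e :: real assume e: "0 < e"
      define U where "U = open_segment x0 x1 \<inter> {x0 - e<..<x0 + e}"
      have U: "U = {max (min x0 x1) (x0 - e)<..<min (max x0 x1) (x0 + e)}"
        unfolding U_def open_segment_eq_real_ivl by (auto simp: min_def max_def)
      have "max (min x0 x1) (x0 - e) < min (max x0 x1) (x0 + e)" using x1(2) e by (auto simp: min_def max_def)
      hence "uncountable U" unfolding U by (simp add: uncountable_open_interval)
      hence "\<not> U \<subseteq> ends" using countable_ends countable_subset by blast
      then obtain x' where "x' \<in> U" "x' \<notin> ends" by blast
      thus "\<exists>x'\<in>open_segment x0 x1 - ends. dist x' x0 < e"
        unfolding U_def by (intro bexI[of _ x']) (auto simp: dist_real_def abs_less_iff)
    qed
    hence "\<Phi> x0 \<in> \<Phi> ` closure (open_segment x0 x1 - ends)" by blast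
    also have "\<dots> \<subseteq> closure (\<Phi> ` (open_segment x0 x1 - ends))"
      using \<eta>_pos by (intro image_closure_subset[OF _ _ closure_subset] continuous_on_to_circle) auto
    also have "\<dots> \<subseteq> closure (\<Union>w\<in>G. \<Phi> ` Iv w)"
    proof (intro closure_mono subsetI)
      fix z assume "z \<in> \<Phi> ` (open_segment x0 x1 - ends)"
      then obtain x' where x': "z = \<Phi> x'" "x' \<in> open_segment x0 x1" "x' \<notin> ends" by blast
      have "x' \<in> Iv v" unfolding J(2) using seg x'(2) subset_per by blast
      have "\<exists>w\<in>G. x' \<in> Iv w"
        by (rule descend[of R]) (use nb \<open>\<rho> \<notin> R\<close> step.prems(1) x'(3) \<open>x' \<in> Iv v\<close> in blast)+
      thus "z \<in> (\<Union>w\<in>G. \<Phi> ` Iv w)" using x'(1) by blast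
    qed
    finally show ?thesis using \<Phi>x by simp
  next
    case False
    have "upgrad v = 0" unfolding upgrad_def
      by (rule sum.neutral) (use False in \<open>auto simp: nbrs_def not_less intro: antisym\<close>)
    hence same: "\<Phi> x = \<Phi> x'" if "x' \<in> Iv v" for x' using dist_Iv_le[OF step.prems(2) that] by simp
    obtain x' where x': "x' \<in> Iv v" "x' \<in> Iv u" using adj_Iv_Int[OF step.hyps(1)] by blast
    have "u \<in> R \<union> G" using nb step by blast
    thus ?thesis
    proof
      assume "u \<in> R"
      thus ?thesis using step.IH[OF _ x'(2)] same[OF x'(1)] by simp
    next
      assume "u \<in> G"
      hence "\<Phi> x' \<in> (\<Union>w\<in>G. \<Phi> ` Iv w)" using x'(2) by blast
      hence "\<Phi> x' \<in> closure (\<Union>w\<in>G. \<Phi> ` Iv w)" using closure_subset by (rule subsetD[rotated])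
      thus ?thesis using same[OF x'(1)] by simp
    qed
  qed
qed

text \<open>A crosscut of total weight at most \<open>e'\<close> has all its intervals within
  \<open>e'\<close> of one point, and the vertices behind it inherit this by passing to the closure.
  The factor \<open>2 * pi / \<eta>\<close> turns lengths on the line into bounds for
  chords.\<close>

lemma Iv_near_boundary:
  assumes \<xi>: "norm \<xi> = 1" and "0 < e"
  obtains \<delta> where "0 < \<delta>" "\<And>v v' x x'. D v \<subseteq> ball \<xi> \<delta> \<Longrightarrow> D v' \<subseteq> ball \<xi> \<delta> \<Longrightarrow> x \<in> Iv v \<Longrightarrow> x' \<in> Iv v'
    \<Longrightarrow> dist (\<Phi> x) (\<Phi> x') \<le> e"
proof -
  define m where "m v = 2 * pi / \<eta> * grad y v" for v
  have m0: "0 \<le> m v" for v unfolding m_def using \<eta>_pos grad_nonneg by simp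
  have tot: "(\<Sum>v\<in>F. (m v)\<^sup>2) \<le> (2 * pi / \<eta>)\<^sup>2 * E0" if "finite F" for F
    unfolding m_def power_mult_distrib sum_distrib_left[symmetric] using grad_y_sum[OF that that] by (intro mult_left_mono) auto
  define e' where "e' = e / 2"
  have e': "0 < e'" unfolding e'_def using \<open>0 < e\<close> by simp
  have "0 < (e' / 12)\<^sup>2" using e' by simp
  with finite_sums_tail[of "\<lambda>v. (m v)\<^sup>2" "(2 * pi / \<eta>)\<^sup>2 * E0" "(e' / 12)\<^sup>2", OF tot]
  obtain F0 where F0: "finite F0" "\<And>F. finite F \<Longrightarrow> F \<inter> F0 = {} \<Longrightarrow> (\<Sum>v\<in>F. (m v)\<^sup>2) \<le> (e' / 12)\<^sup>2" by blast
  \<comment> \<open>Crosscuts within \<open>\<kappa>\<close> of \<open>\<xi>\<close> avoid the root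
    and the finite set that carries the bulk of the weight. The tail bound is chosen so that
    \<open>6 * (e' / 12) < e'\<close>, the threshold for a light crosscut.\<close>
  obtain \<kappa> where \<kappa>: "0 < \<kappa>" "\<kappa> < 1" "\<forall>v\<in>insert \<rho> F0. D v \<subseteq> ball 0 (1 - \<kappa>)"
    using finite_discs_margin[of "insert \<rho> F0"] F0(1) by blast
  have far: "D v \<inter> cball \<xi> \<kappa> = {}" if "v \<in> insert \<rho> F0" for v
    using \<kappa>(3) that cball_boundary_disjoint[OF \<xi>, of \<kappa>] by blast
  have annF0: "F \<inter> F0 = {}" if "F \<subseteq> ann \<xi> (\<kappa> / 4)" for F
  proof -
    have "v \<notin> F0" if "v \<in> F" for v
    proof -
      obtain p where "p \<in> D v" "dist \<xi> p \<le> 2 * (\<kappa> / 4)" using \<open>v \<in> F\<close> \<open>F \<subseteq> ann \<xi> (\<kappa> / 4)\<close> unfolding ann_def by blast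
      hence "p \<in> D v \<inter> cball \<xi> \<kappa>" using \<kappa>(1) by simp
      thus ?thesis using far by blast
    qed
    thus ?thesis by blast
  qed
  have A: "(\<Sum>v\<in>F. (m v)\<^sup>2) \<le> (e' / 12)\<^sup>2" if "finite F" "F \<subseteq> ann \<xi> (\<kappa> / 4)" for F
    by (rule F0(2)[OF that(1) annF0[OF that(2)]])
  have lt: "6 * sqrt ((e' / 12)\<^sup>2) < e'" and pos: "0 < \<kappa> / 4" using e' \<kappa>(1) by simp_all
  obtain s where s: "s \<in> {\<kappa> / 4..2 * (\<kappa> / 4)}" "\<And>F. finite F \<Longrightarrow> F \<subseteq> cross \<xi> s \<Longrightarrow> sum m F \<le> e'"
    using light_crosscut[of "\<kappa> / 4" m \<xi> "(e' / 12)\<^sup>2" e', OF pos m0 A lt] by blast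
  have s01: "0 < s" "s < 1" "s < \<kappa>" using s(1) \<kappa> by auto
  have cross: "dist z z' \<le> e'" if "v \<in> cross \<xi> s" "z \<in> \<Phi> ` Iv v" "v' \<in> cross \<xi> s" "z' \<in> \<Phi> ` Iv v'" for v v' z z'
  proof (rule linked_dist_le[OF linked_cross[OF \<xi> s01(1,2)], where K = "\<lambda>v. \<Phi> ` Iv v" and d = m and i = v and j = v'])
    fix i j assume "adj i j"
    thus "\<Phi> ` Iv i \<inter> \<Phi> ` Iv j \<noteq> {}" using adj_Iv_Int by blast
  next
    fix i p q assume "p \<in> \<Phi> ` Iv i" "q \<in> \<Phi> ` Iv i"
    then obtain x x' where x: "p = \<Phi> x" "q = \<Phi> x'" "x \<in> Iv i" "x' \<in> Iv i" by blast
    have "dist p q \<le> 2 * pi / \<eta> * upgrad i" unfolding x by (rule dist_Iv_le[OF x(3,4)])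
    also have "\<dots> \<le> m i" unfolding m_def using upgrad_le_grad \<eta>_pos by (intro mult_left_mono) auto
    finally show "dist p q \<le> m i" .
  qed (use m0 s(2) that in auto)
  obtain w0 where w0: "w0 \<in> cross \<xi> s" using cross_meets_cofinite[OF \<xi> s01(1,2), of "{}"] by blast
  obtain w1 where "adj w0 w1" using ex_nbr by blast
  then obtain x0 where x0: "x0 \<in> Iv w0" using adj_Iv_Int by blast
  have \<rho>: "\<rho> \<notin> behind \<xi> s"
  proof
    assume "\<rho> \<in> behind \<xi> s"
    hence "ctr \<rho> \<in> ball \<xi> s" unfolding behind_def using centre_in_D by blast
    hence "ctr \<rho> \<in> D \<rho> \<inter> cball \<xi> \<kappa>" using s01(3) centre_in_D[of \<rho>] by simp
    thus False using far by blast
  qed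
  have base: "dist (\<Phi> x0) (\<Phi> x) \<le> e'" if v: "D v \<subseteq> ball \<xi> s" "x \<in> Iv v" for v x
  proof -
    have "v \<in> behind \<xi> s" using v(1) unfolding behind_def by blast
    hence "\<Phi> x \<in> closure (\<Union>w\<in>cross \<xi> s. \<Phi> ` Iv w)"
      by (intro Iv_behind_in_closure[OF behind_nbr \<rho> _ v(2)])
    also have "\<dots> \<subseteq> cball (\<Phi> x0) e'"
      using cross[OF w0 imageI[OF x0]] by (intro closure_minimal) auto
    finally show ?thesis by simp
  qed
  show thesis
  proof (rule that[OF s01(1)])
    fix v v' x x' assume "D v \<subseteq> ball \<xi> s" "D v' \<subseteq> ball \<xi> s" "x \<in> Iv v" "x' \<in> Iv v'"
    hence "dist (\<Phi> x0) (\<Phi> x) \<le> e'" "dist (\<Phi> x0) (\<Phi> x') \<le> e'" using base by blast+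
    thus "dist (\<Phi> x) (\<Phi> x') \<le> e"
      using dist_triangle3[of "\<Phi> x" "\<Phi> x'" "\<Phi> x0"] unfolding e'_def by simp
  qed
qed

lemma \<Phi>_convergent:
  assumes \<xi>: "norm \<xi> = 1" and lim: "(\<lambda>n. ctr (vs n)) \<longlonglongrightarrow> \<xi>" and x: "\<And>n. x n \<in> Iv (vs n)"
  shows "convergent (\<lambda>n. \<Phi> (x n))"
proof -
  have "Cauchy (\<lambda>n. \<Phi> (x n))"
  proof (rule metric_CauchyI)
    fix e :: real assume "0 < e"
    then obtain \<delta> where \<delta>: "0 < \<delta>" "\<And>v v' x x'. D v \<subseteq> ball \<xi> \<delta> \<Longrightarrow> D v' \<subseteq> ball \<xi> \<delta> \<Longrightarrow> x \<in> Iv v \<Longrightarrow> x' \<in> Iv v'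
      \<Longrightarrow> dist (\<Phi> x) (\<Phi> x') \<le> e / 2" using Iv_near_boundary[OF \<xi>, of "e / 2"] by (metis half_gt_zero)
    obtain \<delta>' where \<delta>': "0 < \<delta>'" "\<And>v. D v \<inter> cball \<xi> \<delta>' \<noteq> {} \<Longrightarrow> D v \<subseteq> ball \<xi> \<delta>"
      using discs_near_boundary_small[OF \<xi> \<delta>(1)] by blast
    obtain N where N: "\<And>n. N \<le> n \<Longrightarrow> dist (ctr (vs n)) \<xi> < \<delta>'"
      using lim \<delta>'(1) unfolding lim_sequentially by blast
    have near: "D (vs n) \<subseteq> ball \<xi> \<delta>" if "N \<le> n" for n
    proof -
      have "ctr (vs n) \<in> D (vs n) \<inter> cball \<xi> \<delta>'" using N[OF that] by (intro IntI centre_in_D) (simp add: dist_commute)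
      thus ?thesis using \<delta>'(2) by blast
    qed
    have "dist (\<Phi> (x m)) (\<Phi> (x n)) < e" if "N \<le> m" "N \<le> n" for m n
      using \<delta>(2)[OF near[OF that(1)] near[OF that(2)] x x] \<open>0 < e\<close> by simp
    thus "\<exists>N. \<forall>m\<ge>N. \<forall>n\<ge>N. dist (\<Phi> (x m)) (\<Phi> (x n)) < e" by blast
  qed
  thus ?thesis by (simp add: Cauchy_convergent_iff)
qed

end

section \<open>Boxes in the cylinder\<close>

text \<open>Below height 1 this is the distance to the boundary point \<open>(p, 1)\<close> in the
  maximum norm, on the universal cover of the cylinder. Its level sets there are boxes without a
  lid.\<close>

definition fbox :: "real \<Rightarrow> real \<times> real \<Rightarrow> real" where
  "fbox p z = max \<bar>fst z - p\<bar> (1 - snd z)"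

definition box_boundary :: "real \<Rightarrow> real \<Rightarrow> (real \<times> real) set" where
  "box_boundary p s = {z. fbox p z = s \<and> snd z < 1}"

lemma fbox_diff_le: "\<bar>fbox p z - fbox p z'\<bar> \<le> max \<bar>fst z - fst z'\<bar> \<bar>snd z - snd z'\<bar>"
  unfolding fbox_def by (auto simp: max_def abs_if)

lemma box_boundary_cases:
  assumes "z \<in> box_boundary p s"
  shows "fst z = p + s \<or> fst z = p - s \<or> snd z = 1 - s" "1 - s \<le> snd z" "\<bar>fst z - p\<bar> \<le> s" "snd z < 1"
  using assms unfolding box_boundary_def fbox_def by (auto simp: max_def abs_if split: if_splits)

text \<open>Two sides joined by a bottom. A cut at a height below 1 will leave only finitely many
  tiles to consider.\<close>

lemma connected_truncated_box_boundary:
  assumes "0 < s" "1 - s \<le> t"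
  shows "connected {z. fbox p z = s \<and> snd z \<le> t}"
proof -
  define L where "L = {p - s} \<times> {1 - s..t}"
  define N where "N = {p - s..p + s} \<times> {1 - s}"
  define R where "R = {p + s} \<times> {1 - s..t}"
  have eq: "{z. fbox p z = s \<and> snd z \<le> t} = L \<union> (N \<union> R)"
  proof
    show "{z. fbox p z = s \<and> snd z \<le> t} \<subseteq> L \<union> (N \<union> R)"
    proof
      fix z assume "z \<in> {z. fbox p z = s \<and> snd z \<le> t}"
      hence "fbox p z = s" "snd z \<le> t" by auto
      thus "z \<in> L \<union> (N \<union> R)" unfolding fbox_def L_def N_def R_def
        by (cases z) (auto simp: max_def abs_if split: if_splits)
    qed
    show "L \<union> (N \<union> R) \<subseteq> {z. fbox p z = s \<and> snd z \<le> t}"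
      using assms unfolding fbox_def L_def N_def R_def by (auto simp: max_def abs_if)
  qed
  have "connected (N \<union> R)"
  proof (rule connected_Un)
    have "(p + s, 1 - s) \<in> N \<inter> R" using assms unfolding N_def R_def by simp
    thus "N \<inter> R \<noteq> {}" by blast
  qed (auto simp: N_def R_def intro!: connected_Times)
  have "connected (L \<union> (N \<union> R))"
  proof (rule connected_Un)
    show "connected (N \<union> R)" by fact
    have "(p - s, 1 - s) \<in> L \<inter> (N \<union> R)" using assms unfolding L_def N_def by simp
    thus "L \<inter> (N \<union> R) \<noteq> {}" by blast
  qed (auto simp: L_def intro!: connected_Times)
  thus ?thesis unfolding eq .
qed

lemma interval_of_small_differences:
  fixes H :: "real set"
  assumes "\<And>s s'. s \<in> H \<Longrightarrow> s' \<in> H \<Longrightarrow> \<bar>s - s'\<bar> \<le> d"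
  shows "\<exists>l. \<forall>s\<in>H. l \<le> s \<and> s \<le> l + d"
proof (cases "H = {}")
  case False
  then obtain h where h: "h \<in> H" by blast
  have bd: "bdd_below H"
  proof (rule bdd_belowI)
    fix x assume "x \<in> H"
    thus "h - d \<le> x" using assms[OF h, of x] by (simp add: abs_le_iff)
  qed
  have "Inf H \<le> s \<and> s \<le> Inf H + d" if s: "s \<in> H" for s
  proof
    show "Inf H \<le> s" by (rule cInf_lower[OF s bd])
    have "s - d \<le> Inf H"
    proof (rule cInf_greatest[OF False])
      fix x assume "x \<in> H"
      thus "s - d \<le> x" using assms[OF s, of x] by (simp add: abs_le_iff)
    qed
    thus "s \<le> Inf H + d" by simp
  qed
  thus ?thesis by blast
qed simp

lemma sum_rectangle_areas_le:
  fixes X T w h :: "'i \<Rightarrow> real"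
  assumes F: "finite F" and wh: "\<And>i. i \<in> F \<Longrightarrow> 0 \<le> w i" "\<And>i. i \<in> F \<Longrightarrow> 0 \<le> h i"
    and sub: "\<And>i. i \<in> F \<Longrightarrow> x1 \<le> X i \<and> X i + w i \<le> x2 \<and> t1 \<le> T i \<and> T i + h i \<le> t2"
    and disj: "\<And>i j. i \<in> F \<Longrightarrow> j \<in> F \<Longrightarrow> i \<noteq> j \<Longrightarrow>
      ({X i<..<X i + w i} \<times> {T i<..<T i + h i}) \<inter> ({X j<..<X j + w j} \<times> {T j<..<T j + h j}) = {}"
    and le: "x1 \<le> x2" "t1 \<le> t2"
  shows "(\<Sum>i\<in>F. w i * h i) \<le> (x2 - x1) * (t2 - t1)"
proof -
  define Q where "Q i = {X i<..<X i + w i} \<times> {T i<..<T i + h i}" for i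
  have em: "emeasure lborel (A \<times> A') = emeasure lborel A * emeasure lborel A'"
    if "A \<in> sets borel" "A' \<in> sets borel" for A A' :: "real set"
    using lborel.emeasure_pair_measure_Times[of A lborel A'] that by (simp add: lborel_prod)
  have emQ: "emeasure lborel (Q i) = ennreal (w i * h i)" if "i \<in> F" for i
    unfolding Q_def using wh[OF that] by (subst em) (auto simp: ennreal_mult)
  have "ennreal (\<Sum>i\<in>F. w i * h i) = (\<Sum>i\<in>F. ennreal (w i * h i))"
    using wh by (subst sum_ennreal) auto
  also have "\<dots> = (\<Sum>i\<in>F. emeasure lborel (Q i))" by (intro sum.cong) (auto simp: emQ)
  also have "\<dots> = emeasure lborel (\<Union>i\<in>F. Q i)"
  proof (rule sum_emeasure)
    show "Q ` F \<subseteq> sets lborel" unfolding Q_def by (auto intro!: borel_open open_Times)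
    show "disjoint_family_on Q F" unfolding disjoint_family_on_def Q_def using disj by blast
  qed (rule F)
  also have "\<dots> \<le> emeasure lborel ({x1..x2} \<times> {t1..t2})"
  proof (rule emeasure_mono)
    show "(\<Union>i\<in>F. Q i) \<subseteq> {x1..x2} \<times> {t1..t2}"
    proof
      fix z assume "z \<in> (\<Union>i\<in>F. Q i)"
      then obtain i where "i \<in> F" "z \<in> Q i" by blast
      thus "z \<in> {x1..x2} \<times> {t1..t2}" using sub[of i] unfolding Q_def by (cases z) auto
    qed
    show "{x1..x2} \<times> {t1..t2} \<in> sets lborel" by (auto intro!: borel_closed closed_Times)
  qed
  also have "\<dots> = ennreal ((x2 - x1) * (t2 - t1))" using le by (subst em) (auto simp: ennreal_mult)
  finally show ?thesis using le by (subst (asm) ennreal_le_iff) auto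
qed

context tiled_network
begin

section \<open>Discrete contours of boxes\<close>

definition hits :: "real \<Rightarrow> real \<Rightarrow> 'v \<Rightarrow> 'v \<Rightarrow> bool" where
  "hits p s u v \<longleftrightarrow> adj u v \<and> y u < y v \<and> box_boundary p s \<inter> S u v \<noteq> {}"

definition sig :: "real \<Rightarrow> real \<Rightarrow> 'v set" where
  "sig p s = {w. \<exists>u v. hits p s u v \<and> w \<in> {u, v}}"

text \<open>At such a parameter the sides of the box avoid the abscissas of all vertical tile sides
  and its bottom avoids the heights of all horizontal ones, so no corner of a tile is on the
  contour.\<close>

definition generic :: "real \<Rightarrow> real \<Rightarrow> bool" where
  "generic p s \<longleftrightarrow> p + s \<notin> ends \<and> p - s \<notin> ends \<and> (\<forall>w. y w \<noteq> 1 - s)"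

lemma S_eq: "y u \<le> y v \<Longrightarrow> S u v = I u v \<times> {y u..y v}"
  by (simp add: tile_S_def)

lemma S_swap: "y v < y u \<Longrightarrow> S u v = S v u"
  by (simp add: tile_S_def)

lemma countable_non_generic: "countable {s. \<not> generic p s}"
proof -
  have "{s. \<not> generic p s} \<subseteq> (\<lambda>x. x - p) ` ends \<union> (\<lambda>x. p - x) ` ends \<union> (\<lambda>w. 1 - y w) ` UNIV"
  proof
    fix s assume "s \<in> {s. \<not> generic p s}"
    then consider "p + s \<in> ends" | "p - s \<in> ends" | w where "y w = 1 - s" unfolding generic_def by blast
    thus "s \<in> (\<lambda>x. x - p) ` ends \<union> (\<lambda>x. p - x) ` ends \<union> (\<lambda>w. 1 - y w) ` UNIV"
    proof cases
      case 1
      hence "s \<in> (\<lambda>x. x - p) ` ends" by (intro image_eqI[of _ _ "p + s"]) auto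
      thus ?thesis by blast
    next
      case 2
      hence "s \<in> (\<lambda>x. p - x) ` ends" by (intro image_eqI[of _ _ "p - s"]) auto
      thus ?thesis by blast
    next
      case 3
      hence "s \<in> (\<lambda>w. 1 - y w) ` UNIV" by (intro image_eqI[of _ _ w]) auto
      thus ?thesis by blast
    qed
  qed
  moreover have "countable ((\<lambda>x. x - p) ` ends \<union> (\<lambda>x. p - x) ` ends \<union> (\<lambda>w. 1 - y w) ` UNIV)"
    using countable_ends countable_V by (intro countable_Un countable_image)
  ultimately show ?thesis by (rule countable_subset)
qed

text \<open>A tile between equal heights consists of points with abscissa in \<open>ends\<close> at
  a vertex height, and each point of the contour avoids one or the other.\<close>

lemma box_tile_strict:
  assumes g: "generic p s" and z: "z \<in> box_boundary p s" "z \<in> S u v" and uv: "adj u v"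
  shows "y u \<noteq> y v"
proof
  assume eq: "y u = y v"
  hence "S u v = I u v \<times> {y u..y v}" by (intro S_eq) simp
  hence "fst z \<in> I u v" "snd z \<in> {y u..y v}" using z(2) by (metis mem_Times_iff)+
  hence zI: "fst z \<in> I u v" "snd z = y u" using eq by auto
  have "fst z \<in> per \<eta> {a u v, a u v + len u v}" using zI(1) eq unfolding I_eq by simp
  hence "fst z \<in> ends" unfolding ends_def by blast
  moreover have "snd z \<noteq> 1 - s" using zI(2) g unfolding generic_def by metis
  ultimately show False using box_boundary_cases(1)[OF z(1)] g unfolding generic_def by metis
qed

lemma box_cover:
  assumes g: "generic p s" and s: "s < 1" and z: "z \<in> box_boundary p s"
  shows "\<exists>u v. hits p s u v \<and> z \<in> S u v"
proof -
  have "z \<in> UNIV \<times> {0..<1}" using box_boundary_cases(2,4)[OF z] s by (cases z) auto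
  hence "z \<in> \<Union>{S u v | u v. adj u v}" unfolding tiles_cover .
  then obtain u v where uv: "adj u v" "z \<in> S u v" by blast
  have "y u \<noteq> y v" by (rule box_tile_strict[OF g z uv(2,1)])
  hence "y u < y v \<or> y v < y u" by linarith
  thus ?thesis
  proof
    assume "y u < y v"
    hence "hits p s u v" using uv z unfolding hits_def by blast
    thus ?thesis using uv by blast
  next
    assume lt: "y v < y u"
    have "z \<in> S v u" using uv(2) unfolding S_swap[OF lt] .
    moreover have "adj v u" by (rule adj_sym[OF uv(1)])
    ultimately have "hits p s v u" using lt z unfolding hits_def by blast
    thus ?thesis using \<open>z \<in> S v u\<close> by blast
  qed
qed

lemma open_box_subset_tile:
  assumes "y u \<le> y v" "a u v \<le> x1 + of_int k * \<eta>" "x2 + of_int k * \<eta> \<le> a u v + len u v" "y u \<le> t1" "t2 \<le> y v"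
  shows "{x1<..<x2} \<times> {t1<..<t2} \<subseteq> interior (S u v)"
proof (rule interior_maximal)
  show "{x1<..<x2} \<times> {t1<..<t2} \<subseteq> S u v"
  proof
    fix z assume z: "z \<in> {x1<..<x2} \<times> {t1<..<t2}"
    hence "fst z + of_int k * \<eta> \<in> {a u v..a u v + len u v}" using assms by (cases z) auto
    hence "fst z \<in> I u v" unfolding I_eq per_iff by blast
    thus "z \<in> S u v" unfolding S_eq[OF assms(1)] using z assms by (cases z) auto
  qed
qed (intro open_Times open_greaterThanLessThan)

text \<open>One tile contains a neighbourhood of the point and the other has it in the closure of
  its interior.\<close>

lemma tiles_overlap:
  assumes uv: "adj u v" "adj u' v'"
    and k: "a u v < x + of_int k * \<eta>" "x + of_int k * \<eta> < a u v + len u v" and x: "x \<in> I u' v'"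
    and t: "y u < t" "t < y v" "y u' < t" "t < y v'"
  shows "{u, v} = {u', v'}"
proof (rule ccontr)
  assume ne: "{u, v} \<noteq> {u', v'}"
  obtain k' :: int where k': "x + of_int k' * \<eta> \<in> {a u' v'..a u' v' + len u' v'}" using x unfolding I_eq per_iff by blast
  define U where "U = {a u v - of_int k * \<eta><..<a u v + len u v - of_int k * \<eta>} \<times> {y u<..<y v}"
  define V where "V = {a u' v' - of_int k' * \<eta><..<a u' v' + len u' v' - of_int k' * \<eta>} \<times> {y u'<..<y v'}"
  have UV: "U \<subseteq> interior (S u v)" "V \<subseteq> interior (S u' v')"
    unfolding U_def V_def using t by (intro open_box_subset_tile[where k = k] open_box_subset_tile[where k = k']; simp)+
  have "0 < len u' v'" using uv t by (intro len_pos) auto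
  hence "closure V = {a u' v' - of_int k' * \<eta>..a u' v' + len u' v' - of_int k' * \<eta>} \<times> {y u'..y v'}"
    unfolding V_def closure_Times using t by simp
  hence "(x, t) \<in> closure V" using k' t by simp
  moreover have "(x, t) \<in> U" unfolding U_def using k t by simp
  moreover have "open U" unfolding U_def by (intro open_Times open_greaterThanLessThan)
  ultimately have "U \<inter> V \<noteq> {}" using open_Int_closure_eq_empty[of U V] by blast
  thus False using UV tile_interiors_disjoint[OF uv ne] by blast
qed

text \<open>The tile of \<open>u\<close>, \<open>v\<close> stands on height \<open>t\<close> above
  \<open>x\<close>. Conservation of flow at \<open>u\<close> puts the tile of some edge from
  \<open>w\<close> to \<open>u\<close> below it; just under \<open>t\<close> this tile overlaps that
  of \<open>u'\<close>, \<open>v'\<close>, so the two edges are the same.\<close>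

lemma tiles_above_below_share:
  assumes uv: "adj u v" "adj u' v'" "y u < y v" "y u' < y v'"
    and x: "x \<in> I u v" "x \<in> I u' v'" "x \<notin> ends" and t: "0 < t" "y u = t" "y v' = t"
  shows "u \<in> {u', v'}"
proof -
  have "u \<noteq> \<rho>" using t by auto
  moreover have "x \<in> Iv u" using I_subset_Iv[OF uv(1)] uv(3) x(1) by auto
  ultimately obtain w where w: "adj w u" "y w \<le> y u" "x \<in> I w u" using Iv_inE by blast
  obtain k where k: "a w u < x + of_int k * \<eta>" "x + of_int k * \<eta> < a w u + len w u" "y w < y u"
    using generic_I[OF w x(3)] by blast
  define t' where "t' = (max (y w) (y u') + t) / 2"
  have "{w, u} = {u', v'}"
    by (rule tiles_overlap[OF w(1) uv(2) k(1,2) x(2), of t']) (use k(3) t uv in \<open>auto simp: t'_def max_def\<close>)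
  thus ?thesis by blast
qed

text \<open>Off \<open>ends\<close>, both tiles extend to the same side of height \<open>t\<close>
  and overlap, or one stands on the other. On \<open>ends\<close>, the point lies on the bottom of
  the box, strictly between the heights of both tiles; if these are different, it is on vertical
  sides of both, and their edges lie on a common face.\<close>

lemma box_tiles_share:
  assumes g: "generic p s" and s: "s < 1" and z: "z \<in> box_boundary p s"
    and uv: "adj u v" "y u < y v" "z \<in> S u v" and uv': "adj u' v'" "y u' < y v'" "z \<in> S u' v'"
  shows "{u, v} \<inter> {u', v'} \<noteq> {}"
proof -
  obtain x t where zxt: "z = (x, t)" by fastforce
  have xt: "x \<in> I u v" "y u \<le> t" "t \<le> y v" "x \<in> I u' v'" "y u' \<le> t" "t \<le> y v'"
    using uv uv' S_eq[of u v] S_eq[of u' v'] zxt by auto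
  have t0: "0 < t" using box_boundary_cases(2)[OF z] s zxt by simp
  have cases: "x = p + s \<or> x = p - s \<or> t = 1 - s" using box_boundary_cases(1)[OF z] zxt by simp
  show ?thesis
  proof (cases "x \<in> ends")
    case False
    obtain k where k: "a u v < x + of_int k * \<eta>" "x + of_int k * \<eta> < a u v + len u v"
      using generic_I[OF uv(1) less_imp_le[OF uv(2)] xt(1) False] by blast
    have overlap: "{u, v} = {u', v'}" if "y u < t'" "t' < y v" "y u' < t'" "t' < y v'" for t'
      using tiles_overlap[OF uv(1) uv'(1) k xt(4) that] .
    consider "y u < t" "y u' < t" | "t < y v" "t < y v'" | "y u = t" "y v' = t" | "y u' = t" "y v = t"
      using xt uv(2) uv'(2) by linarith
    thus ?thesis
    proof cases
      case 1
      have "{u, v} = {u', v'}"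
        by (rule overlap[of "(max (y u) (y u') + t) / 2"]) (use 1 xt in \<open>auto simp: max_def\<close>)
      thus ?thesis by auto
    next
      case 2
      have "{u, v} = {u', v'}"
        by (rule overlap[of "(min (y v) (y v') + t) / 2"]) (use 2 xt in \<open>auto simp: min_def\<close>)
      thus ?thesis by auto
    next
      case 3
      thus ?thesis using tiles_above_below_share[OF uv(1) uv'(1) uv(2) uv'(2) xt(1,4) False t0] by blast
    next
      case 4
      thus ?thesis using tiles_above_below_share[OF uv'(1) uv(1) uv'(2) uv(2) xt(4,1) False t0] by blast
    qed
  next
    case True
    hence t: "t = 1 - s" using cases g unfolding generic_def by metis
    have ty: "y w \<noteq> t" for w using g t unfolding generic_def by metis
    hence lt: "y u < t" "t < y v" "y u' < t" "t < y v'" using xt ty by (metis order_le_less)+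
    obtain k :: int where k: "a u v \<le> x + of_int k * \<eta>" "x + of_int k * \<eta> \<le> a u v + len u v"
      using xt(1) unfolding I_eq per_iff by auto
    obtain k' :: int where k': "a u' v' \<le> x + of_int k' * \<eta>" "x + of_int k' * \<eta> \<le> a u' v' + len u' v'"
      using xt(4) unfolding I_eq per_iff by auto
    show ?thesis
    proof (cases "{u, v} = {u', v'}")
      case False
      have "\<not> (a u v < x + of_int k * \<eta> \<and> x + of_int k * \<eta> < a u v + len u v)"
        using tiles_overlap[OF uv(1) uv'(1) _ _ xt(4) lt] False by blast
      hence "x + of_int k * \<eta> \<in> {a u v, a u v + len u v}" using k by auto
      hence "x \<in> per \<eta> {a u v, a u v + len u v}" unfolding per_iff by blast
      hence 1: "(x, t) \<in> tile_vsides adj c \<rho> a u v" unfolding tile_vsides_def using uv(2) lt by simp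
      have "\<not> (a u' v' < x + of_int k' * \<eta> \<and> x + of_int k' * \<eta> < a u' v' + len u' v')"
        using tiles_overlap[OF uv'(1) uv(1) _ _ xt(1) lt(3,4,1,2)] False by blast
      hence "x + of_int k' * \<eta> \<in> {a u' v', a u' v' + len u' v'}" using k' by auto
      hence "x \<in> per \<eta> {a u' v', a u' v' + len u' v'}" unfolding per_iff by blast
      hence 2: "(x, t) \<in> tile_vsides adj c \<rho> a u' v'" unfolding tile_vsides_def using uv'(2) lt by simp
      show ?thesis using common_face_share[OF vsides_common_face[OF uv(1) uv'(1)] uv(1) uv'(1)] 1 2 by blast
    qed auto
  qed
qed

lemma finite_low_edges: "t < 1 \<Longrightarrow> finite {(u, v). adj u v \<and> y u \<le> t}"
proof -
  assume "t < 1"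
  have "{(u, v). adj u v \<and> y u \<le> t} = Sigma {u. y u \<le> t} (nbrs adj)" unfolding nbrs_def by blast
  thus ?thesis using finite_y_le[OF \<open>t < 1\<close>] finite_nbrs by (simp add: finite_SigmaI)
qed

lemma closed_tile: "closed (S u v)"
  unfolding tile_S_def I_eq using closed_per_interval[OF \<eta>_pos] by (auto intro!: closed_Times)

text \<open>A partition without adjacencies puts each tile on the contour wholly into one class, and
  tiles of different classes share no contour point. Cut off above two chosen hitting points, the
  contour meets only finitely many tiles, which are closed, so it would be disconnected.\<close>

lemma linked_sig:
  assumes g: "generic p s" and s: "0 < s" "s < 1"
  shows "linked adj (sig p s)"
  unfolding linked_def
proof (intro allI impI)
  fix P assume P: "P \<subseteq> sig p s \<and> P \<noteq> {} \<and> P \<noteq> sig p s"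
  show "\<exists>i\<in>P. \<exists>j\<in>sig p s - P. adj i j"
  proof (rule ccontr)
    assume neg: "\<not> ?thesis"
    define Q where "Q = sig p s - P"
    have sep: "\<not> adj i j" "\<not> adj j i" if "i \<in> P" "j \<in> Q" for i j using neg that adj_sym unfolding Q_def by blast+
    have PQ: "P \<union> Q = sig p s" "P \<inter> Q = {}" "P \<noteq> {}" "Q \<noteq> {}" using P unfolding Q_def by blast+
    have ends_in: "u \<in> sig p s" "v \<in> sig p s" if "hits p s u v" for u v using that unfolding sig_def by blast+
    have cls: "u \<in> P \<and> v \<in> P \<or> u \<in> Q \<and> v \<in> Q" if h: "hits p s u v" for u v
    proof -
      have "adj u v" using h unfolding hits_def by blast
      thus ?thesis using ends_in[OF h] PQ(1) sep by blast
    qed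
    have pick: "\<exists>u v z. hits p s u v \<and> u \<in> Z \<and> z \<in> box_boundary p s \<and> z \<in> S u v"
      if Z: "Z = P \<or> Z = Q" for Z
    proof -
      obtain w where w: "w \<in> Z" using Z PQ by blast
      hence "w \<in> sig p s" using Z PQ(1) by blast
      then obtain u v where h: "hits p s u v" "w \<in> {u, v}" unfolding sig_def by blast
      hence "u \<in> Z" using cls[OF h(1)] w Z PQ(2) by blast
      moreover obtain z where "z \<in> box_boundary p s" "z \<in> S u v" using h(1) unfolding hits_def by blast
      ultimately show ?thesis using h(1) by blast
    qed
    obtain u1 v1 z1 where 1: "hits p s u1 v1" "u1 \<in> P" "z1 \<in> box_boundary p s" "z1 \<in> S u1 v1" using pick[of P] by blast
    obtain u2 v2 z2 where 2: "hits p s u2 v2" "u2 \<in> Q" "z2 \<in> box_boundary p s" "z2 \<in> S u2 v2" using pick[of Q] by blast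
    define t where "t = max (snd z1) (snd z2)"
    define C where "C = {z. fbox p z = s \<and> snd z \<le> t}"
    have t: "t < 1" "1 - s \<le> t"
      using box_boundary_cases(2,4)[OF 1(3)] box_boundary_cases(4)[OF 2(3)] unfolding t_def by auto
    have CB: "z \<in> box_boundary p s" if "z \<in> C" for z using that t unfolding C_def box_boundary_def by auto
    have zC: "z1 \<in> C" "z2 \<in> C" using 1(3) 2(3) unfolding C_def box_boundary_def t_def by auto
    have connC: "connected C" unfolding C_def by (rule connected_truncated_box_boundary[OF s(1) t(2)])
    define low where "low Z = {(u, v). hits p s u v \<and> u \<in> Z \<and> y u \<le> t}" for Z
    define U where "U Z = (\<Union>(u, v)\<in>low Z. S u v)" for Z
    have fin: "finite (low Z)" for Z
      using finite_low_edges[OF t(1)] unfolding low_def hits_def by (rule rev_finite_subset) auto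
    have closedU: "closed (U Z)" for Z unfolding U_def using fin closed_tile by (intro closed_UN) auto
    have in_U: "z \<in> U Z" if "z \<in> C" "hits p s u v" "u \<in> Z" "z \<in> S u v" for z u v Z
    proof -
      have "y u \<le> snd z" using that(2,4) S_eq[of u v] unfolding hits_def by auto
      hence "(u, v) \<in> low Z" using that unfolding low_def C_def by simp
      thus ?thesis using that(4) unfolding U_def by blast
    qed
    have "C \<subseteq> U P \<union> U Q"
    proof
      fix z assume z: "z \<in> C"
      obtain u v where uv: "hits p s u v" "z \<in> S u v" using box_cover[OF g s(2) CB[OF z]] by blast
      have "u \<in> P \<or> u \<in> Q" using cls[OF uv(1)] by blast
      thus "z \<in> U P \<union> U Q" using in_U[OF z uv(1) _ uv(2)] by blast
    qed
    moreover have "U P \<inter> U Q \<inter> C = {}"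
    proof (rule ccontr)
      assume "U P \<inter> U Q \<inter> C \<noteq> {}"
      then obtain z where z: "z \<in> U P" "z \<in> U Q" "z \<in> C" by blast
      obtain u v where uv: "hits p s u v" "u \<in> P" "z \<in> S u v" using z(1) unfolding U_def low_def by blast
      obtain u' v' where uv': "hits p s u' v'" "u' \<in> Q" "z \<in> S u' v'" using z(2) unfolding U_def low_def by blast
      have "{u, v} \<inter> {u', v'} \<noteq> {}"
        by (rule box_tiles_share[OF g s(2) CB[OF z(3)]]) (use uv uv' in \<open>auto simp: hits_def\<close>)
      moreover have "u \<in> P \<and> v \<in> P" "u' \<in> Q \<and> v' \<in> Q" using cls uv uv' PQ(2) by blast+
      ultimately show False using PQ(2) by blast
    qed
    moreover have "U P \<inter> C \<noteq> {}" using in_U[OF zC(1) 1(1,2,4)] zC by blast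
    moreover have "U Q \<inter> C \<noteq> {}" using in_U[OF zC(2) 2(1,2,4)] zC by blast
    ultimately show False using connC closedU unfolding connected_closed by blast
  qed
qed

text \<open>Only one point of the horizontal segment of \<open>w\<close> has to be in the open box,
  so vertices of the contour may be inside too.\<close>

definition inside_box :: "real \<Rightarrow> real \<Rightarrow> 'v set" where
  "inside_box p s = {w. \<exists>x\<in>Iv w. \<bar>x - p\<bar> < s \<and> 1 - y w < s}"

text \<open>The counterpart of \<open>behind_nbr\<close>. As \<open>w\<close> is not on the contour,
  no tile at \<open>w\<close> meets it; hence the lift of \<open>Iv w\<close> through
  \<open>x0\<close> stays within \<open>s\<close> of \<open>p\<close> by the intermediate value
  theorem, and then a tile at \<open>w\<close> cannot cross the bottom of the box.\<close>

lemma inside_box_nbr: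
  assumes g: "generic p s" and s: "s < 1" and w: "w \<in> inside_box p s" "w \<notin> sig p s" and ww': "adj w w'"
  shows "w' \<in> inside_box p s"
proof -
  have no_hit: "fbox p (x, t) \<noteq> s" if uv: "adj u v" "w \<in> {u, v}" "x \<in> I u v" "y u \<le> y v" "y u \<le> t" "t \<le> y v" for u v x t
  proof
    assume "fbox p (x, t) = s"
    hence z: "(x, t) \<in> box_boundary p s" using y_lt_1[of v] uv(6) unfolding box_boundary_def by simp
    have zS: "(x, t) \<in> S u v" using uv S_eq by simp
    have "y u \<noteq> y v" by (rule box_tile_strict[OF g z zS uv(1)])
    hence "hits p s u v" using uv(1,4) z zS unfolding hits_def by auto
    thus False using w(2) uv(2) unfolding sig_def by blast
  qed
  obtain x0 where x0: "x0 \<in> Iv w" "\<bar>x0 - p\<bar> < s" "1 - y w < s" using w(1) unfolding inside_box_def by blast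
  have w\<rho>: "w \<noteq> \<rho>" using x0(3) s by auto
  obtain J where J: "is_interval J" "Iv w = per \<eta> J" using Iv_circle_interval[of w] unfolding circle_interval_def by blast
  obtain k0 :: int where k0: "x0 + of_int k0 * \<eta> \<in> J" using x0(1) unfolding J(2) per_iff by blast
  have small: "\<bar>x - p\<bar> < s" if x: "x + of_int k0 * \<eta> \<in> J" for x
  proof (rule ccontr)
    assume "\<not> \<bar>x - p\<bar> < s"
    moreover have "continuous_on (closed_segment x0 x) (\<lambda>x. \<bar>x - p\<bar>)" by (intro continuous_intros)
    ultimately obtain x' where x': "x' \<in> closed_segment x0 x" "\<bar>x' - p\<bar> = s"
      using IVT'_closed_segment_real[of s "\<lambda>x. \<bar>x - p\<bar>" x0 x] x0(2)
      by (auto simp: closed_segment_eq_real_ivl)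
    have "x' + of_int k0 * \<eta> \<in> closed_segment (x0 + of_int k0 * \<eta>) (x + of_int k0 * \<eta>)"
      using x'(1) by (auto simp: closed_segment_eq_real_ivl split: if_splits)
    hence "x' + of_int k0 * \<eta> \<in> J"
      using J(1) k0 x by (meson closed_segment_subset is_interval_convex subsetD)
    hence "x' \<in> Iv w" unfolding J(2) per_iff by blast
    then obtain v where v: "adj w v" "y w \<le> y v" "x' \<in> I w v" using Iv_outE by blast
    have "fbox p (x', y w) = s" unfolding fbox_def using x'(2) x0(3) by simp
    thus False using no_hit[OF v(1) _ v(3,2), of "y w"] v(2) by simp
  qed
  have key: "\<exists>x\<in>I u v. \<bar>x - p\<bar> < s \<and> 1 - y u < s \<and> 1 - y v < s"
    if uv: "adj u v" "y u \<le> y v" "w \<in> {u, v}" "I u v \<subseteq> Iv w" for u v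
  proof -
    have "a u v \<in> per \<eta> J" using a_in_I[OF uv(1,2)] uv(4) J(2) by blast
    then obtain k :: int where k: "a u v + of_int k * \<eta> \<in> J" unfolding per_iff by blast
    \<comment> \<open>The left end of \<open>I u v\<close>, moved to the lift that
      \<open>small\<close> controls.\<close>
    define x where "x = a u v + of_int (k - k0) * \<eta>"
    have "x + of_int k0 * \<eta> \<in> J" using k unfolding x_def by (simp add: algebra_simps)
    hence xs: "\<bar>x - p\<bar> < s" by (rule small)
    have xI: "x \<in> I u v" unfolding x_def using a_in_I[OF uv(1,2)] unfolding I_eq per_shift .
    have "1 - t < s" if t: "y u \<le> t" "t \<le> y v" for t
    proof (rule ccontr)
      assume nt: "\<not> 1 - t < s"
      have "t \<le> 1 - s" "1 - s < y w" using nt x0(3) by auto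
      hence "y u \<le> 1 - s" "1 - s \<le> y v" using t(1) uv(2,3) by auto
      moreover have "fbox p (x, 1 - s) = s" unfolding fbox_def using xs by simp
      ultimately show False using no_hit[OF uv(1,3) xI uv(2)] by blast
    qed
    thus ?thesis using xI xs uv(2) by (intro bexI[of _ x]) auto
  qed
  show ?thesis
  proof (cases "y w \<le> y w'")
    case True
    then obtain x where x: "x \<in> I w w'" "\<bar>x - p\<bar> < s" "1 - y w' < s"
      using key[OF ww' True _ I_subset_Iv[OF ww' True]] by blast
    hence "w' \<noteq> \<rho>" using s by auto
    hence "x \<in> Iv w'" using I_subset_Iv_in[OF ww' True] x(1) by blast
    thus ?thesis using x unfolding inside_box_def by blast
  next
    case False
    hence lt: "y w' \<le> y w" and w'w: "adj w' w" using adj_sym[OF ww'] by auto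
    obtain x where x: "x \<in> I w' w" "\<bar>x - p\<bar> < s" "1 - y w' < s"
      using key[OF w'w lt _ I_subset_Iv_in[OF w'w lt w\<rho>]] by blast
    thus ?thesis using I_subset_Iv[OF w'w lt] unfolding inside_box_def by blast
  qed
qed

lemma root_not_inside_box: "s < 1 \<Longrightarrow> \<rho> \<notin> inside_box p s"
  unfolding inside_box_def by simp

lemma eventually_inside_box:
  assumes s: "0 < s" and x: "\<And>n. x n \<in> Iv (vs n)" and lim: "(\<lambda>n. \<Phi> (x n)) \<longlonglongrightarrow> \<Phi> p"
    and y: "(\<lambda>n. y (vs n)) \<longlonglongrightarrow> 1"
  shows "eventually (\<lambda>n. vs n \<in> inside_box p s) sequentially"
proof -
  obtain e where e: "0 < e" "\<And>x. dist (\<Phi> x) (\<Phi> p) < e \<Longrightarrow> \<exists>k::int. \<bar>x + of_int k * \<eta> - p\<bar> < s"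
    using to_circle_near[OF \<eta>_pos s, of p] by metis
  have "eventually (\<lambda>n. dist (\<Phi> (x n)) (\<Phi> p) < e) sequentially" using lim e(1) by (rule tendstoD)
  moreover have "eventually (\<lambda>n. 1 - s < y (vs n)) sequentially"
    using y s by (intro order_tendstoD(1)) auto
  ultimately show ?thesis
  proof eventually_elim
    case (elim n)
    obtain k :: int where k: "\<bar>x n + of_int k * \<eta> - p\<bar> < s" using e(2)[OF elim(1)] by blast
    obtain J where "Iv (vs n) = per \<eta> J" using Iv_circle_interval[of "vs n"] unfolding circle_interval_def by blast
    hence "x n + of_int k * \<eta> \<in> Iv (vs n)" using x[of n] per_shift by simp
    thus ?case using k elim(2) unfolding inside_box_def by fastforce
  qed
qed

end

text \<open>If \<open>w\<close> is missed, the argument of \<open>- f z / w\<close> is a continuous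
  injective real function on the circle, since the principal branch is cut exactly at
  \<open>f z = w\<close>. Its difference at antipodal points is odd and so vanishes somewhere, which
  contradicts injectivity.\<close>

lemma continuous_injective_circle_surj:
  fixes f :: "complex \<Rightarrow> complex"
  assumes cont: "continuous_on (sphere 0 1) f" and inj: "inj_on f (sphere 0 1)"
    and im: "f ` sphere 0 1 \<subseteq> sphere 0 1"
  shows "f ` sphere 0 1 = sphere 0 1"
proof (rule ccontr)
  assume "f ` sphere 0 1 \<noteq> sphere 0 1"
  then obtain w where "w \<in> sphere 0 1" and w2: "w \<notin> f ` sphere 0 1" using im by blast
  hence w: "norm w = 1" "w \<notin> f ` sphere 0 1" by simp_all
  have w0: "w \<noteq> 0" using w(1) by auto
  define g where "g z = Im (Ln (- f z / w))" for z
  have fz: "norm (f z) = 1" "f z \<noteq> w" if "norm z = 1" for z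
    using that im w(2) by (auto simp: image_subset_iff image_iff)
  have nonneg: "- f z / w \<notin> \<real>\<^sub>\<le>\<^sub>0" if z: "norm z = 1" for z
  proof
    assume neg: "- f z / w \<in> \<real>\<^sub>\<le>\<^sub>0"
    hence "- f z / w = of_real (Re (- f z / w))" "Re (- f z / w) \<le> 0"
      by (auto simp: complex_nonpos_Reals_iff complex_eq_iff)
    moreover have "norm (- f z / w) = 1" using fz(1)[OF z] w(1) by (simp add: norm_divide)
    ultimately have "Re (- f z / w) = - 1" by (metis abs_minus_cancel abs_of_nonpos norm_of_real minus_minus)
    hence "- f z / w = - 1" using \<open>- f z / w = of_real _\<close> by simp
    thus False using fz(2)[OF z] w0 by (simp add: field_simps)
  qed
  have contg: "continuous_on (sphere 0 1) g"
    unfolding g_def using nonneg w0 by (intro continuous_intros cont) auto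
  have injg: "z = z'" if z: "norm z = 1" "norm z' = 1" "g z = g z'" for z z'
  proof -
    have "Ln (- f z / w) = Ln (- f z' / w)"
    proof (rule complex_eqI)
      have "Re (Ln (- f z / w)) = 0" if "norm z = 1" for z
        using fz(1)[OF that] w(1) w0 by (subst Re_Ln) (auto simp: norm_divide)
      thus "Re (Ln (- f z / w)) = Re (Ln (- f z' / w))" using z by simp
    qed (use z(3) g_def in simp)
    moreover have "- f z / w \<noteq> 0" "- f z' / w \<noteq> 0" using fz(1)[OF z(1)] fz(1)[OF z(2)] w0 by auto
    ultimately have "- f z / w = - f z' / w" by (metis exp_Ln)
    hence "f z = f z'" using w0 by simp
    thus "z = z'" using inj z by (auto dest: inj_onD)
  qed
  define d where "d z = g z - g (- z)" for z
  have "continuous_on (sphere 0 1) (\<lambda>z. g (- z))"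
    by (rule continuous_on_compose2[OF contg]) (auto intro: continuous_intros)
  hence "continuous_on (sphere 0 1) d" unfolding d_def using contg by (intro continuous_on_diff)
  hence "connected (d ` sphere 0 1)"
    by (intro connected_continuous_image connected_sphere) auto
  moreover have "d 1 \<in> d ` sphere 0 1" "- d 1 \<in> d ` sphere 0 1"
    by (auto simp: d_def intro: image_eqI[of _ _ "- 1"])
  ultimately have "0 \<in> d ` sphere 0 1"
    unfolding connected_iff_interval by (cases "0 \<le> d 1") (metis neg_le_0_iff_le, metis linear neg_0_le_iff_le)
  then obtain z where z: "norm z = 1" "g z = g (- z)" unfolding d_def by auto
  hence "z = - z" using injg[of z "- z"] by simp
  thus False using z(1) by auto
qed

lemma tendsto_of_dist_inverse_Suc:
  fixes f g :: "nat \<Rightarrow> complex"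
  assumes d: "\<And>n. dist (f n) (g n) < 1 / Suc n" and g: "g \<longlonglongrightarrow> l"
  shows "f \<longlonglongrightarrow> l"
proof -
  have "(\<lambda>n. f n - g n) \<longlonglongrightarrow> 0"
  proof (rule Lim_null_comparison)
    show "eventually (\<lambda>n. norm (f n - g n) \<le> 1 / Suc n) sequentially"
      using d by (auto simp: dist_norm intro!: always_eventually less_imp_le)
    show "(\<lambda>n. 1 / real (Suc n)) \<longlonglongrightarrow> 0" using LIMSEQ_Suc[OF lim_1_over_n] .
  qed
  from tendsto_add[OF this g] show ?thesis by simp
qed

context tiled_network
begin

section \<open>The length-area estimate for tiles\<close>

lemma sum_fst_le:
  assumes F: "finite F" "\<And>u v. (u, v) \<in> F \<Longrightarrow> adj u v" and g: "\<And>u. 0 \<le> g u"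
  shows "(\<Sum>e\<in>F. g (fst e)) \<le> M * (\<Sum>u\<in>fst ` F. g u)"
proof -
  have "(\<Sum>e\<in>F. g (fst e)) = (\<Sum>u\<in>fst ` F. \<Sum>e\<in>{e\<in>F. fst e = u}. g (fst e))"
    by (rule sum.image_gen[OF F(1)])
  also have "\<dots> \<le> (\<Sum>u\<in>fst ` F. M * g u)"
  proof (rule sum_mono)
    fix u assume "u \<in> fst ` F"
    have "{e\<in>F. fst e = u} \<subseteq> Pair u ` nbrs adj u" using F(2) unfolding nbrs_def by force
    hence "card {e\<in>F. fst e = u} \<le> card (Pair u ` nbrs adj u)" using finite_nbrs by (intro card_mono) auto
    also have "\<dots> \<le> card (nbrs adj u)" using finite_nbrs by (rule card_image_le)
    finally have "real (card {e\<in>F. fst e = u}) \<le> M" using deg[of u] by linarith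
    hence "real (card {e\<in>F. fst e = u}) * g u \<le> M * g u" using g by (rule mult_right_mono)
    thus "(\<Sum>e\<in>{e\<in>F. fst e = u}. g (fst e)) \<le> M * g u" by simp
  qed
  finally show ?thesis by (simp add: sum_distrib_left)
qed

lemma sum_snd_le:
  assumes F: "finite F" "\<And>u v. (u, v) \<in> F \<Longrightarrow> adj u v" and g: "\<And>u. 0 \<le> g u"
  shows "(\<Sum>e\<in>F. g (snd e)) \<le> M * (\<Sum>u\<in>snd ` F. g u)"
proof -
  have "(\<Sum>e\<in>F. g (snd e)) = (\<Sum>e\<in>prod.swap ` F. g (fst e))"
    by (subst sum.reindex) (auto simp: inj_on_def)
  also have "\<dots> \<le> M * (\<Sum>u\<in>fst ` prod.swap ` F. g u)"
    using F g by (intro sum_fst_le) (auto intro: adj_sym)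
  also have "fst ` prod.swap ` F = snd ` F" by force
  finally show ?thesis .
qed

text \<open>Two points of a short tile that are within \<open>\<eta> / 4\<close> of each other lie
  in the same lift of it, since changing the lift moves a point by at least
  \<open>\<eta>\<close>.\<close>

lemma same_lift:
  assumes len: "len u v < \<eta> / 4" and d: "\<bar>x - x'\<bar> \<le> \<eta> / 4"
    and k: "x + of_int k * \<eta> \<in> {a u v..a u v + len u v}" and k': "x' + of_int k' * \<eta> \<in> {a u v..a u v + len u v}"
  shows "k = k'" "\<bar>x - x'\<bar> \<le> len u v"
proof -
  have 1: "\<bar>(x + of_int k * \<eta>) - (x' + of_int k' * \<eta>)\<bar> \<le> len u v" using k k' by auto
  have "of_int (k - k') * \<eta> = ((x + of_int k * \<eta>) - (x' + of_int k' * \<eta>)) - (x - x')" by (simp add: algebra_simps)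
  hence "\<bar>of_int (k - k') * \<eta>\<bar> < \<eta>" using 1 len d \<eta>_pos by linarith
  hence "\<bar>real_of_int (k - k')\<bar> < 1" using \<eta>_pos by (simp add: abs_mult)
  thus "k = k'" by linarith
  thus "\<bar>x - x'\<bar> \<le> len u v" using 1 by simp
qed

text \<open>Conductances in \<open>[1 / M, M]\<close> make the width and the height of a tile
  comparable, so the squared variation of \<open>fbox\<close> over a tile, truncated at the scale,
  is bounded by an area. The mass of a tile is the sum of the radii at its two ends, and these are
  square-summable with a small tail.\<close>

lemma light_box:
  assumes F0: "finite F0" and e: "0 < e"
  obtains s where "0 < s" "s < 1" "generic p s" "sig p s \<inter> F0 = {}"
    "\<And>P. finite P \<Longrightarrow> P \<subseteq> sig p s \<Longrightarrow> sum r P \<le> e"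
proof -
  define M1 where "M1 = max M 1"
  have M1: "1 \<le> M1" "M \<le> M1" "0 < M1" unfolding M1_def by auto
  define C where "C = 18 * M1 ^ 3"
  have C0: "0 < C" unfolding C_def using M1 by simp
  \<comment> \<open>With this choice the product
    \<open>4 * M * \<tau> * (C * \<epsilon>\<^sup>2)\<close> of the two length-area bounds is half
    of \<open>(e * \<epsilon>)\<^sup>2\<close>.\<close>
  define \<tau> where "\<tau> = e\<^sup>2 / (8 * M * C)"
  have \<tau>: "0 < \<tau>" unfolding \<tau>_def using e M0 C0 by simp
  obtain F1 where F1: "finite F1" "\<And>F. finite F \<Longrightarrow> F \<inter> F1 = {} \<Longrightarrow> (\<Sum>v\<in>F. (r v)\<^sup>2) \<le> \<tau>"
    using finite_sums_tail[of "\<lambda>v. (r v)\<^sup>2" 1 \<tau>] sum_radii_le \<tau> by blast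
  \<comment> \<open>Edges above height \<open>1 - \<tau>0\<close> have length below
    \<open>\<eta> / 4\<close>, as \<open>same_lift\<close> requires.\<close>
  define \<tau>0 where "\<tau>0 = \<eta> / (8 * M)"
  have \<tau>0: "0 < \<tau>0" "M * \<tau>0 < \<eta> / 4" unfolding \<tau>0_def using \<eta>_pos M0 by auto
  define F2 where "F2 = {v. y v \<le> 1 - \<tau>0}"
  have finF2: "finite F2" unfolding F2_def using \<tau>0(1) by (intro finite_y_le) simp
  define F3 where "F3 = F0 \<union> F1 \<union> F2"
  \<comment> \<open>With the neighbours of \<open>F3\<close> included, an upper end outside
    \<open>F4\<close> keeps the lower end outside \<open>F3\<close>.\<close>
  define F4 where "F4 = F3 \<union> (\<Union>v\<in>F3. nbrs adj v)"
  have finF3: "finite F3" unfolding F3_def using F0 F1(1) finF2 by simp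
  have finF4: "finite F4" unfolding F4_def using finF3 finite_nbrs by blast
  define Y where "Y = Max (insert 0 (y ` F4))"
  have "Y \<in> insert 0 (y ` F4)" unfolding Y_def using finF4 by (intro Max_in) auto
  hence Y1: "Y < 1" using y_lt_1 by auto
  have Yge: "y v \<le> Y" if "v \<in> F4" for v unfolding Y_def using finF4 that by (intro Max_ge) auto
  have Y0: "0 \<le> Y" unfolding Y_def using finF4 by (intro Max_ge) auto
  \<comment> \<open>Contours of radius up to \<open>2 * \<epsilon>\<close> stay above all of
    \<open>F4\<close>, and any two of their points differ horizontally by at most
    \<open>\<eta> / 4\<close>.\<close>
  define \<epsilon> where "\<epsilon> = min ((1 - Y) / 4) (\<eta> / 16)"
  have \<epsilon>: "0 < \<epsilon>" "2 * \<epsilon> < 1 - Y" "4 * \<epsilon> \<le> \<eta> / 4" unfolding \<epsilon>_def using Y1 \<eta>_pos by (auto simp: min_def)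
  define X where "X = {(u, v). \<exists>s\<in>{\<epsilon>..2*\<epsilon>}. hits p s u v}"
  have XD: "adj u v" "y u < y v" "u \<notin> F3" "v \<notin> F3" if uvX: "(u, v) \<in> X" for u v
  proof -
    obtain s where s: "s \<in> {\<epsilon>..2*\<epsilon>}" "hits p s u v" using uvX unfolding X_def by blast
    thus uv: "adj u v" "y u < y v" unfolding hits_def by auto
    obtain z where z: "z \<in> box_boundary p s" "z \<in> S u v" using s(2) unfolding hits_def by blast
    have "snd z \<le> y v" using z(2) S_eq[of u v] uv(2) by auto
    hence "Y < y v" using box_boundary_cases(2)[OF z(1)] s(1) \<epsilon>(2) by auto
    hence v4: "v \<notin> F4" using Yge[of v] by linarith
    thus "v \<notin> F3" unfolding F4_def by blast
    show "u \<notin> F3" using v4 uv(1) unfolding F4_def nbrs_def by blast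
  qed
  define dy where "dy = (\<lambda>(u, v). y v - y u)"
  have len_le: "len u v \<le> M * (y v - y u)" "y v - y u \<le> M * len u v" "len u v < \<eta> / 4" "0 < len u v" if "(u, v) \<in> X" for u v
  proof -
    note uv = XD[OF that]
    have cb: "inverse M \<le> c u v" "c u v \<le> M" using c_bounds[OF uv(1)] by auto
    show l: "len u v \<le> M * (y v - y u)" using cb uv(2) by (intro mult_right_mono) auto
    have "1 \<le> M * c u v" using cb(1) M0 by (simp add: field_simps)
    hence "1 * (y v - y u) \<le> M * c u v * (y v - y u)" using uv(2) by (intro mult_right_mono) auto
    thus "y v - y u \<le> M * len u v" by (simp add: mult.assoc)
    have "u \<notin> F2" using uv(3) unfolding F3_def by blast
    hence "1 - \<tau>0 < y u" unfolding F2_def by simp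
    hence "y v - y u < \<tau>0" using y_lt_1[of v] by simp
    hence "M * (y v - y u) < M * \<tau>0" using M0 by simp
    thus "len u v < \<eta> / 4" using l \<tau>0(2) by linarith
    show "0 < len u v" by (rule len_pos[OF uv(1,2)])
  qed
  have in_box: "\<exists>k::int. fst z + of_int k * \<eta> \<in> {a u v..a u v + len u v} \<and> y u \<le> snd z \<and> snd z \<le> y v
      \<and> \<bar>fst z - p\<bar> \<le> 2 * \<epsilon> \<and> 1 - 2 * \<epsilon> \<le> snd z"
    if "(u, v) \<in> X" "s \<in> {\<epsilon>..2*\<epsilon>}" "z \<in> box_boundary p s" "z \<in> S u v" for u v s z
  proof -
    have "z \<in> I u v \<times> {y u..y v}" using that(4) S_eq[of u v] XD(2)[OF that(1)] by simp
    hence zz: "fst z \<in> I u v" "y u \<le> snd z" "snd z \<le> y v" by auto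
    moreover obtain k :: int where "fst z + of_int k * \<eta> \<in> {a u v..a u v + len u v}" using zz(1) unfolding I_eq per_iff by blast
    ultimately show ?thesis using box_boundary_cases(2,3)[OF that(3)] that(2) by auto
  qed
  define d where "d e = min \<epsilon> (M1 * dy e)" for e
  have hit: "\<exists>l. \<forall>s\<in>{\<epsilon>..2*\<epsilon>}. hits p s (fst e) (snd e) \<longrightarrow> l \<le> s \<and> s \<le> l + d e" if "e \<in> X" for e
  proof -
    obtain u v where uv: "e = (u, v)" by fastforce
    define H where "H = {s\<in>{\<epsilon>..2*\<epsilon>}. hits p s u v}"
    have "\<bar>s - s'\<bar> \<le> d e" if s: "s \<in> H" "s' \<in> H" for s s'
    proof -
      have X: "(u, v) \<in> X" using \<open>e \<in> X\<close> uv by simp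
      have s\<epsilon>: "s \<in> {\<epsilon>..2*\<epsilon>}" "s' \<in> {\<epsilon>..2*\<epsilon>}" using s unfolding H_def by auto
      obtain z where z: "z \<in> box_boundary p s" "z \<in> S u v" using s(1) unfolding H_def hits_def by blast
      obtain z' where z': "z' \<in> box_boundary p s'" "z' \<in> S u v" using s(2) unfolding H_def hits_def by blast
      obtain k :: int where k: "fst z + of_int k * \<eta> \<in> {a u v..a u v + len u v}" "y u \<le> snd z" "snd z \<le> y v" "\<bar>fst z - p\<bar> \<le> 2 * \<epsilon>"
        using in_box[OF X s\<epsilon>(1) z] by blast
      obtain k' :: int where k': "fst z' + of_int k' * \<eta> \<in> {a u v..a u v + len u v}" "y u \<le> snd z'" "snd z' \<le> y v" "\<bar>fst z' - p\<bar> \<le> 2 * \<epsilon>"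
        using in_box[OF X s\<epsilon>(2) z'] by blast
      have "\<bar>fst z - fst z'\<bar> \<le> \<eta> / 4" using k(4) k'(4) \<epsilon>(3) by linarith
      hence "\<bar>fst z - fst z'\<bar> \<le> len u v" using same_lift(2)[OF len_le(3)[OF X] _ k(1) k'(1)] by blast
      also have "\<dots> \<le> M * (y v - y u)" by (rule len_le(1)[OF X])
      also have "\<dots> \<le> M1 * (y v - y u)" using M1 XD(2)[OF X] by (intro mult_right_mono) auto
      finally have 1: "\<bar>fst z - fst z'\<bar> \<le> M1 * (y v - y u)" .
      have "\<bar>snd z - snd z'\<bar> \<le> 1 * (y v - y u)" using k(2,3) k'(2,3) by (simp add: abs_le_iff)
      also have "\<dots> \<le> M1 * (y v - y u)" using M1 XD(2)[OF X] by (intro mult_right_mono) auto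
      finally have "\<bar>fbox p z - fbox p z'\<bar> \<le> M1 * (y v - y u)" using 1 fbox_diff_le[of p z z'] by linarith
      moreover have "fbox p z = s" "fbox p z' = s'" using z(1) z'(1) unfolding box_boundary_def by auto
      ultimately have "\<bar>s - s'\<bar> \<le> M1 * dy e" unfolding dy_def uv by simp
      moreover have "\<bar>s - s'\<bar> \<le> \<epsilon>" using s\<epsilon> by auto
      ultimately show ?thesis unfolding d_def by simp
    qed
    then obtain l where "\<forall>s\<in>H. l \<le> s \<and> s \<le> l + d e" using interval_of_small_differences by blast
    thus ?thesis unfolding H_def by (intro exI[of _ l]) (simp add: uv)
  qed
  have area: "(\<Sum>e\<in>F. (d e)\<^sup>2) \<le> C * \<epsilon>\<^sup>2" if F: "finite F" "F \<subseteq> X" for F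
  proof -
    \<comment> \<open>As for large discs, a tile is replaced by a rectangle inside it with sides at
      most \<open>\<epsilon>\<close>, near a contour point.\<close>
    define w where "w = (\<lambda>(u, v). min (len u v) \<epsilon>)"
    define h where "h e = min (dy e) \<epsilon>" for e
    have ex: "\<forall>e\<in>F. \<exists>q. case e of (u, v) \<Rightarrow> case q of (x, t, k :: int) \<Rightarrow>
        x + of_int k * \<eta> \<in> {a u v..a u v + len u v} \<and> y u \<le> t \<and> t \<le> y v \<and> \<bar>x - p\<bar> \<le> 2 * \<epsilon> \<and> 1 - 2 * \<epsilon> \<le> t"
    proof
      fix e assume "e \<in> F"
      obtain u v where uv: "e = (u, v)" by fastforce
      hence X: "(u, v) \<in> X" using \<open>e \<in> F\<close> F(2) by blast
      then obtain s where s: "s \<in> {\<epsilon>..2*\<epsilon>}" "hits p s u v" unfolding X_def by blast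
      then obtain z where z: "z \<in> box_boundary p s" "z \<in> S u v" unfolding hits_def by blast
      obtain k :: int where "fst z + of_int k * \<eta> \<in> {a u v..a u v + len u v} \<and> y u \<le> snd z \<and> snd z \<le> y v
        \<and> \<bar>fst z - p\<bar> \<le> 2 * \<epsilon> \<and> 1 - 2 * \<epsilon> \<le> snd z" using in_box[OF X s(1) z] by blast
      thus "\<exists>q. case e of (u, v) \<Rightarrow> case q of (x, t, k :: int) \<Rightarrow>
        x + of_int k * \<eta> \<in> {a u v..a u v + len u v} \<and> y u \<le> t \<and> t \<le> y v \<and> \<bar>x - p\<bar> \<le> 2 * \<epsilon> \<and> 1 - 2 * \<epsilon> \<le> t"
        unfolding uv by (intro exI[of _ "(fst z, snd z, k)"]) simp
    qed
    from bchoice[OF ex] obtain q where q: "\<forall>e\<in>F. case e of (u, v) \<Rightarrow> case q e of (x, t, k :: int) \<Rightarrow>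
        x + of_int k * \<eta> \<in> {a u v..a u v + len u v} \<and> y u \<le> t \<and> t \<le> y v \<and> \<bar>x - p\<bar> \<le> 2 * \<epsilon> \<and> 1 - 2 * \<epsilon> \<le> t" by blast
    define xx where "xx e = fst (q e)" for e
    define tt where "tt e = fst (snd (q e))" for e
    define kk where "kk e = snd (snd (q e))" for e
    have q': "xx (u, v) + of_int (kk (u, v)) * \<eta> \<in> {a u v..a u v + len u v}" "y u \<le> tt (u, v)" "tt (u, v) \<le> y v"
      "\<bar>xx (u, v) - p\<bar> \<le> 2 * \<epsilon>" "1 - 2 * \<epsilon> \<le> tt (u, v)" if "(u, v) \<in> F" for u v
      using bspec[OF q that] unfolding xx_def tt_def kk_def by (auto simp: split_beta)
    \<comment> \<open>The lower left corner starts at the contour point and is pushed back only as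
      far as the rectangle needs to fit into the tile.\<close>
    define X0 where "X0 = (\<lambda>(u, v). min (xx (u, v)) (a u v + len u v - of_int (kk (u, v)) * \<eta> - w (u, v)))"
    define T0 where "T0 = (\<lambda>(u, v). min (tt (u, v)) (y v - h (u, v)))"
    have wh: "0 \<le> w (u, v)" "0 \<le> h (u, v)" "w (u, v) \<le> len u v" "w (u, v) \<le> \<epsilon>" "h (u, v) \<le> y v - y u" "h (u, v) \<le> \<epsilon>"
      if "(u, v) \<in> F" for u v
    proof -
      have "(u, v) \<in> X" using that F(2) by blast
      thus "0 \<le> w (u, v)" "0 \<le> h (u, v)" "w (u, v) \<le> len u v" "w (u, v) \<le> \<epsilon>" "h (u, v) \<le> y v - y u" "h (u, v) \<le> \<epsilon>"
        using len_le(4)[of u v] XD(2)[of u v] \<epsilon>(1) unfolding w_def h_def dy_def by auto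
    qed
    have rect: "{X0 e<..<X0 e + w e} \<times> {T0 e<..<T0 e + h e} \<subseteq> interior (S (fst e) (snd e))" if "e \<in> F" for e
    proof -
      obtain u v where uv: "e = (u, v)" by fastforce
      have uvF: "(u, v) \<in> F" using that uv by simp
      have "y u \<le> y v" using XD(2)[of u v] uvF F(2) by auto
      thus ?thesis unfolding uv fst_conv snd_conv
        using q'(1-3)[OF uvF] wh[OF uvF]
        by (intro open_box_subset_tile[where k = "kk (u, v)"]) (auto simp: X0_def T0_def min_def)
    qed
    \<comment> \<open>All rectangles lie in a box of width \<open>6 * \<epsilon>\<close> and height
      \<open>3 * \<epsilon>\<close>, hence the 18 in \<open>C\<close>.\<close>
    have "(\<Sum>e\<in>F. w e * h e) \<le> ((p + 3 * \<epsilon>) - (p - 3 * \<epsilon>)) * (1 - (1 - 3 * \<epsilon>))"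
    proof (rule sum_rectangle_areas_le[where X = X0 and T = T0])
      fix e assume "e \<in> F"
      obtain u v where uv: "e = (u, v)" by fastforce
      have uvF: "(u, v) \<in> F" using \<open>e \<in> F\<close> uv by simp
      show "0 \<le> w e" "0 \<le> h e" using wh[OF uvF] uv by auto
      have "xx (u, v) - w (u, v) \<le> X0 (u, v)" "X0 (u, v) \<le> xx (u, v)" "T0 (u, v) \<le> y v - h (u, v)" "tt (u, v) - h (u, v) \<le> T0 (u, v)"
        using q'(1-3)[OF uvF] wh(1,2)[OF uvF] unfolding X0_def T0_def by (auto simp: min_def)
      thus "p - 3 * \<epsilon> \<le> X0 e \<and> X0 e + w e \<le> p + 3 * \<epsilon> \<and> 1 - 3 * \<epsilon> \<le> T0 e \<and> T0 e + h e \<le> 1"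
        using q'(4,5)[OF uvF] wh(4,6)[OF uvF] y_lt_1[of v] unfolding uv by linarith
    next
      fix e e' assume ee: "e \<in> F" "e' \<in> F" "e \<noteq> e'"
      obtain u v where uv: "e = (u, v)" by fastforce
      obtain u' v' where uv': "e' = (u', v')" by fastforce
      have X: "adj u v" "y u < y v" "adj u' v'" "y u' < y v'" using XD[of u v] XD[of u' v'] ee F(2) uv uv' by auto
      have "{u, v} \<noteq> {u', v'}" using X(2,4) ee(3) uv uv' by (auto simp: doubleton_eq_iff)
      hence "interior (S u v) \<inter> interior (S u' v') = {}" using X by (intro tile_interiors_disjoint)
      thus "({X0 e<..<X0 e + w e} \<times> {T0 e<..<T0 e + h e}) \<inter> ({X0 e'<..<X0 e' + w e'} \<times> {T0 e'<..<T0 e' + h e'}) = {}"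
        using rect[OF ee(1)] rect[OF ee(2)] uv uv' by auto
    qed (use F(1) \<epsilon>(1) in auto)
    hence tot: "(\<Sum>e\<in>F. w e * h e) \<le> 18 * \<epsilon>\<^sup>2" by (simp add: power2_eq_square algebra_simps)
    \<comment> \<open>Both \<open>d e \<le> M1 * h e\<close> and \<open>h e \<le> M1 * w e\<close>
      hold, as \<open>M1 \<ge> 1\<close> is compatible with truncation at \<open>\<epsilon>\<close>;
      together they give the factor \<open>M1 ^ 3\<close>.\<close>
    have "(d e)\<^sup>2 \<le> M1 ^ 3 * (w e * h e)" if "e \<in> F" for e
    proof -
      obtain u v where uv: "e = (u, v)" by fastforce
      have uvF: "(u, v) \<in> F" using that uv by simp
      hence uvX: "(u, v) \<in> X" using F(2) by blast
      have h0: "0 \<le> h e" "0 \<le> w e" using wh[OF uvF] uv by auto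
      have "\<epsilon> \<le> M1 * \<epsilon>" using M1 \<epsilon>(1) by simp
      moreover have "M1 * h e = min (M1 * dy e) (M1 * \<epsilon>)" unfolding h_def using M1 by (simp add: min_mult_distrib_left)
      ultimately have dh: "d e \<le> M1 * h e" unfolding d_def by (auto simp: min_def)
      have "y v - y u \<le> M1 * len u v"
        using len_le(2)[OF uvX] mult_right_mono[OF M1(2), of "len u v"] len_le(4)[OF uvX] by linarith
      moreover have "M1 * w e = min (M1 * len u v) (M1 * \<epsilon>)" unfolding w_def uv using M1 by (simp add: min_mult_distrib_left)
      moreover have "h e = min (y v - y u) \<epsilon>" unfolding h_def dy_def uv by simp
      ultimately have hw: "h e \<le> M1 * w e" using \<open>\<epsilon> \<le> M1 * \<epsilon>\<close> by (auto simp: min_def)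
      have "0 \<le> d e" using XD(2)[OF uvX] \<epsilon>(1) M1 unfolding d_def dy_def uv by auto
      hence "(d e)\<^sup>2 \<le> (M1 * h e)\<^sup>2" using dh by (intro power_mono)
      also have "\<dots> = M1\<^sup>2 * h e * h e" by (simp add: power2_eq_square)
      also have "\<dots> \<le> M1\<^sup>2 * h e * (M1 * w e)" using hw h0 by (intro mult_left_mono) auto
      also have "\<dots> = M1 ^ 3 * (w e * h e)" by (simp add: power2_eq_square power3_eq_cube)
      finally show ?thesis .
    qed
    hence "(\<Sum>e\<in>F. (d e)\<^sup>2) \<le> (\<Sum>e\<in>F. M1 ^ 3 * (w e * h e))" by (rule sum_mono)
    also have "\<dots> \<le> M1 ^ 3 * (18 * \<epsilon>\<^sup>2)" unfolding sum_distrib_left[symmetric] using tot M1 by (intro mult_left_mono) auto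
    finally show ?thesis unfolding C_def by simp
  qed
  define m where "m e = r (fst e) + r (snd e)" for e
  have mass: "(\<Sum>e\<in>F. (m e)\<^sup>2) \<le> 4 * M * \<tau>" if F: "finite F" "F \<subseteq> X" for F
  proof -
    have adjF: "adj u v" if "(u, v) \<in> F" for u v using XD(1) that F(2) by blast
    have "(\<Sum>e\<in>F. (m e)\<^sup>2) \<le> (\<Sum>e\<in>F. 2 * (r (fst e))\<^sup>2 + 2 * (r (snd e))\<^sup>2)"
    proof (rule sum_mono)
      fix e
      have "0 \<le> (r (fst e) - r (snd e))\<^sup>2" by simp
      thus "(m e)\<^sup>2 \<le> 2 * (r (fst e))\<^sup>2 + 2 * (r (snd e))\<^sup>2" unfolding m_def by (simp add: power2_eq_square algebra_simps)
    qed
    also have "\<dots> = 2 * (\<Sum>e\<in>F. (r (fst e))\<^sup>2) + 2 * (\<Sum>e\<in>F. (r (snd e))\<^sup>2)"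
      by (simp add: sum.distrib sum_distrib_left)
    also have "(\<Sum>e\<in>F. (r (fst e))\<^sup>2) \<le> M * (\<Sum>u\<in>fst ` F. (r u)\<^sup>2)"
      by (rule sum_fst_le[OF F(1) adjF, of "\<lambda>u. (r u)\<^sup>2"]) auto
    also have "(\<Sum>e\<in>F. (r (snd e))\<^sup>2) \<le> M * (\<Sum>u\<in>snd ` F. (r u)\<^sup>2)"
      by (rule sum_snd_le[OF F(1) adjF, of "\<lambda>u. (r u)\<^sup>2"]) auto
    also have "(\<Sum>u\<in>fst ` F. (r u)\<^sup>2) \<le> \<tau>"
    proof (rule F1(2))
      show "fst ` F \<inter> F1 = {}" using XD(3) F(2) unfolding F3_def by fastforce
    qed (use F(1) in simp)
    also have "(\<Sum>u\<in>snd ` F. (r u)\<^sup>2) \<le> \<tau>"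
    proof (rule F1(2))
      show "snd ` F \<inter> F1 = {}" using XD(4) F(2) unfolding F3_def by fastforce
    qed (use F(1) in simp)
    finally show ?thesis using M0 by simp
  qed
  have sq: "sqrt (4 * M * \<tau> * (C * \<epsilon>\<^sup>2)) < e * \<epsilon>"
  proof -
    have "4 * M * \<tau> * (C * \<epsilon>\<^sup>2) = (e * \<epsilon>)\<^sup>2 / 2" unfolding \<tau>_def using M0 C0 by (simp add: power_mult_distrib)
    also have "\<dots> < (e * \<epsilon>)\<^sup>2" using e \<epsilon>(1) by simp
    finally show ?thesis using e \<epsilon>(1) by (intro real_less_lsqrt) auto
  qed
  obtain s where s: "s \<in> {\<epsilon>..2*\<epsilon>} - {s. \<not> generic p s}"
    "\<And>F. finite F \<Longrightarrow> F \<subseteq> {e\<in>X. hits p s (fst e) (snd e)} \<Longrightarrow> sum m F \<le> e"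
  proof (rule length_area[where X = X and N = "{s. \<not> generic p s}" and m = m and d = d
        and hit = "\<lambda>e s. hits p s (fst e) (snd e)" and A = "4 * M * \<tau>" and B = "C * \<epsilon>\<^sup>2" and c = e])
    have "countable (UNIV \<times> UNIV :: ('v \<times> 'v) set)" using countable_V by (intro countable_SIGMA)
    thus "countable X" by (rule countable_subset[rotated]) simp
    fix e assume "e \<in> X"
    thus "0 \<le> d e" using XD(2)[of "fst e" "snd e"] \<epsilon>(1) M1 unfolding d_def dy_def by (auto simp: split_beta)
    show "0 \<le> m e" unfolding m_def using r_pos[of "fst e"] r_pos[of "snd e"] by simp
  qed (use \<epsilon>(1) countable_non_generic hit mass area sq in auto)
  have hX: "(u, v) \<in> X" if "hits p s u v" for u v using that s(1) unfolding X_def by blast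
  show thesis
  proof (rule that)
    show "0 < s" "s < 1" "generic p s" using s(1) \<epsilon> Y0 by auto
    have "w \<notin> F0" if w: "w \<in> sig p s" for w
    proof -
      obtain u v where "hits p s u v" "w \<in> {u, v}" using w unfolding sig_def by blast
      thus ?thesis using XD(3,4)[OF hX] unfolding F3_def by blast
    qed
    thus "sig p s \<inter> F0 = {}" by blast
    fix P assume P: "finite P" "P \<subseteq> sig p s"
    hence "\<forall>w\<in>P. \<exists>e. hits p s (fst e) (snd e) \<and> w \<in> {fst e, snd e}" unfolding sig_def by fastforce
    from bchoice[OF this] obtain g where g: "\<And>w. w \<in> P \<Longrightarrow> hits p s (fst (g w)) (snd (g w)) \<and> w \<in> {fst (g w), snd (g w)}" by blast
    \<comment> \<open>Each vertex is charged to one hitting edge \<open>g w\<close>, and each edge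
      is charged at most by its two ends.\<close>
    have "sum r P = (\<Sum>e\<in>g ` P. \<Sum>w\<in>{w\<in>P. g w = e}. r w)" by (rule sum.image_gen[OF P(1)])
    also have "\<dots> \<le> (\<Sum>e\<in>g ` P. m e)"
    proof (rule sum_mono)
      fix e
      have "(\<Sum>w\<in>{w\<in>P. g w = e}. r w) \<le> (\<Sum>w\<in>{fst e, snd e}. r w)"
        using g r_pos by (intro sum_mono2) (auto simp: less_imp_le)
      also have "\<dots> \<le> m e" unfolding m_def using r_pos[of "snd e"] by (cases "fst e = snd e") auto
      finally show "(\<Sum>w\<in>{w\<in>P. g w = e}. r w) \<le> m e" .
    qed
    also have "\<dots> \<le> e"
    proof (rule s(2))
      show "g ` P \<subseteq> {e\<in>X. hits p s (fst e) (snd e)}" using g hX by force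
    qed (use P(1) in simp)
    finally show "sum r P \<le> e" .
  qed
qed

end

section \<open>The boundary map\<close>

context tiled_network
begin

text \<open>A light box around the common limit in the cylinder separates the tails of both sequences
  from the root by a set of discs of small total diameter near the unit circle, but a radial path
  to one of the two boundary points avoids any such set.\<close>

lemma limit_injective:
  assumes \<xi>: "norm \<xi> = 1" "norm \<xi>' = 1"
    and lim: "(\<lambda>n. ctr (vs n)) \<longlonglongrightarrow> \<xi>" "(\<lambda>n. ctr (vs' n)) \<longlonglongrightarrow> \<xi>'"
    and x: "\<And>n. x n \<in> Iv (vs n)" "\<And>n. x' n \<in> Iv (vs' n)"
    and \<Phi>: "(\<lambda>n. \<Phi> (x n)) \<longlonglongrightarrow> w" "(\<lambda>n. \<Phi> (x' n)) \<longlonglongrightarrow> w"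
  shows "\<xi> = \<xi>'"
proof (rule ccontr)
  assume "\<xi> \<noteq> \<xi>'"
  define \<Delta> where "\<Delta> = dist \<xi> \<xi>'"
  have \<Delta>: "0 < \<Delta>" unfolding \<Delta>_def using \<open>\<xi> \<noteq> \<xi>'\<close> by simp
  have "(\<lambda>n. norm (\<Phi> (x n))) \<longlonglongrightarrow> norm w" by (rule tendsto_norm[OF \<Phi>(1)])
  hence "norm w = 1" by (simp add: LIMSEQ_const_iff)
  define p where "p = \<eta> * Arg w / (2 * pi)"
  have "\<Phi> p = cis (Arg w)" unfolding to_circle_def p_def using \<eta>_pos by simp
  also have "\<dots> = w" using \<open>norm w = 1\<close> by (metis rcis_cmod_Arg rcis_def mult_1 of_real_1)
  finally have pw: "\<Phi> p = w" .
  have "ctr \<rho> \<in> ball 0 1" using D_subset[of \<rho>] centre_in_D[of \<rho>] by blast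
  hence \<rho>1: "norm (ctr \<rho>) < 1" by simp
  \<comment> \<open>The contour discs will form a set of size of order \<open>\<kappa>\<close> close
    to the unit circle; \<open>16 * \<kappa> \<le> \<Delta>\<close> keeps it from blocking both
    radii, and the root lies deeper than the contour.\<close>
  define \<kappa> where "\<kappa> = min (\<Delta> / 16) ((1 - norm (ctr \<rho>)) / 4)"
  have \<kappa>: "0 < \<kappa>" "16 * \<kappa> \<le> \<Delta>" "norm (ctr \<rho>) \<le> 1 - 4 * \<kappa>" unfolding \<kappa>_def using \<Delta> \<rho>1 by (auto simp: min_def field_simps)
  define \<delta> where "\<delta> = \<kappa> / 2"
  have \<delta>: "0 < \<delta>" unfolding \<delta>_def using \<kappa>(1) by simp
  have "finite {v. norm (ctr v) \<le> 1 - \<kappa>}" using \<kappa>(1) by (intro finite_centres) simp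
  then obtain s where s: "0 < s" "s < 1" "generic p s" "sig p s \<inter> {v. norm (ctr v) \<le> 1 - \<kappa>} = {}"
    "\<And>P. finite P \<Longrightarrow> P \<subseteq> sig p s \<Longrightarrow> sum r P \<le> \<delta> / 2"
    using light_box[where ?F0.0 = "{v. norm (ctr v) \<le> 1 - \<kappa>}" and e = "\<delta> / 2" and p = p] \<delta> by (metis half_gt_zero)
  have far: "1 - \<kappa> < norm (ctr v)" if "v \<in> sig p s" for v using s(4) that by fastforce
  have ev: "eventually (\<lambda>n. vs n \<in> inside_box p s) sequentially" "eventually (\<lambda>n. vs' n \<in> inside_box p s) sequentially"
    using eventually_inside_box[where p = p, OF s(1) x(1)] eventually_inside_box[where p = p, OF s(1) x(2)] \<Phi> pw
      y_tendsto_1[OF \<xi>(1) lim(1)] y_tendsto_1[OF \<xi>(2) lim(2)] by simp_all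
  show False
  proof (cases "sig p s = {}")
    \<comment> \<open>Without contour vertices nothing stops \<open>inside_box\<close> from
      spreading along edges to the root.\<close>
    case True
    obtain n where "vs n \<in> inside_box p s" using ev(1) eventually_happens by force
    hence "inside_box p s = UNIV"
      by (rule closed_under_adj_UNIV) (use inside_box_nbr[OF s(3,2)] True in blast)
    thus False using root_not_inside_box[OF s(2)] by blast
  next
    case False
    then obtain v0 where v0: "v0 \<in> sig p s" by blast
    define q where "q = ctr v0"
    have nq: "1 - \<kappa> < norm q" unfolding q_def by (rule far[OF v0])
    have near: "dist q z \<le> \<delta>" if "v \<in> sig p s" "z \<in> D v" for v z
    proof (rule linked_dist_le[OF linked_sig[OF s(3,1,2)], where K = D and d = "\<lambda>v. 2 * r v" and i = v0 and j = v])
      fix i j assume "adj i j"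
      thus "D i \<inter> D j \<noteq> {}" using adj_iff[OF adj_neq] by blast
    next
      fix i z z' assume "z \<in> D i" "z' \<in> D i"
      thus "dist z z' \<le> 2 * r i" using dist_triangle3[of z z' "ctr i"] by simp
    next
      fix P assume "finite P" "P \<subseteq> sig p s"
      thus "(\<Sum>v\<in>P. 2 * r v) \<le> \<delta>" using s(5)[of P] by (simp add: sum_distrib_left[symmetric])
    qed (use v0 that r_pos in \<open>auto simp: q_def less_imp_le\<close>)
    \<comment> \<open>A point of a radius that is close to \<open>q\<close> has norm close to 1, so
      \<open>q\<close> is within \<open>3 * \<kappa>\<close> of the end of that radius; this cannot
      hold for both ends.\<close>
    have clear: "\<exists>\<zeta>\<in>{\<xi>, \<xi>'}. \<forall>t\<in>{0..1}. 2 * \<delta> < dist q (t *\<^sub>R \<zeta>)"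
    proof (rule ccontr)
      assume neg: "\<not> ?thesis"
      have "dist q \<zeta> \<le> 3 * \<kappa>" if \<zeta>: "\<zeta> \<in> {\<xi>, \<xi>'}" for \<zeta>
      proof -
        obtain t where t: "t \<in> {0..1}" "dist q (t *\<^sub>R \<zeta>) \<le> 2 * \<delta>" using neg \<zeta> by (meson not_less)
        have n: "norm \<zeta> = 1" using \<zeta> \<xi> by auto
        have "norm q \<le> norm (t *\<^sub>R \<zeta>) + dist q (t *\<^sub>R \<zeta>)"
          using norm_triangle_ineq[of "t *\<^sub>R \<zeta>" "q - t *\<^sub>R \<zeta>"] by (simp add: dist_norm)
        hence "1 - \<kappa> - 2 * \<delta> \<le> t" using nq t n by simp
        moreover have "dist (t *\<^sub>R \<zeta>) \<zeta> = 1 - t"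
        proof -
          have "t *\<^sub>R \<zeta> - \<zeta> = (t - 1) *\<^sub>R \<zeta>" by (simp add: algebra_simps)
          thus ?thesis using t(1) n by (simp add: dist_norm)
        qed
        ultimately show ?thesis using t(2) dist_triangle[of q \<zeta> "t *\<^sub>R \<zeta>"] unfolding \<delta>_def by simp
      qed
      hence "dist q \<xi> \<le> 3 * \<kappa>" "dist q \<xi>' \<le> 3 * \<kappa>" by auto
      hence "\<Delta> \<le> 6 * \<kappa>" unfolding \<Delta>_def using dist_triangle3[of \<xi> \<xi>' q] by simp
      thus False using \<kappa>(1,2) by simp
    qed
    have contra: False
      if \<zeta>: "norm \<zeta> = 1" "\<forall>t\<in>{0..1}. 2 * \<delta> < dist q (t *\<^sub>R \<zeta>)" and us: "(\<lambda>n. ctr (us n)) \<longlonglongrightarrow> \<zeta>"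
        "eventually (\<lambda>n. us n \<in> inside_box p s) sequentially" for \<zeta> and us :: "nat \<Rightarrow> 'v"
    proof -
      have "eventually (\<lambda>n. dist (ctr (us n)) \<zeta> < \<delta>) sequentially" using us(1) \<delta> by (rule tendstoD)
      with us(2) have "eventually (\<lambda>n. us n \<in> inside_box p s \<and> dist (ctr (us n)) \<zeta> < \<delta>) sequentially"
        by (rule eventually_conj)
      then obtain n where n: "us n \<in> inside_box p s" "dist (ctr (us n)) \<zeta> < \<delta>" using eventually_happens by force
      \<comment> \<open>The path runs from the root through the origin to a vertex in the box and
        avoids the contour discs. The discs along it are linked, so membership in
        \<open>inside_box\<close> would be handed on to the root.\<close>
      define L where "L = closed_segment 0 (ctr \<rho>) \<union> closed_segment 0 (ctr (us n))"
      have "connected L" unfolding L_def by (intro connected_Un connected_segment) auto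
      moreover have "ctr v \<in> ball 0 1" for v using D_subset centre_in_D by blast
      hence "L \<subseteq> ball 0 1" unfolding L_def by (intro Un_least closed_segment_subset) auto
      ultimately have link: "linked adj {v. D v \<inter> L \<noteq> {}}" by (rule linked_discs)
      have away: "\<delta> < dist q z" if zL: "z \<in> L" for z
      proof -
        consider "z \<in> closed_segment 0 (ctr \<rho>)" | t where "t \<in> {0..1}" "z = t *\<^sub>R ctr (us n)"
          using zL unfolding L_def by (auto simp: closed_segment_def)
        thus ?thesis
        proof cases
          case 1
          then obtain t where "0 \<le> t" "t \<le> 1" "z = t *\<^sub>R ctr \<rho>" by (auto simp: closed_segment_def)
          hence "norm z \<le> 1 - 4 * \<kappa>" using \<kappa>(3) mult_left_le_one_le[of "norm (ctr \<rho>)" t] by simp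
          moreover have "norm q \<le> norm z + dist q z" using norm_triangle_ineq[of z "q - z"] by (simp add: dist_norm)
          ultimately show ?thesis using nq \<kappa>(1) unfolding \<delta>_def by simp
        next
          case 2
          have "dist (t *\<^sub>R ctr (us n)) (t *\<^sub>R \<zeta>) = t * dist (ctr (us n)) \<zeta>"
            using 2(1) by (simp add: dist_norm scaleR_diff_right[symmetric])
          also have "\<dots> \<le> dist (ctr (us n)) \<zeta>" using 2(1) by (intro mult_left_le_one_le) auto
          finally have "dist z (t *\<^sub>R \<zeta>) < \<delta>" using n(2) 2(2) by simp
          moreover have "2 * \<delta> < dist q (t *\<^sub>R \<zeta>)" using \<zeta>(2) 2(1) by blast
          ultimately show ?thesis using dist_triangle[of q "t *\<^sub>R \<zeta>" z] by simp
        qed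
      qed
      have avoid: "v \<notin> sig p s" if "D v \<inter> L \<noteq> {}" for v
      proof
        assume "v \<in> sig p s"
        moreover obtain z where "z \<in> D v" "z \<in> L" using \<open>D v \<inter> L \<noteq> {}\<close> by blast
        ultimately show False using near away by fastforce
      qed
      define P where "P = {v. D v \<inter> L \<noteq> {}} \<inter> inside_box p s"
      have "ctr (us n) \<in> L" "ctr \<rho> \<in> L" unfolding L_def by auto
      hence mem: "us n \<in> P" "\<rho> \<in> {v. D v \<inter> L \<noteq> {}}" using n(1) centre_in_D unfolding P_def by blast+
      have "\<rho> \<notin> P" unfolding P_def using root_not_inside_box[OF s(2)] by blast
      then obtain i j where ij: "i \<in> P" "j \<in> {v. D v \<inter> L \<noteq> {}} - P" "adj i j"
        using linkedD[OF link, of P] mem unfolding P_def by blast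
      have "j \<in> inside_box p s"
        by (rule inside_box_nbr[OF s(3,2) _ _ ij(3)]) (use ij avoid in \<open>auto simp: P_def\<close>)
      thus False using ij(2) unfolding P_def by blast
    qed
    from clear show False using contra[OF \<xi>(1) _ lim(1) ev(1)] contra[OF \<xi>(2) _ lim(2) ev(2)] by blast
  qed
qed

lemma ex_centres_tendsto:
  assumes \<xi>: "norm \<xi> = 1"
  shows "\<exists>vs. (\<lambda>n::nat. ctr (vs n)) \<longlonglongrightarrow> \<xi>"
proof -
  have "\<exists>v. dist (ctr v) \<xi> < \<epsilon>" if "0 < \<epsilon>" for \<epsilon>
  proof -
    obtain \<delta> where \<delta>: "0 < \<delta>" "\<And>v. D v \<inter> cball \<xi> \<delta> \<noteq> {} \<Longrightarrow> D v \<subseteq> ball \<xi> \<epsilon>"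
      using discs_near_boundary_small[OF \<xi> \<open>0 < \<epsilon>\<close>] by blast
    define s where "s = min \<delta> (1/2)"
    have s: "0 < s" "s < 1" "s \<le> \<delta>" unfolding s_def using \<delta>(1) by auto
    obtain v where "v \<in> cross \<xi> s" using cross_meets_cofinite[OF \<xi> s(1,2), of "{}"] by blast
    moreover have "sphere \<xi> s \<subseteq> cball \<xi> \<delta>" using s(3) by auto
    ultimately have "D v \<inter> cball \<xi> \<delta> \<noteq> {}" unfolding cross_def by blast
    hence "ctr v \<in> ball \<xi> \<epsilon>" using \<delta>(2) centre_in_D by blast
    thus ?thesis by (auto simp: dist_commute)
  qed
  hence "\<forall>n::nat. \<exists>v. dist (ctr v) \<xi> < 1 / (Suc n)" by simp
  from choice[OF this] obtain vs where vs: "\<And>n::nat. dist (ctr (vs n)) \<xi> < 1 / (Suc n)" by blast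
  have "(\<lambda>n. ctr (vs n)) \<longlonglongrightarrow> \<xi>"
    by (rule tendsto_of_dist_inverse_Suc[OF vs tendsto_const])
  thus ?thesis by blast
qed

text \<open>For the converse in the first part, limit points of the centres are on the unit circle,
  as only finitely many vertices have centres in a smaller disc and \<open>y\<close> is bounded away
  from 1 on them; \<open>limit_injective\<close> makes the limit point unique. In the second part,
  the same lemma gives injectivity, a diagonal choice gives continuity, and surjectivity then
  follows on the circle.\<close>

lemma boundary_identification:
  fixes \<theta> :: "'v \<Rightarrow> real"
  assumes \<theta>: "\<And>v. \<theta> v \<in> Iv v"
  shows "(\<forall>vs :: nat \<Rightarrow> 'v. (\<exists>\<xi>\<in>sphere 0 1. (\<lambda>n. ctr (vs n)) \<longlonglongrightarrow> \<xi>) \<longleftrightarrow>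
      ((\<lambda>n. y (vs n)) \<longlonglongrightarrow> 1 \<and> (\<exists>w. (\<lambda>n. \<Phi> (\<theta> (vs n))) \<longlonglongrightarrow> w)))
    \<and> (\<exists>\<phi> \<psi>. homeomorphism (sphere 0 1) (sphere 0 1) \<phi> \<psi>
      \<and> (\<forall>(vs :: nat \<Rightarrow> 'v) \<xi>. \<xi> \<in> sphere 0 1 \<and> (\<lambda>n. ctr (vs n)) \<longlonglongrightarrow> \<xi> \<longrightarrow>
           (\<lambda>n. \<Phi> (\<theta> (vs n))) \<longlonglongrightarrow> \<phi> \<xi>))"
proof
  have conv: "\<exists>w. (\<lambda>n. \<Phi> (\<theta> (vs n))) \<longlonglongrightarrow> w"
    if "norm \<xi> = 1" "(\<lambda>n. ctr (vs n)) \<longlonglongrightarrow> \<xi>" for vs and \<xi> :: complex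
    using \<Phi>_convergent[OF that \<theta>] unfolding convergent_def .
  show "\<forall>vs :: nat \<Rightarrow> 'v. (\<exists>\<xi>\<in>sphere 0 1. (\<lambda>n. ctr (vs n)) \<longlonglongrightarrow> \<xi>) \<longleftrightarrow>
      ((\<lambda>n. y (vs n)) \<longlonglongrightarrow> 1 \<and> (\<exists>w. (\<lambda>n. \<Phi> (\<theta> (vs n))) \<longlonglongrightarrow> w))"
  proof (intro allI iffI)
    fix vs :: "nat \<Rightarrow> 'v"
    assume "\<exists>\<xi>\<in>sphere 0 1. (\<lambda>n. ctr (vs n)) \<longlonglongrightarrow> \<xi>"
    then obtain \<xi> where "norm \<xi> = 1" "(\<lambda>n. ctr (vs n)) \<longlonglongrightarrow> \<xi>" by auto
    thus "(\<lambda>n. y (vs n)) \<longlonglongrightarrow> 1 \<and> (\<exists>w. (\<lambda>n. \<Phi> (\<theta> (vs n))) \<longlonglongrightarrow> w)" using y_tendsto_1 conv by blast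
  next
    fix vs :: "nat \<Rightarrow> 'v"
    assume "(\<lambda>n. y (vs n)) \<longlonglongrightarrow> 1 \<and> (\<exists>w. (\<lambda>n. \<Phi> (\<theta> (vs n))) \<longlonglongrightarrow> w)"
    then obtain w where yl: "(\<lambda>n. y (vs n)) \<longlonglongrightarrow> 1" and wl: "(\<lambda>n. \<Phi> (\<theta> (vs n))) \<longlonglongrightarrow> w" by blast
    have subseq: "\<exists>(\<xi> :: complex) g. norm \<xi> = 1 \<and> strict_mono g \<and> (\<lambda>n. ctr (vs (f (g n)))) \<longlonglongrightarrow> \<xi>" if f: "strict_mono f" for f :: "nat \<Rightarrow> nat"
    proof -
      have "range (\<lambda>n. ctr (vs (f n))) \<subseteq> cball 0 1" using D_subset centre_in_D ball_subset_cball by fastforce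
      then obtain \<xi> g where g: "\<xi> \<in> cball 0 1" "strict_mono g" "((\<lambda>n. ctr (vs (f n))) \<circ> g) \<longlonglongrightarrow> \<xi>"
        using compact_cball[of 0 1, unfolded compact_def, rule_format, of "\<lambda>n. ctr (vs (f n))"] by fastforce
      have gl: "(\<lambda>n. ctr (vs (f (g n)))) \<longlonglongrightarrow> \<xi>" using g(3) by (simp add: o_def)
      have "norm \<xi> = 1"
      proof (rule ccontr)
        assume "norm \<xi> \<noteq> 1"
        hence lt: "norm \<xi> < 1" using g(1) by simp
        define t where "t = (1 + norm \<xi>) / 2"
        have t: "norm \<xi> < t" "t < 1" unfolding t_def using lt by auto
        define A where "A = {v. norm (ctr v) \<le> t}"
        have finA: "finite A" unfolding A_def by (rule finite_centres[OF t(2)])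
        define Y where "Y = Max (insert 0 (y ` A))"
        have "Y \<in> insert 0 (y ` A)" unfolding Y_def using finA by (intro Max_in) auto
        hence Y1: "Y < 1" using y_lt_1 by auto
        have "eventually (\<lambda>n. norm (ctr (vs (f (g n)))) < t) sequentially"
          using tendsto_norm[OF gl] t(1) by (rule order_tendstoD(2))
        moreover have "(\<lambda>n. y (vs (f (g n)))) \<longlonglongrightarrow> 1"
          using LIMSEQ_subseq_LIMSEQ[OF yl strict_mono_o[OF f g(2)]] by (simp add: o_def)
        hence "eventually (\<lambda>n. Y < y (vs (f (g n)))) sequentially" using Y1 by (rule order_tendstoD(1))
        ultimately have "eventually (\<lambda>n. False) sequentially"
        proof eventually_elim
          case (elim n)
          have "vs (f (g n)) \<in> A" unfolding A_def using elim(1) by simp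
          hence "y (vs (f (g n))) \<le> Y" unfolding Y_def using finA by (intro Max_ge) auto
          thus False using elim(2) by simp
        qed
        thus False by simp
      qed
      thus ?thesis using g(2) gl by blast
    qed
    have sub_w: "(\<lambda>n. \<Phi> (\<theta> (vs (f n)))) \<longlonglongrightarrow> w" if "strict_mono f" for f :: "nat \<Rightarrow> nat"
      using LIMSEQ_subseq_LIMSEQ[OF wl that] by (simp add: o_def)
    have id_mono: "strict_mono (\<lambda>n::nat. n)" by (simp add: strict_mono_def)
    obtain \<xi> g where \<xi>: "norm \<xi> = 1" "strict_mono g" "(\<lambda>n. ctr (vs (g n))) \<longlonglongrightarrow> \<xi>" using subseq[OF id_mono] by blast
    have "(\<lambda>n. ctr (vs n)) \<longlonglongrightarrow> \<xi>"
    proof (rule ccontr)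
      assume "\<not> (\<lambda>n. ctr (vs n)) \<longlonglongrightarrow> \<xi>"
      then obtain e where e: "0 < e" "\<And>N. \<exists>n\<ge>N. e \<le> dist (ctr (vs n)) \<xi>"
        unfolding lim_sequentially by (meson not_less)
      have "infinite {n. e \<le> dist (ctr (vs n)) \<xi>}" unfolding infinite_nat_iff_unbounded_le using e(2) by blast
      then obtain f :: "nat \<Rightarrow> nat" where f: "strict_mono f" "\<And>n. f n \<in> {n. e \<le> dist (ctr (vs n)) \<xi>}"
        using infinite_enumerate by blast
      obtain \<xi>' h where h: "norm \<xi>' = 1" "strict_mono h" "(\<lambda>n. ctr (vs (f (h n)))) \<longlonglongrightarrow> \<xi>'" using subseq[OF f(1)] by blast
      have "\<xi> = \<xi>'"
        by (rule limit_injective[OF \<xi>(1) h(1) \<xi>(3) h(3) \<theta> \<theta> sub_w[OF \<xi>(2)]])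
           (use sub_w[OF strict_mono_o[OF f(1) h(2)]] in \<open>simp add: o_def\<close>)
      moreover have "e \<le> dist \<xi>' \<xi>"
        by (rule LIMSEQ_le_const[OF tendsto_dist[OF h(3) tendsto_const]]) (use f(2) in auto)
      ultimately show False using e(1) by simp
    qed
    thus "\<exists>\<xi>\<in>sphere 0 1. (\<lambda>n. ctr (vs n)) \<longlonglongrightarrow> \<xi>" using \<xi>(1) by (intro bexI[of _ \<xi>]) auto
  qed
  have "\<forall>\<xi>. \<exists>vs. norm \<xi> = 1 \<longrightarrow> (\<lambda>n::nat. ctr (vs n)) \<longlonglongrightarrow> \<xi>" using ex_centres_tendsto by blast
  from choice[OF this] obtain V where V: "\<And>\<xi>. norm \<xi> = 1 \<Longrightarrow> (\<lambda>n. ctr (V \<xi> n)) \<longlonglongrightarrow> \<xi>" by blast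
  define \<phi> where "\<phi> \<xi> = lim (\<lambda>n. \<Phi> (\<theta> (V \<xi> n)))" for \<xi>
  have \<phi>V: "(\<lambda>n. \<Phi> (\<theta> (V \<xi> n))) \<longlonglongrightarrow> \<phi> \<xi>" if "norm \<xi> = 1" for \<xi>
    using conv[OF that V[OF that]] unfolding \<phi>_def by (metis limI)
  have \<phi>: "(\<lambda>n. \<Phi> (\<theta> (vs n))) \<longlonglongrightarrow> \<phi> \<xi>" if \<xi>: "norm \<xi> = 1" "(\<lambda>n. ctr (vs n)) \<longlonglongrightarrow> \<xi>" for vs \<xi>
  proof -
    obtain w where w: "(\<lambda>n. \<Phi> (\<theta> (vs n))) \<longlonglongrightarrow> w" using conv[OF \<xi>] by blast
    \<comment> \<open>The limit does not depend on the sequence, because vertices with discs near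
      \<open>\<xi>\<close> have nearby angles.\<close>
    have "dist w (\<phi> \<xi>) \<le> e" if "0 < e" for e
    proof -
      obtain \<delta> where \<delta>: "0 < \<delta>" "\<And>v v' x x'. D v \<subseteq> ball \<xi> \<delta> \<Longrightarrow> D v' \<subseteq> ball \<xi> \<delta> \<Longrightarrow> x \<in> Iv v \<Longrightarrow> x' \<in> Iv v'
        \<Longrightarrow> dist (\<Phi> x) (\<Phi> x') \<le> e" using Iv_near_boundary[OF \<xi>(1) \<open>0 < e\<close>] by metis
      obtain \<delta>' where \<delta>': "0 < \<delta>'" "\<And>v. D v \<inter> cball \<xi> \<delta>' \<noteq> {} \<Longrightarrow> D v \<subseteq> ball \<xi> \<delta>"
        using discs_near_boundary_small[OF \<xi>(1) \<delta>(1)] by blast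
      have ev: "eventually (\<lambda>n. D (us n) \<subseteq> ball \<xi> \<delta>) sequentially" if "(\<lambda>n. ctr (us n)) \<longlonglongrightarrow> \<xi>" for us
        using tendstoD[OF that \<delta>'(1)]
      proof eventually_elim
        case (elim n)
        hence "ctr (us n) \<in> D (us n) \<inter> cball \<xi> \<delta>'" by (intro IntI centre_in_D) (simp add: dist_commute)
        thus ?case using \<delta>'(2) by blast
      qed
      have "eventually (\<lambda>n. dist (\<Phi> (\<theta> (vs n))) (\<Phi> (\<theta> (V \<xi> n))) \<le> e) sequentially"
        using ev[OF \<xi>(2)] ev[OF V[OF \<xi>(1)]] by eventually_elim (rule \<delta>(2)[OF _ _ \<theta> \<theta>])
      thus ?thesis by (intro tendsto_upperbound[OF tendsto_dist[OF w \<phi>V[OF \<xi>(1)]]]) auto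
    qed
    hence "w = \<phi> \<xi>" by (metis dist_le_zero_iff field_le_epsilon add_0)
    thus ?thesis using w by simp
  qed
  have norm\<phi>: "norm (\<phi> \<xi>) = 1" if "norm \<xi> = 1" for \<xi>
    using tendsto_norm[OF \<phi>V[OF that]] by (simp add: LIMSEQ_const_iff)
  have inj: "inj_on \<phi> (sphere 0 1)"
  proof (rule inj_onI)
    fix \<xi> \<xi>' :: complex assume "\<xi> \<in> sphere 0 1" "\<xi>' \<in> sphere 0 1" "\<phi> \<xi> = \<phi> \<xi>'"
    hence n: "norm \<xi> = 1" "norm \<xi>' = 1" by auto
    show "\<xi> = \<xi>'"
      by (rule limit_injective[OF n V[OF n(1)] V[OF n(2)] \<theta> \<theta> \<phi>V[OF n(1)]])
         (use \<phi>V[OF n(2)] \<open>\<phi> \<xi> = \<phi> \<xi>'\<close> in simp)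
  qed
  have cont: "continuous_on (sphere 0 1) \<phi>"
    unfolding continuous_on_sequentially
  proof (intro allI ballI impI)
    fix us :: "nat \<Rightarrow> complex" and \<xi> :: complex
    assume us: "\<xi> \<in> sphere 0 1" "(\<forall>n. us n \<in> sphere 0 1) \<and> us \<longlonglongrightarrow> \<xi>"
    hence n: "norm \<xi> = 1" "\<And>k. norm (us k) = 1" by auto
    \<comment> \<open>The diagonal choice: a vertex late enough in the sequence for
      \<open>us k\<close> that both its centre and its angle are close to their limits.\<close>
    have "\<exists>v. dist (ctr v) (us k) < 1 / Suc k \<and> dist (\<Phi> (\<theta> v)) (\<phi> (us k)) < 1 / Suc k" for k
    proof -
      have "eventually (\<lambda>n. dist (ctr (V (us k) n)) (us k) < 1 / Suc k) sequentially"
        using V[OF n(2)] by (rule tendstoD) simp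
      moreover have "eventually (\<lambda>n. dist (\<Phi> (\<theta> (V (us k) n))) (\<phi> (us k)) < 1 / Suc k) sequentially"
        using \<phi>V[OF n(2)] by (rule tendstoD) simp
      ultimately show ?thesis using eventually_happens[OF eventually_conj] by force
    qed
    then obtain v where v: "\<And>k. dist (ctr (v k)) (us k) < 1 / Suc k" "\<And>k. dist (\<Phi> (\<theta> (v k))) (\<phi> (us k)) < 1 / Suc k"
      by metis
    have "(\<lambda>k. ctr (v k)) \<longlonglongrightarrow> \<xi>"
      by (rule tendsto_of_dist_inverse_Suc[OF v(1)]) (use us(2) in blast)
    hence "(\<lambda>k. \<Phi> (\<theta> (v k))) \<longlonglongrightarrow> \<phi> \<xi>" by (rule \<phi>[OF n(1)])
    thus "(\<phi> \<circ> us) \<longlonglongrightarrow> \<phi> \<xi>"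
      by (rule tendsto_of_dist_inverse_Suc[rotated]) (use v(2) in \<open>simp add: dist_commute\<close>)
  qed
  have im: "\<phi> ` sphere 0 1 \<subseteq> sphere 0 1" using norm\<phi> by auto
  have "\<phi> ` sphere 0 1 = sphere 0 1" by (rule continuous_injective_circle_surj[OF cont inj im])
  then obtain \<psi> where "homeomorphism (sphere 0 1) (sphere 0 1) \<phi> \<psi>"
    using homeomorphism_compact[OF compact_sphere cont _ inj] by blast
  thus "\<exists>\<phi> \<psi>. homeomorphism (sphere 0 1) (sphere 0 1) \<phi> \<psi>
      \<and> (\<forall>(vs :: nat \<Rightarrow> 'v) \<xi>. \<xi> \<in> sphere 0 1 \<and> (\<lambda>n. ctr (vs n)) \<longlonglongrightarrow> \<xi> \<longrightarrow>
           (\<lambda>n. \<Phi> (\<theta> (vs n))) \<longlonglongrightarrow> \<phi> \<xi>)"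
    using \<phi> by (intro exI[of _ \<phi>] exI[of _ \<psi>]) auto
qed

end

theorem theorem1p5:
  fixes adj :: "'v \<Rightarrow> 'v \<Rightarrow> bool" and c :: "'v \<Rightarrow> 'v \<Rightarrow> real" and \<rho> :: 'v
    and pos :: "'v \<Rightarrow> complex" and ep :: "'v \<Rightarrow> 'v \<Rightarrow> real \<Rightarrow> complex"
    and a :: "'v \<Rightarrow> 'v \<Rightarrow> real" and \<theta> :: "'v \<Rightarrow> real"
    and ctr :: "'v \<Rightarrow> complex" and r :: "'v \<Rightarrow> real"
  assumes "is_network adj c" and "simple_graph adj" and "bounded_local_geometry adj c"
    and "transient adj c \<rho>"
    and "proper_plane_triangulation adj pos ep"
    and "rectangle_tiling adj c \<rho> pos ep a"
    and "\<forall>v. \<theta> v \<in> tile_Iv adj c \<rho> a v"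
    and "circle_packing_disc adj pos ep ctr r"
  shows "(\<forall>vs :: nat \<Rightarrow> 'v.
            (\<exists>\<xi>\<in>sphere 0 1. (\<lambda>n. ctr (vs n)) \<longlonglongrightarrow> \<xi>) \<longleftrightarrow>
            ((\<lambda>n. escape adj c \<rho> (vs n)) \<longlonglongrightarrow> 1
             \<and> (\<exists>w. (\<lambda>n. to_circle (eta adj c \<rho>) (\<theta> (vs n))) \<longlonglongrightarrow> w)))
       \<and> (\<exists>\<phi> \<psi>. homeomorphism (sphere 0 1) (sphere 0 1) \<phi> \<psi>
            \<and> (\<forall>(vs :: nat \<Rightarrow> 'v) \<xi>. \<xi> \<in> sphere 0 1 \<and> (\<lambda>n. ctr (vs n)) \<longlonglongrightarrow> \<xi> \<longrightarrow>
                 (\<lambda>n. to_circle (eta adj c \<rho>) (\<theta> (vs n))) \<longlonglongrightarrow> \<phi> \<xi>))"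
proof -
  obtain M where M: "M > 0" "\<And>v. real (card (nbrs adj v)) \<le> M" "\<And>u v. adj u v \<Longrightarrow> inverse M \<le> c u v \<and> c u v \<le> M"
    using assms(3) unfolding bounded_local_geometry_def by blast
  have inf: "infinite (UNIV :: 'v set)" by (rule infinite_of_circle_packing[OF assms(8)])
  interpret network adj c \<rho> M
    by unfold_locales (fact assms(1) assms(2) M inf)+
  interpret tiled_network adj c \<rho> M pos ep ctr r a
    by unfold_locales (use assms adj_sym irrefl inf finite_nbrs ex_nbr in auto)
  show ?thesis using assms(7) by (intro boundary_identification) blast
qed

end
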